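(* Let $t_0\in(0,1)$, let $c_0,c_1\in\mathbb R$ with $c_0>c_1$, and let $$g_{t_0}(t)=c_0\mathbf 1_{[0,t_0]}(t)+c_1\mathbf 1_{(t_0,1]}(t),\quad t\in[0,1].$$ Let $0\le t_{n1}\le\dots\le t_{nn}\le1$, $n\in\mathbb N$, be a triangular array of design points which is an asymptotic $q$-design for some $q\in(0,1)$, i.e. $$\lim_{n\to\infty}\frac{\#\{i: 1\le i\le n,\ t_{ni}\le t_0\}}{n}=q .$$ For the constant regression model let $\vec e^{\,n}=(e_{n2},\dots,e_{nn})^\top$ be the vector of the $n-1$ recursive least squares residuals, and suppose that the local alternative $\frac{1}{\sqrt{n-1}}\,g_{t_0}$ is true, i.e. $Y_{nj}=\frac{1}{\sqrt{n-1}}g_{t_0}(t_{nj})+\varepsilon_{nj}$ for $1\le j\le n$, $n\ge2$. Then, as $n\to\infty$, the process $\frac{1}{\sqrt{n-1}}T_{n-1}(\vec e^{\,n})(z)$, $z\in[0,1]$, converges weakly to $h(z)+B(z)$, $z\in[0,1]$, where $B$ is standard Brownian motion on $[0,1]$ and $$h(z)=q(c_1-c_0)\big(\ln(z)-\ln(q)\big)\mathbf 1_{(q,1]}(z),\quad z\in[0,1].$$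
   Context: Errors: $\varepsilon_{n1},\dots,\varepsilon_{nn}$, $n\in\mathbb N$, is a triangular array of real random variables such that, for each $n\in\mathbb N$, $\varepsilon_{n1},\dots,\varepsilon_{nn}$ are iid with $E(\varepsilon_{ni})=0$ and $\mathrm{Var}(\varepsilon_{ni})=1$. Constant regression model: the linear regression model with $d=1$ known regression function $f=\mathbf 1_{[0,1]}$ (identically $1$ on $[0,1]$); recursive residuals are always computed with respect to this model, whatever the true mean function is. Recursive residuals: in general, with regression functions $f=(f_1,\dots,f_d)^\top$, $X^n_i=(f(t_{n1}),\dots,f(t_{ni}))^\top$, and $\hat\beta^n_i$ the least squares estimate of $\beta$ from the first $i$ observations $Y_{n1},\dots,Y_{ni}$, $$e_{ni}=\frac{Y_{ni}-f(t_{ni})^\top\hat\beta^n_{i-1}}{\big(1+f(t_{ni})^\top((X^n_{i-1})^\top X^n_{i-1})^{-1}f(t_{ni})\big)^{1/2}},\quad i=d+1,\dots,n.$$ For the constant regression model ($d=1$, $f\equiv1$) this reads $$e_{ni}=\frac{Y_{ni}-\frac1{i-1}\sum_{j=1}^{i-1}Y_{nj}}{\left(1+\frac1{i-1}\right)^{1/2}},\quad i=2,\dots,n.$$ Partial sum operator: for $m\in\mathbb N$, $T_m:\mathbb R^m\to C[0,1]$ maps $\mathbf a=(a_1,\dots,a_m)^\top$ to the function $$T_m(\mathbf a)(z)=\sum_{i=1}^{[mz]}a_i+(mz-[mz])\,a_{[mz]+1},\quad z\in[0,1],$$ where $[s]=\max\{k\in\mathbb N_0: k\le s\}$ and $\sum_{i=1}^0a_i=0$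 (at $z=1$ the second summand is $0$). Weak convergence is convergence in distribution of random elements of $C[0,1]$ with the supremum norm. The function $h$ is understood to be $0$ on $[0,q]$ (in particular at $z=0$).
   Formalization: The Lindeberg condition is assumed for the errors (automatic if their law does not depend on n); without it the claim fails, e.g. for errors ±√n with probability 1/(2n) each and 0 otherwise. *)

theory Defs
  imports "HOL-Probability.Probability"
begin

subsection \<open>Recursive residuals\<close>

text \<open>
  The regression functions are given by \<open>f :: real \<Rightarrow> real ^ 'd\<close>, the design points and observations
  by sequences of which only the entries with index \<open>\<ge> 1\<close> are used.
\<close>

definition least_squares :: "(real \<Rightarrow> real ^ 'd) \<Rightarrow> (nat \<Rightarrow> real) \<Rightarrow> (nat \<Rightarrow> real) \<Rightarrow> nat \<Rightarrow> real ^ 'd" where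
  "least_squares f t y i = arg_min (\<lambda>\<beta>. \<Sum>j=1..i. (y j - f (t j) \<bullet> \<beta>)\<^sup>2) (\<lambda>_. True)"

text \<open>This is \<open>X\<^sup>T X\<close> for the design matrix \<open>X\<close> with rows \<open>f (t 1), \<dots>, f (t i)\<close>.\<close>

definition gram :: "(real \<Rightarrow> real ^ 'd) \<Rightarrow> (nat \<Rightarrow> real) \<Rightarrow> nat \<Rightarrow> real ^ 'd ^ 'd" where
  "gram f t i = (\<chi> k l. \<Sum>j=1..i. f (t j) $ k * f (t j) $ l)"

definition recursive_residual ::
  "(real \<Rightarrow> real ^ 'd) \<Rightarrow> (nat \<Rightarrow> real) \<Rightarrow> (nat \<Rightarrow> real) \<Rightarrow> nat \<Rightarrow> real" where
  "recursive_residual f t y i =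
     (y i - f (t i) \<bullet> least_squares f t y (i - 1)) /
     sqrt (1 + f (t i) \<bullet> (matrix_inv (gram f t (i - 1)) *v f (t i)))"

definition constant_regression :: "real \<Rightarrow> real ^ 1" where
  "constant_regression = (\<lambda>s. vec (indicator {0..1} s))"

lemma recursive_residual_constant_regression:
  assumes i: "2 \<le> i" and t: "\<And>j. 1 \<le> j \<Longrightarrow> j \<le> i \<Longrightarrow> t j \<in> {0..1}"
  shows "recursive_residual constant_regression t y i =
    (y i - (\<Sum>j=1..i-1. y j) / (real i - 1)) / sqrt (1 + 1 / (real i - 1))"
proof -
  define m where "m = real (i - 1)"
  have m: "m > 0" "m = real i - 1" using i by (auto simp: m_def)
  have f: "constant_regression (t j) = 1" if "j \<in> {1..i}" for j
    using t[of j] that by (simp add: constant_regression_def vec_eq_iff)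
  define \<mu> where "\<mu> = (\<Sum>j=1..i-1. y j) / m"
  let ?S = "\<lambda>\<beta>::real^1. \<Sum>j=1..i-1. (y j - constant_regression (t j) \<bullet> \<beta>)\<^sup>2"
  have S: "?S \<beta> = ?S (vec \<mu>) + m * (\<beta> $ 1 - \<mu>)\<^sup>2" for \<beta>
  proof -
    have S': "?S \<gamma> = (\<Sum>j=1..i-1. (y j)\<^sup>2) - 2 * \<gamma> $ 1 * (m * \<mu>) + m * (\<gamma> $ 1)\<^sup>2" for \<gamma>
    proof -
      have "?S \<gamma> = (\<Sum>j=1..i-1. (y j)\<^sup>2 - 2 * \<gamma> $ 1 * y j + (\<gamma> $ 1)\<^sup>2)"
        by (intro sum.cong) (auto simp: f inner_vec_def power2_diff algebra_simps)
      also have "\<dots> = (\<Sum>j=1..i-1. (y j)\<^sup>2) - 2 * \<gamma> $ 1 * (\<Sum>j=1..i-1. y j) + m * (\<gamma> $ 1)\<^sup>2"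
        by (simp add: sum.distrib sum_subtractf sum_distrib_left m_def)
      also have "(\<Sum>j=1..i-1. y j) = m * \<mu>" using m by (simp add: \<mu>_def)
      finally show ?thesis .
    qed
    show ?thesis unfolding S' by (simp add: power2_eq_square algebra_simps)
  qed
  have min: "?S (least_squares constant_regression t y (i - 1)) = ?S (vec \<mu>)"
    unfolding least_squares_def
  proof (rule arg_min_equality)
    fix \<beta> :: "real ^ 1" show "?S (vec \<mu>) \<le> ?S \<beta>" using m by (subst S[of \<beta>]) simp
  qed simp
  have ls: "least_squares constant_regression t y (i - 1) $ 1 = \<mu>"
    using min m by (subst (asm) S) simp
  have "gram constant_regression t (i - 1) $ 1 $ 1 = (\<Sum>j=1..i-1. 1)"
    unfolding gram_def vec_lambda_beta by (intro sum.cong refl) (auto simp: f)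
  then have "gram constant_regression t (i - 1) = mat m"
    by (simp add: mat_def vec_eq_iff m_def)
  moreover have "matrix_inv (mat m :: real^1^1) $ 1 $ 1 = 1 / m"
  proof -
    have "(mat m :: real^1^1) ** mat (1 / m) = mat 1" "(mat (1 / m) :: real^1^1) ** mat m = mat 1"
      using m by (simp_all add: matrix_matrix_mult_def mat_def vec_eq_iff)
    then have "(mat m :: real^1^1) ** matrix_inv (mat m) = mat 1"
      by (metis (mono_tags, lifting) matrix_inv_def someI_ex)
    then have "m * matrix_inv (mat m :: real^1^1) $ 1 $ 1 = 1"
      by (simp add: matrix_matrix_mult_def mat_def vec_eq_iff)
    then show ?thesis using m(1) by (simp add: field_simps)
  qed
  ultimately show ?thesis
    using i m(2)[symmetric] f[of i] ls
    by (simp add: recursive_residual_def inner_vec_def matrix_vector_mult_def \<mu>_def)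
qed

subsection \<open>Partial sums and the change-point model\<close>

definition C01 :: "(real \<Rightarrow> real) metric" where
  "C01 = cfunspace (top_of_set {0..1}) euclidean_metric"

text \<open>
  A vector in \<open>\<real>\<^sup>m\<close> is the sequence of its entries \<open>a 1, \<dots>, a m\<close>. The value \<open>a (m + 1)\<close> occurs
  only with factor \<open>0\<close>. Elements of \<^const>\<open>C01\<close> are extensional on \<open>{0..1}\<close>.
\<close>

definition partial_sum :: "nat \<Rightarrow> (nat \<Rightarrow> real) \<Rightarrow> real \<Rightarrow> real" where
  "partial_sum m a = (\<lambda>z\<in>{0..1}.
     (\<Sum>i=1..nat \<lfloor>real m * z\<rfloor>. a i) +
     (real m * z - of_int \<lfloor>real m * z\<rfloor>) * a (nat \<lfloor>real m * z\<rfloor> + 1))"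

definition jump_function :: "real \<Rightarrow> real \<Rightarrow> real \<Rightarrow> real \<Rightarrow> real" where
  "jump_function t\<^sub>0 c\<^sub>0 c\<^sub>1 s = c\<^sub>0 * indicator {0..t\<^sub>0} s + c\<^sub>1 * indicator {t\<^sub>0<..1} s"

definition asymptotic_design :: "(nat \<Rightarrow> nat \<Rightarrow> real) \<Rightarrow> real \<Rightarrow> real \<Rightarrow> bool" where
  "asymptotic_design t t\<^sub>0 q \<longleftrightarrow>
     (\<lambda>n. real (card {i \<in> {1..n}. t n i \<le> t\<^sub>0}) / real n) \<longlonglongrightarrow> q"

definition limit_drift :: "real \<Rightarrow> real \<Rightarrow> real \<Rightarrow> real \<Rightarrow> real" where
  "limit_drift q c\<^sub>0 c\<^sub>1 z = q * (c\<^sub>1 - c\<^sub>0) * (ln z - ln q) * indicator {q<..1} z"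

subsection \<open>Error arrays\<close>

text \<open>
  Row \<open>n\<close> of the array lives on its own probability space \<open>M n\<close>; taking \<open>M\<close> constant gives an
  array on a single space.
\<close>

definition iid_row :: "'a measure \<Rightarrow> nat \<Rightarrow> (nat \<Rightarrow> 'a \<Rightarrow> real) \<Rightarrow> bool" where
  "iid_row M n X \<longleftrightarrow>
     prob_space.indep_vars M (\<lambda>_. borel) X {1..n} \<and>
     (\<forall>i\<in>{1..n}. \<forall>j\<in>{1..n}. distr M borel (X i) = distr M borel (X j))"

text \<open>
  Since the common law of a row may vary with the row, mean \<open>0\<close> and variance \<open>1\<close> do not suffice for
  a Gaussian limit: if the entries of row \<open>n\<close> take the values \<open>\<plusminus> sqrt n\<close> with probability
  \<open>1 / (2 n)\<close> each and \<open>0\<close> otherwise, the normalised row sums have a compound Poisson limit.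
\<close>

definition lindeberg :: "(nat \<Rightarrow> 'a measure) \<Rightarrow> (nat \<Rightarrow> nat \<Rightarrow> 'a \<Rightarrow> real) \<Rightarrow> bool" where
  "lindeberg M \<epsilon> \<longleftrightarrow> (\<forall>\<delta>>0.
     (\<lambda>n. (\<Sum>i=1..n. \<integral>\<omega>. (\<epsilon> n i \<omega>)\<^sup>2 * indicator {x. \<delta> * sqrt (real n) < \<bar>x\<bar>} (\<epsilon> n i \<omega>) \<partial>M n) / real n)
       \<longlonglongrightarrow> 0)"

text \<open>The condition holds automatically if the law of the entries does not depend on the row.\<close>

lemma lindeberg_common_law:
  assumes meas: "\<And>n i. 1 \<le> i \<Longrightarrow> i \<le> n \<Longrightarrow> \<epsilon> n i \<in> borel_measurable (M n)"
    and law: "\<And>n i. 1 \<le> i \<Longrightarrow> i \<le> n \<Longrightarrow> distr (M n) borel (\<epsilon> n i) = F"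
    and sq: "integrable F (\<lambda>x. x\<^sup>2)"
  shows "lindeberg M \<epsilon>"
  unfolding lindeberg_def
proof (intro allI impI)
  fix \<delta> :: real assume \<delta>: "\<delta> > 0"
  let ?g = "\<lambda>n x::real. x\<^sup>2 * indicator {x. \<delta> * sqrt (real n) < \<bar>x\<bar>} x"
  have sets: "sets F = sets borel"
    using law[of 1 1] by (metis le_refl sets_distr)
  have "(\<lambda>n. \<integral>x. ?g n x \<partial>F) \<longlonglongrightarrow> (\<integral>x. 0 \<partial>F)"
  proof (rule integral_dominated_convergence[where w = "\<lambda>x. x\<^sup>2"])
    show "AE x in F. (\<lambda>n. ?g n x) \<longlonglongrightarrow> 0"
    proof (intro AE_I2 tendsto_eventually)
      fix x :: real
      have "filterlim (\<lambda>n. \<delta> * sqrt (real n)) at_top sequentially"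
        using \<delta> by (intro filterlim_tendsto_pos_mult_at_top[OF tendsto_const]
            filterlim_compose[OF sqrt_at_top] filterlim_real_sequentially)
      then have "\<forall>\<^sub>F n in sequentially. \<bar>x\<bar> \<le> \<delta> * sqrt (real n)"
        by (simp add: filterlim_at_top)
      then show "\<forall>\<^sub>F n in sequentially. ?g n x = 0"
        by eventually_elim (simp add: indicator_def)
    qed
  qed (use sq in \<open>auto simp: measurable_cong_sets[OF sets refl] indicator_def\<close>)
  then have lim: "(\<lambda>n. \<integral>x. ?g n x \<partial>F) \<longlonglongrightarrow> 0" by simp
  have eq: "(\<Sum>i=1..n. \<integral>\<omega>. ?g n (\<epsilon> n i \<omega>) \<partial>M n) / real n = (\<integral>x. ?g n x \<partial>F)" if "n \<ge> 1" for n
  proof -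
    have "(\<integral>\<omega>. ?g n (\<epsilon> n i \<omega>) \<partial>M n) = (\<integral>x. ?g n x \<partial>F)" if "i \<in> {1..n}" for i
    proof -
      have "(\<integral>x. ?g n x \<partial>distr (M n) borel (\<epsilon> n i)) = (\<integral>\<omega>. ?g n (\<epsilon> n i \<omega>) \<partial>M n)"
        using that by (intro integral_distr meas) auto
      then show ?thesis using that by (simp add: law)
    qed
    then show ?thesis using that by simp
  qed
  show "(\<lambda>n. (\<Sum>i=1..n. \<integral>\<omega>. ?g n (\<epsilon> n i \<omega>) \<partial>M n) / real n) \<longlonglongrightarrow> 0"
    by (rule Lim_transform_eventually[OF lim])
       (use eq in \<open>auto simp: eventually_sequentially intro!: exI[of _ 1]\<close>)
qed

subsection \<open>Weak convergence and Brownian motion\<close>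

definition borel_metric :: "'b metric \<Rightarrow> 'b measure" where
  "borel_metric m = sigma (mspace m) {U. openin (mtopology_of m) U}"

definition converges_weakly ::
  "'b metric \<Rightarrow> (nat \<Rightarrow> 'a measure) \<Rightarrow> (nat \<Rightarrow> 'a \<Rightarrow> 'b) \<Rightarrow> 'c measure \<Rightarrow> ('c \<Rightarrow> 'b) \<Rightarrow> bool" where
  "converges_weakly m M X N Z \<longleftrightarrow>
     (\<forall>n\<ge>1. X n \<in> M n \<rightarrow>\<^sub>M borel_metric m) \<and> Z \<in> N \<rightarrow>\<^sub>M borel_metric m \<and>
     (\<forall>\<phi>. continuous_map (mtopology_of m) euclideanreal \<phi> \<and> bounded (\<phi> ` mspace m) \<longrightarrow>
        (\<lambda>n. \<integral>\<omega>. \<phi> (X n \<omega>) \<partial>M n) \<longlonglongrightarrow> (\<integral>\<omega>. \<phi> (Z \<omega>) \<partial>N))"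

definition standard_brownian_motion :: "'a measure \<Rightarrow> (real \<Rightarrow> 'a \<Rightarrow> real) \<Rightarrow> bool" where
  "standard_brownian_motion N B \<longleftrightarrow>
     prob_space N \<and>
     (\<forall>s\<in>{0..1}. B s \<in> borel_measurable N) \<and>
     (\<forall>\<omega>\<in>space N. continuous_on {0..1} (\<lambda>s. B s \<omega>)) \<and>
     (AE \<omega> in N. B 0 \<omega> = 0) \<and>
     (\<forall>s u. 0 \<le> s \<and> s < u \<and> u \<le> 1 \<longrightarrow>
        distributed N lborel (\<lambda>\<omega>. B u \<omega> - B s \<omega>) (normal_density 0 (sqrt (u - s)))) \<and>
     (\<forall>k \<tau>. mono_on {..k} \<tau> \<and> \<tau> ` {..k} \<subseteq> {0..1} \<longrightarrow>
        prob_space.indep_vars N (\<lambda>_. borel) (\<lambda>i \<omega>. B (\<tau> (Suc i)) \<omega> - B (\<tau> i) \<omega>) {..<k :: nat})"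

end

theory Submission
  imports Defs "HOL-Real_Asymp.Real_Asymp"
begin

text \<open>
  The residuals are linear in the observations, so the process is a deterministic drift plus the
  residual partial sums of the errors. On the drift side the residuals of a step function are
  \<open>K * (c\<^sub>1 - c\<^sub>0) / sqrt (k * (k + 1))\<close> after the jump at index \<open>K\<close>, which sum to a logarithm.

  For the errors, the residual coefficients are orthonormal, so a linear combination of residuals has
  the same variance as if the residuals were independent, and Lindeberg's argument for characteristic
  functions gives the finite-dimensional limits of Brownian motion. No Prokhorov theorem is needed: a
  bounded Lipschitz functional of a path is compared with its value at the polygon through the grid
  points \<open>j / m\<close>. The distance to the polygon is small uniformly in \<open>n\<close> because the \<open>k\<close>-th residual is
  the error \<open>\<epsilon>\<^sub>k\<^sub>+\<^sub>1\<close> minus a term of second moment at most \<open>2 / k\<close>; the plain partial sums are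
  controlled by Ottaviani's inequality and the remaining terms by a weighted Cauchy-Schwarz inequality.
\<close>

subsection \<open>Weak convergence in a metric space\<close>

text \<open>The residuals of the errors are uncorrelated but in general not independent, so a
  maximal inequality for independent summands cannot be applied to their partial sums. This forces
  the splitting into partial sums of the errors themselves and a remainder that second moments alone
  can control. Only second moments of the errors are available. Chebyshev's inequality on each of
  the \<open>m\<close> blocks gives a bound of order \<open>1 / m\<close>, and the sum over the
  blocks does not become small. The required gain comes from the limit law: with \<open>m\<close>
  fixed, a block sum converges to a normal variable with fourth moment \<open>3 / m ^ 2\<close>, so
  the exceptional probabilities add up to order \<open>1 / m\<close>. Hence the order of limits
  throughout: \<open>n\<close> tends to infinity for fixed \<open>m\<close>, and \<open>m\<close> is
  enlarged afterwards. With \<open>m\<close> fixed, a Lipschitz functional of the polygon is a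
  continuous function of \<open>m\<close> increments. Convergence of characteristic functions passes
  to such functions by the Stone-Weierstrass theorem on a large box, and uniform second moment
  bounds control the mass outside the box.\<close>

lemma openin_mtopology_of_iff:
  "openin (mtopology_of m) U \<longleftrightarrow>
    U \<subseteq> mspace m \<and> (\<forall>x\<in>U. \<exists>r>0. \<forall>y\<in>mspace m. mdist m x y < r \<longrightarrow> y \<in> U)"
proof -
  interpret Metric_space "mspace m" "mdist m" by simp
  have "mball x r \<subseteq> U \<longleftrightarrow> (\<forall>y\<in>mspace m. mdist m x y < r \<longrightarrow> y \<in> U)" if "x \<in> mspace m" for x r
    using that by (auto simp: mball_def)
  then show ?thesis
    unfolding mtopology_of_def openin_mtopology by (meson subsetD)
qed

lemma continuous_map_mtopology_of_iff:
  fixes \<phi> :: "'b \<Rightarrow> real"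
  shows "continuous_map (mtopology_of m) euclideanreal \<phi> \<longleftrightarrow>
    (\<forall>x\<in>mspace m. \<forall>e>0. \<exists>d>0. \<forall>y\<in>mspace m. mdist m x y < d \<longrightarrow> \<bar>\<phi> y - \<phi> x\<bar> < e)"
    (is "?L \<longleftrightarrow> ?R")
proof
  assume L: ?L
  show ?R
  proof (intro ballI allI impI)
    fix x e assume x: "x \<in> mspace m" and e: "e > (0::real)"
    have "openin (mtopology_of m) {y \<in> topspace (mtopology_of m). \<phi> y \<in> ball (\<phi> x) e}"
      using L by (rule openin_continuous_map_preimage) simp
    then show "\<exists>d>0. \<forall>y\<in>mspace m. mdist m x y < d \<longrightarrow> \<bar>\<phi> y - \<phi> x\<bar> < e"
      using x e by (force simp: openin_mtopology_of_iff dist_real_def abs_minus_commute)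
  qed


next
  assume R: ?R
  show ?L
    unfolding continuous_map_def openin_mtopology_of_iff
  proof (intro conjI allI impI ballI)
    fix U and x assume U: "openin euclideanreal U" and x: "x \<in> {x \<in> topspace (mtopology_of m). \<phi> x \<in> U}"
    then obtain e where e: "e > 0" "ball (\<phi> x) e \<subseteq> U"
      using openE[of U "\<phi> x"] by auto
    from x have "x \<in> mspace m" by simp
    with R e(1) obtain d where "d > 0" "\<forall>y\<in>mspace m. mdist m x y < d \<longrightarrow> \<bar>\<phi> y - \<phi> x\<bar> < e"
      by blast
    then show "\<exists>r>0. \<forall>y\<in>mspace m. mdist m x y < r \<longrightarrow> y \<in> {x \<in> topspace (mtopology_of m). \<phi> x \<in> U}"
      using e by (intro exI[of _ d]) (auto simp: subset_iff dist_real_def abs_minus_commute)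
  qed auto
qed

lemma space_borel_metric: "space (borel_metric m) = mspace m"
  unfolding borel_metric_def by (intro space_measure_of) (auto dest!: openin_subset)

lemma sets_borel_metric_openin: "openin (mtopology_of m) U \<Longrightarrow> U \<in> sets (borel_metric m)"
  unfolding borel_metric_def by (intro in_measure_of) (auto dest!: openin_subset)

lemma measurable_borel_metricI:
  assumes "\<And>\<omega>. \<omega> \<in> space M \<Longrightarrow> X \<omega> \<in> mspace m"
    and "\<And>U. openin (mtopology_of m) U \<Longrightarrow> X -` U \<inter> space M \<in> sets M"
  shows "X \<in> M \<rightarrow>\<^sub>M borel_metric m"
  unfolding borel_metric_def
  by (rule measurable_measure_of) (use assms in \<open>auto dest!: openin_subset\<close>)

lemma measurable_borel_metric_continuous:
  fixes \<phi> :: "'b \<Rightarrow> real"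
  assumes X: "X \<in> M \<rightarrow>\<^sub>M borel_metric m" and \<phi>: "continuous_map (mtopology_of m) euclideanreal \<phi>"
  shows "(\<lambda>\<omega>. \<phi> (X \<omega>)) \<in> borel_measurable M"
proof -
  have "\<phi> \<in> borel_metric m \<rightarrow>\<^sub>M borel"
  proof (rule borel_measurableI)
    fix S :: "real set" assume "open S"
    then have "openin (mtopology_of m) {x \<in> topspace (mtopology_of m). \<phi> x \<in> S}"
      using \<phi> by (intro openin_continuous_map_preimage) auto
    moreover have "{x \<in> topspace (mtopology_of m). \<phi> x \<in> S} = \<phi> -` S \<inter> space (borel_metric m)"
      by (auto simp: space_borel_metric)
    ultimately show "\<phi> -` S \<inter> space (borel_metric m) \<in> sets (borel_metric m)"
      using sets_borel_metric_openin by metis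
  qed
  then show ?thesis
    using measurable_compose[OF X] by blast
qed

lemma measurable_in_mspace:
  "X \<in> M \<rightarrow>\<^sub>M borel_metric m \<Longrightarrow> \<omega> \<in> space M \<Longrightarrow> X \<omega> \<in> mspace m"
  using measurable_space space_borel_metric by metis

lemma continuous_map_lipschitz:
  fixes \<phi> :: "'b \<Rightarrow> real"
  assumes "\<And>x y. x \<in> mspace m \<Longrightarrow> y \<in> mspace m \<Longrightarrow> \<bar>\<phi> x - \<phi> y\<bar> \<le> L * mdist m x y"
  shows "continuous_map (mtopology_of m) euclideanreal \<phi>"
  unfolding continuous_map_mtopology_of_iff
proof (intro ballI allI impI)
  fix x and e :: real assume x: "x \<in> mspace m" and e: "e > 0"
  \<comment> \<open>Nothing is assumed about the sign of \<open>L\<close>;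
    \<open>\<bar>L\<bar> + 1\<close> is positive and dominates it.\<close>
  have "\<bar>\<phi> y - \<phi> x\<bar> < e" if y: "y \<in> mspace m" "mdist m x y < e / (\<bar>L\<bar> + 1)" for y
  proof -
    have "\<bar>\<phi> y - \<phi> x\<bar> \<le> L * mdist m x y"
      using assms[OF x y(1)] by (simp add: abs_minus_commute)
    also have "\<dots> \<le> (\<bar>L\<bar> + 1) * mdist m x y"
      by (intro mult_right_mono) auto
    also have "\<dots> < e" using y(2) by (simp add: field_simps)
    finally show ?thesis .
  qed
  then show "\<exists>d>0. \<forall>y\<in>mspace m. mdist m x y < d \<longrightarrow> \<bar>\<phi> y - \<phi> x\<bar> < e"
    using e by (intro exI[of _ "e / (\<bar>L\<bar> + 1)"]) auto
qed

text \<open>The distance to the complement of an open set is positive exactly on that set.\<close>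

lemma measurable_borel_metric_limit:
  assumes X: "\<And>k::nat. X k \<in> M \<rightarrow>\<^sub>M borel_metric m"
    and Z: "\<And>\<omega>. \<omega> \<in> space M \<Longrightarrow> Z \<omega> \<in> mspace m"
    and lim: "\<And>\<omega>. \<omega> \<in> space M \<Longrightarrow> (\<lambda>k. mdist m (X k \<omega>) (Z \<omega>)) \<longlonglongrightarrow> 0"
  shows "Z \<in> M \<rightarrow>\<^sub>M borel_metric m"
proof (rule measurable_borel_metricI[OF Z])
  fix U assume U: "openin (mtopology_of m) U"
  show "Z -` U \<inter> space M \<in> sets M"
  proof (cases "U = mspace m")
    case True
    then have "Z -` U \<inter> space M = space M" using Z by auto
    then show ?thesis by simp
  next
    case False
    \<comment> \<open>The whole space was split off because its complement is empty and the infimum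
      below would then range over nothing.\<close>
    define C where "C = mspace m - U"
    have C: "C \<noteq> {}" "C \<subseteq> mspace m" "U \<subseteq> mspace m"
      using False openin_subset[OF U] by (auto simp: C_def)
    define \<phi> where "\<phi> x = (INF c\<in>C. mdist m x c)" for x
    have bdd: "bdd_below ((\<lambda>c. mdist m x c) ` C)" for x
      by (intro bdd_belowI2[of _ 0]) simp
    have lip1: "\<phi> x \<le> \<phi> y + mdist m x y" if "x \<in> mspace m" "y \<in> mspace m" for x y
    proof -
      have "\<phi> x - mdist m x y \<le> \<phi> y"
        unfolding \<phi>_def[of y]
      proof (rule cINF_greatest[OF C(1)])
        fix c assume c: "c \<in> C"
        have "\<phi> x \<le> mdist m x c" unfolding \<phi>_def by (rule cINF_lower[OF bdd c])
        also have "\<dots> \<le> mdist m x y + mdist m y c"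
          using c C that by (intro mdist_triangle) auto
        finally show "\<phi> x - mdist m x y \<le> mdist m y c" by simp
      qed
      then show ?thesis by simp
    qed
    have lip: "\<bar>\<phi> x - \<phi> y\<bar> \<le> 1 * mdist m x y" if "x \<in> mspace m" "y \<in> mspace m" for x y
      using lip1[OF that] lip1[OF that(2,1)] mdist_commute[of m x y] by linarith
    have pos: "x \<in> U \<longleftrightarrow> \<phi> x > 0" if x: "x \<in> mspace m" for x
    proof
      assume "x \<in> U"
      with U obtain r where r: "r > 0" "\<forall>y\<in>mspace m. mdist m x y < r \<longrightarrow> y \<in> U"
        unfolding openin_mtopology_of_iff by blast
      have "r \<le> \<phi> x"
        unfolding \<phi>_def using r(2) by (intro cINF_greatest[OF C(1)]) (force simp: C_def)
      then show "\<phi> x > 0" using r by simp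
    next
      assume "\<phi> x > 0"
      show "x \<in> U"
      proof (rule ccontr)
        assume "x \<notin> U"
        then have "x \<in> C" using x by (simp add: C_def)
        then have "\<phi> x \<le> mdist m x x" unfolding \<phi>_def by (rule cINF_lower[OF bdd])
        moreover have "mdist m x x = 0" using x by simp
        ultimately show False using \<open>\<phi> x > 0\<close> by simp
      qed
    qed
    have "(\<lambda>\<omega>. \<phi> (Z \<omega>)) \<in> borel_measurable M"
    proof (rule borel_measurable_LIMSEQ_real)
      show "(\<lambda>\<omega>. \<phi> (X k \<omega>)) \<in> borel_measurable M" for k
        by (rule measurable_borel_metric_continuous[OF X continuous_map_lipschitz[OF lip]])
      fix \<omega> assume \<omega>: "\<omega> \<in> space M"
      show "(\<lambda>k. \<phi> (X k \<omega>)) \<longlonglongrightarrow> \<phi> (Z \<omega>)"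
      proof (rule LIM_zero_cancel, rule Lim_null_comparison[OF _ lim[OF \<omega>]])
        show "\<forall>\<^sub>F k in sequentially. norm (\<phi> (X k \<omega>) - \<phi> (Z \<omega>)) \<le> mdist m (X k \<omega>) (Z \<omega>)"
          using lip[OF measurable_in_mspace[OF X \<omega>] Z[OF \<omega>]] by simp
      qed
    qed
    then have "{\<omega> \<in> space M. \<phi> (Z \<omega>) > 0} \<in> sets M" by simp
    also have "{\<omega> \<in> space M. \<phi> (Z \<omega>) > 0} = Z -` U \<inter> space M"
      using pos Z by auto
    finally show ?thesis .
  qed
qed

lemma integrable_bounded_borel_metric:
  fixes \<phi> :: "'b \<Rightarrow> real"
  assumes "prob_space M" "X \<in> M \<rightarrow>\<^sub>M borel_metric m"
    and \<phi>: "continuous_map (mtopology_of m) euclideanreal \<phi>" "\<And>x. x \<in> mspace m \<Longrightarrow> \<bar>\<phi> x\<bar> \<le> K"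
  shows "integrable M (\<lambda>\<omega>. \<phi> (X \<omega>))"
proof -
  interpret prob_space M by fact
  show ?thesis
    using measurable_borel_metric_continuous[OF assms(2) \<phi>(1)] measurable_in_mspace[OF assms(2)] \<phi>(2)
    by (intro integrable_const_bound[where B = K] AE_I2) auto
qed

text \<open>The Pasch-Hausdorff envelope (inf-convolution with \<open>k\<close> times the metric):
  for bounded \<phi> it is the largest \<open>k\<close>-Lipschitz function below \<phi>. As
  \<open>k\<close> grows it tends to \<phi> pointwise wherever \<phi> is continuous.\<close>

definition lipschitz_minorant :: "'b metric \<Rightarrow> ('b \<Rightarrow> real) \<Rightarrow> nat \<Rightarrow> 'b \<Rightarrow> real" where
  "lipschitz_minorant m \<phi> k x = (INF y\<in>mspace m. \<phi> y + real k * mdist m x y)"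

lemma
  assumes \<phi>: "\<And>x. x \<in> mspace m \<Longrightarrow> \<bar>\<phi> x\<bar> \<le> K" and x: "x \<in> mspace m"
  shows lipschitz_minorant_le: "lipschitz_minorant m \<phi> k x \<le> \<phi> x"
    and lipschitz_minorant_ge: "- K \<le> lipschitz_minorant m \<phi> k x"
    and lipschitz_minorant_lipschitz:
      "y \<in> mspace m \<Longrightarrow> \<bar>lipschitz_minorant m \<phi> k x - lipschitz_minorant m \<phi> k y\<bar> \<le> real k * mdist m x y"
    and lipschitz_minorant_tendsto:
      "continuous_map (mtopology_of m) euclideanreal \<phi> \<Longrightarrow> (\<lambda>k. lipschitz_minorant m \<phi> k x) \<longlonglongrightarrow> \<phi> x"
proof -
  let ?l = "lipschitz_minorant m \<phi>"
  have ne: "mspace m \<noteq> {}" using x by auto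
  have lb: "- K \<le> \<phi> y + real k * mdist m x y" if "y \<in> mspace m" for k x y
    using \<phi>[OF that] mult_nonneg_nonneg[OF of_nat_0_le_iff mdist_nonneg, of k m x y] by linarith
  have bdd: "bdd_below ((\<lambda>y. \<phi> y + real k * mdist m x y) ` mspace m)" for k x
    using lb by (intro bdd_belowI2[of _ "- K"]) auto
  have low: "?l k x \<le> \<phi> y + real k * mdist m x y" if "y \<in> mspace m" for k x y
    unfolding lipschitz_minorant_def using that by (rule cINF_lower[OF bdd])
  show le: "?l k x \<le> \<phi> x" for k
    using low[OF x, of k x] mdist_zero[OF x x] by simp
  show "- K \<le> ?l k x" for k
    unfolding lipschitz_minorant_def using lb by (intro cINF_greatest[OF ne]) auto
  have lip1: "?l k u \<le> ?l k v + real k * mdist m u v" if "u \<in> mspace m" "v \<in> mspace m" for u v k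
  proof -
    have "?l k u - real k * mdist m u v \<le> ?l k v"
      unfolding lipschitz_minorant_def[of _ _ _ v]
    proof (rule cINF_greatest[OF ne])
      fix y assume y: "y \<in> mspace m"
      have "?l k u \<le> \<phi> y + real k * mdist m u y" by (rule low[OF y])
      also have "\<dots> \<le> \<phi> y + real k * (mdist m u v + mdist m v y)"
        using that y by (intro add_left_mono mult_left_mono mdist_triangle) auto
      finally show "?l k u - real k * mdist m u v \<le> \<phi> y + real k * mdist m v y"
        by (simp add: algebra_simps)
    qed
    then show ?thesis by simp
  qed
  show "\<bar>?l k x - ?l k y\<bar> \<le> real k * mdist m x y" if "y \<in> mspace m" for k
    using lip1[OF x that, of k] lip1[OF that x, of k] mdist_commute[of m x y] by simp
  show "(\<lambda>k. ?l k x) \<longlonglongrightarrow> \<phi> x" if cont: "continuous_map (mtopology_of m) euclideanreal \<phi>"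
  proof (rule LIMSEQ_I)
    fix e :: real assume e: "e > 0"
    obtain d where d: "d > 0" "\<And>y. y \<in> mspace m \<Longrightarrow> mdist m x y < d \<Longrightarrow> \<bar>\<phi> y - \<phi> x\<bar> < e / 2"
      using cont[unfolded continuous_map_mtopology_of_iff] x e half_gt_zero by metis
    \<comment> \<open>From distance \<open>d\<close> on, the penalty \<open>k * d\<close> outweighs
      the largest possible drop \<open>2 * K\<close> of \<phi>, so only points near \<open>x\<close>
      can compete in the infimum.\<close>
    obtain k0 where k0: "2 * K / d \<le> real k0" using real_arch_simple by blast
    have "norm (?l k x - \<phi> x) < e" if k: "k \<ge> k0" for k
    proof -
      have "\<phi> x - e / 2 \<le> ?l k x"
        unfolding lipschitz_minorant_def
      proof (rule cINF_greatest[OF ne])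
        fix y assume y: "y \<in> mspace m"
        show "\<phi> x - e / 2 \<le> \<phi> y + real k * mdist m x y"
        proof (cases "mdist m x y < d")
          case True
          then show ?thesis
            using d(2)[OF y] mult_nonneg_nonneg[OF of_nat_0_le_iff mdist_nonneg, of k m x y] by linarith
        next
          case False
          have "2 * K \<le> real k0 * d" using k0 d by (simp add: field_simps)
          also have "\<dots> \<le> real k * mdist m x y"
            using False k d by (intro mult_mono) auto
          finally show ?thesis using \<phi>[OF x] \<phi>[OF y] e by linarith
        qed
      qed
      then show ?thesis using le[of k] e by simp
    qed
    then show "\<exists>k0. \<forall>k\<ge>k0. norm (?l k x - \<phi> x) < e" by blast
  qed
qed

text \<open>Lipschitz minorants approximate \<phi> from below only, hence give the lower half of the
  limit; the upper half is the same bound for the negated functional.\<close>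

lemma converges_weaklyI_lipschitz:
  fixes m :: "'b metric"
  assumes M: "\<And>n. n \<ge> 1 \<Longrightarrow> prob_space (M n)" and N: "prob_space N"
    and X: "\<And>n. n \<ge> 1 \<Longrightarrow> X n \<in> M n \<rightarrow>\<^sub>M borel_metric m" and Z: "Z \<in> N \<rightarrow>\<^sub>M borel_metric m"
    and conv: "\<And>\<phi> K L. (\<And>x. x \<in> mspace m \<Longrightarrow> \<bar>\<phi> x\<bar> \<le> K) \<Longrightarrow>
      (\<And>x y. x \<in> mspace m \<Longrightarrow> y \<in> mspace m \<Longrightarrow> \<bar>\<phi> x - \<phi> y\<bar> \<le> L * mdist m x y) \<Longrightarrow>
      (\<lambda>n. \<integral>\<omega>. \<phi> (X n \<omega>) \<partial>M n) \<longlonglongrightarrow> (\<integral>\<omega>. \<phi> (Z \<omega>) \<partial>N)"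
  shows "converges_weakly m M X N Z"
proof -
  interpret N: prob_space N by fact
  have lower: "\<forall>\<^sub>F n in sequentially. (\<integral>\<omega>. \<phi> (Z \<omega>) \<partial>N) - e < (\<integral>\<omega>. \<phi> (X n \<omega>) \<partial>M n)"
    if cont: "continuous_map (mtopology_of m) euclideanreal \<phi>"
      and K: "\<And>x. x \<in> mspace m \<Longrightarrow> \<bar>\<phi> x\<bar> \<le> K" and e: "e > 0" for \<phi> :: "'b \<Rightarrow> real" and K e
  proof -
    let ?l = "lipschitz_minorant m \<phi>"
    have lip: "\<bar>?l k x - ?l k y\<bar> \<le> real k * mdist m x y" if "x \<in> mspace m" "y \<in> mspace m" for k x y
      using lipschitz_minorant_lipschitz[of m \<phi> K, OF K that] .
    have bd: "\<bar>?l k x\<bar> \<le> K" if "x \<in> mspace m" for k x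
      using lipschitz_minorant_ge[of m \<phi> K x k, OF K that] lipschitz_minorant_le[of m \<phi> K x k, OF K that] K[OF that]
      by (simp add: abs_le_iff)
    note contl = continuous_map_lipschitz[OF lip]
    have "(\<lambda>k. \<integral>\<omega>. ?l k (Z \<omega>) \<partial>N) \<longlonglongrightarrow> (\<integral>\<omega>. \<phi> (Z \<omega>) \<partial>N)"
      using measurable_borel_metric_continuous[OF Z contl] measurable_borel_metric_continuous[OF Z cont]
        bd lipschitz_minorant_tendsto[of m \<phi> K, OF K _ cont] measurable_in_mspace[OF Z]
      by (intro integral_dominated_convergence[where w = "\<lambda>_. K"] AE_I2) auto
    then have "\<forall>\<^sub>F k in sequentially. (\<integral>\<omega>. \<phi> (Z \<omega>) \<partial>N) - e < (\<integral>\<omega>. ?l k (Z \<omega>) \<partial>N)"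
      using e by (intro order_tendstoD) auto
    then obtain k where k: "(\<integral>\<omega>. \<phi> (Z \<omega>) \<partial>N) - e < (\<integral>\<omega>. ?l k (Z \<omega>) \<partial>N)"
      by (auto simp: eventually_sequentially)
    have "\<forall>\<^sub>F n in sequentially. (\<integral>\<omega>. \<phi> (Z \<omega>) \<partial>N) - e < (\<integral>\<omega>. ?l k (X n \<omega>) \<partial>M n)"
      by (rule order_tendstoD(1)[OF conv[OF bd lip] k])
    then show ?thesis
      using eventually_ge_at_top[of 1]
    proof eventually_elim
      case (elim n)
      have "(\<integral>\<omega>. ?l k (X n \<omega>) \<partial>M n) \<le> (\<integral>\<omega>. \<phi> (X n \<omega>) \<partial>M n)"
        using elim(2) lipschitz_minorant_le[of m \<phi> K, OF K] measurable_in_mspace[OF X] bd contl cont K M X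
        by (intro integral_mono integrable_bounded_borel_metric[where m = m and K = K]) auto
      then show ?case using elim(1) by simp
    qed
  qed
  have "(\<lambda>n. \<integral>\<omega>. \<phi> (X n \<omega>) \<partial>M n) \<longlonglongrightarrow> (\<integral>\<omega>. \<phi> (Z \<omega>) \<partial>N)"
    if cont: "continuous_map (mtopology_of m) euclideanreal \<phi>" and b: "bounded (\<phi> ` mspace m)"
    for \<phi> :: "'b \<Rightarrow> real"
  proof (rule order_tendstoI)
    obtain K where K: "\<And>x. x \<in> mspace m \<Longrightarrow> \<bar>\<phi> x\<bar> \<le> K"
      using b by (auto simp: bounded_iff)
    show "\<forall>\<^sub>F n in sequentially. a < (\<integral>\<omega>. \<phi> (X n \<omega>) \<partial>M n)" if "a < (\<integral>\<omega>. \<phi> (Z \<omega>) \<partial>N)" for a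
      using lower[OF cont K, of "(\<integral>\<omega>. \<phi> (Z \<omega>) \<partial>N) - a"] that by simp
    show "\<forall>\<^sub>F n in sequentially. (\<integral>\<omega>. \<phi> (X n \<omega>) \<partial>M n) < a" if "(\<integral>\<omega>. \<phi> (Z \<omega>) \<partial>N) < a" for a
    proof -
      have "continuous_map (mtopology_of m) euclideanreal (\<lambda>x. - \<phi> x)"
        using cont by (rule continuous_map_minus)
      from lower[OF this, of K "a - (\<integral>\<omega>. \<phi> (Z \<omega>) \<partial>N)"] K that show ?thesis by simp
    qed
  qed
  then show ?thesis
    unfolding converges_weakly_def using X Z by blast
qed

section \<open>The path space of continuous functions on the unit interval\<close>

lemma C01_mspace_iff: "f \<in> mspace C01 \<longleftrightarrow> f \<in> extensional {0..1} \<and> continuous_on {0..1} f"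
proof -
  have "compactin (top_of_set {0..1::real}) (topspace (top_of_set {0..1}))"
    by (simp add: compactin_subtopology)
  then show ?thesis
    by (simp add: C01_def compactin_mspace_cfunspace del: mspace_cfunspace)
qed

lemma restrict_in_C01: "continuous_on {0..1} f \<Longrightarrow> (\<lambda>z\<in>{0..1}. f z) \<in> mspace C01"
  unfolding C01_mspace_iff by (auto cong: continuous_on_cong_simp)

lemma C01_mdist_le:
  assumes "0 \<le> r" "\<And>z. 0 \<le> z \<Longrightarrow> z \<le> 1 \<Longrightarrow> \<bar>f z - g z\<bar> \<le> r"
  shows "mdist C01 f g \<le> r"
  unfolding C01_def by (rule mdist_cfunspace_le) (use assms in \<open>auto simp: dist_real_def\<close>)

lemma C01_abs_diff_le:
  assumes "f \<in> mspace C01" "g \<in> mspace C01" "0 \<le> z" "z \<le> 1"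
  shows "\<bar>f z - g z\<bar> \<le> mdist C01 f g"
  using mdist_cfunspace_imp_mdist_le[OF assms(1,2)[unfolded C01_def] order_refl, of z] assms(3,4)
  by (simp add: C01_def dist_real_def)

text \<open>Interpolated paths are finite combinations of fixed continuous functions with random
  coefficients. The map from coefficients to paths is continuous into the supremum metric, so Borel
  measurability of the path follows from that of the coefficients, with no appeal to
  separability.\<close>

lemma measurable_C01_combination:
  fixes V :: "nat \<Rightarrow> 'a \<Rightarrow> real"
  assumes V: "\<And>j. j < m \<Longrightarrow> V j \<in> borel_measurable M"
    and f: "continuous_on {0..1} f" and g: "\<And>j. j < m \<Longrightarrow> continuous_on {0..1} (g j)"
  shows "(\<lambda>\<omega>. \<lambda>z\<in>{0..1}. f z + (\<Sum>j<m. V j \<omega> * g j z)) \<in> M \<rightarrow>\<^sub>M borel_metric C01"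
proof -
  define G where "G v = (\<lambda>z\<in>{0..1}. f z + (\<Sum>j<m. v j * g j z))" for v :: "nat \<Rightarrow> real"
  have G: "G v \<in> mspace C01" for v
    unfolding G_def using f g by (intro restrict_in_C01 continuous_intros) auto
  show ?thesis
  proof (rule measurable_borel_metricI)
    fix \<omega>
    show "(\<lambda>z\<in>{0..1}. f z + (\<Sum>j<m. V j \<omega> * g j z)) \<in> mspace C01"
      using G[of "\<lambda>j. V j \<omega>"] by (simp add: G_def)
  next
    fix U assume U: "openin (mtopology_of C01) U"
    have "\<exists>K\<ge>0. \<forall>z\<in>{0..1}. \<bar>g j z\<bar> \<le> K" if "j < m" for j
    proof -
      have "bounded (g j ` {0..1})"
        using g[OF that] by (intro compact_imp_bounded compact_continuous_image) auto
      then obtain K where "\<forall>z\<in>{0..1}. \<bar>g j z\<bar> \<le> K" by (auto simp: bounded_iff)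
      then show ?thesis by (intro exI[of _ "max 0 K"]) (auto intro: le_max_iff_disj[THEN iffD2])
    qed
    then obtain K where K: "\<And>j. j < m \<Longrightarrow> K j \<ge> 0" "\<And>j z. j < m \<Longrightarrow> 0 \<le> z \<Longrightarrow> z \<le> 1 \<Longrightarrow> \<bar>g j z\<bar> \<le> K j"
      by (metis atLeastAtMost_iff)
    \<comment> \<open>The summand 1 keeps \<open>S\<close> positive when \<open>m = 0\<close> or all
      bounds vanish, so that dividing by \<open>S\<close> is harmless.\<close>
    define S where "S = (\<Sum>j<m. K j) + 1"
    have S: "S > 0" using K(1) by (auto simp: S_def intro!: add_nonneg_pos sum_nonneg)
    have "open (G -` U)"
    proof (subst open_subopen, intro ballI)
      fix v assume "v \<in> G -` U"
      then obtain r where r: "r > 0" "\<And>y. y \<in> mspace C01 \<Longrightarrow> mdist C01 (G v) y < r \<Longrightarrow> y \<in> U"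
        using U unfolding openin_mtopology_of_iff by (metis vimageE)
      define d where "d = r / (2 * S)"
      have d: "d > 0" using r S by (simp add: d_def)
      \<comment> \<open>Only finitely many coordinates are constrained, so this neighbourhood is
        open in the product topology on sequences.\<close>
      have "open {w. \<forall>j\<in>{..<m}. w j \<in> ball (v j) d}"
        by (rule product_topology_basis') auto
      moreover have "w \<in> G -` U" if w: "\<forall>j\<in>{..<m}. w j \<in> ball (v j) d" for w
      proof -
        have "mdist C01 (G v) (G w) \<le> d * S"
        proof (rule C01_mdist_le)
          fix z :: real assume z: "0 \<le> z" "z \<le> 1"
          have "\<bar>G v z - G w z\<bar> = \<bar>\<Sum>j<m. (v j - w j) * g j z\<bar>"
            using z by (simp add: G_def left_diff_distrib sum_subtractf)
          also have "\<dots> \<le> (\<Sum>j<m. \<bar>v j - w j\<bar> * \<bar>g j z\<bar>)"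
            by (rule order_trans[OF sum_abs]) (simp add: abs_mult)
          also have "\<dots> \<le> (\<Sum>j<m. d * K j)"
            using w K z d by (intro sum_mono mult_mono) (auto simp: dist_real_def less_imp_le)
          also have "\<dots> \<le> d * S" using d by (simp add: S_def sum_distrib_left[symmetric])
          finally show "\<bar>G v z - G w z\<bar> \<le> d * S" .
        qed (use d S in auto)
        also have "d * S < r" using r S by (simp add: d_def)
        finally show ?thesis using r(2)[OF G] by simp
      qed
      ultimately show "\<exists>T. open T \<and> v \<in> T \<and> T \<subseteq> G -` U"
        using d by (intro exI[of _ "{w. \<forall>j\<in>{..<m}. w j \<in> ball (v j) d}"]) auto
    qed
    moreover have "(\<lambda>\<omega> j. if j < m then V j \<omega> else 0) \<in> borel_measurable M"
    proof (rule measurable_coordinatewise_then_product)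
      show "(\<lambda>\<omega>. if j < m then V j \<omega> else 0) \<in> borel_measurable M" for j
        using V by (cases "j < m") auto
    qed
    ultimately have "(\<lambda>\<omega> j. if j < m then V j \<omega> else 0) -` (G -` U) \<inter> space M \<in> sets M"
      by (auto intro: measurable_sets)
    also have "(\<lambda>\<omega> j. if j < m then V j \<omega> else 0) -` (G -` U) =
        (\<lambda>\<omega>. \<lambda>z\<in>{0..1}. f z + (\<Sum>j<m. V j \<omega> * g j z)) -` U"
      by (simp add: vimage_def G_def cong: restrict_cong)
    finally show "(\<lambda>\<omega>. \<lambda>z\<in>{0..1}. f z + (\<Sum>j<m. V j \<omega> * g j z)) -` U \<inter> space M \<in> sets M" .
  qed
qed

subsection \<open>Piecewise linear interpolation\<close>

definition ramp :: "real \<Rightarrow> real" where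
  "ramp y = max 0 (min 1 y)"

text \<open>The partial sum operator with entries counted from 0, written as a sum of fixed ramps:
  linearity in \<open>v\<close> and continuity in \<open>z\<close> are then immediate, and the floor
  expression is recovered in \<open>interp_eq_floor\<close>.\<close>

definition interp :: "nat \<Rightarrow> (nat \<Rightarrow> real) \<Rightarrow> real \<Rightarrow> real" where
  "interp m v z = (\<Sum>j<m. v j * ramp (real m * z - real j))"

lemma ramp_nonneg [simp]: "0 \<le> ramp y" and ramp_le_1 [simp]: "ramp y \<le> 1"
  and ramp_eq_0: "y \<le> 0 \<Longrightarrow> ramp y = 0" and ramp_eq_1: "1 \<le> y \<Longrightarrow> ramp y = 1"
  and ramp_ident: "0 \<le> y \<Longrightarrow> y \<le> 1 \<Longrightarrow> ramp y = y"
  by (auto simp: ramp_def)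

lemma ramp_diff_cases: "0 \<le> y - x \<Longrightarrow> ramp y - ramp x \<in> {0..1}"
  by (auto simp: ramp_def)

lemma continuous_on_interp: "continuous_on S (interp m v)"
  unfolding interp_def ramp_def by (intro continuous_intros)

lemma continuous_on_ramp: "continuous_on S (\<lambda>z. ramp (real m * z - real j))"
  unfolding ramp_def by (intro continuous_intros)

lemma interp_eq_floor:
  assumes z: "0 \<le> z" "z \<le> 1"
  shows "interp m v z = (\<Sum>i<nat \<lfloor>real m * z\<rfloor>. v i) + frac (real m * z) * v (nat \<lfloor>real m * z\<rfloor>)"
proof -
  define K where "K = nat \<lfloor>real m * z\<rfloor>"
  have nn: "real m * z \<ge> 0" using z by simp
  have K: "real K = of_int \<lfloor>real m * z\<rfloor>" using nn by (simp add: K_def)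
  have fr: "frac (real m * z) = real m * z - real K" by (simp add: frac_def K)
  have fr2: "0 \<le> real m * z - real K" "real m * z - real K < 1" using K by linarith+
  have mz: "real m * z \<le> real m * 1" using z by (intro mult_left_mono) auto
  have Km: "K \<le> m" using fr2 mz by linarith
  define t where "t j = v j * ramp (real m * z - real j)" for j
  have t1: "t j = v j" if "j < K" for j
    using that fr2 by (simp add: t_def ramp_eq_1)
  have t0: "t j = 0" if "K < j" for j
    using that fr2 by (simp add: t_def ramp_eq_0)
  have tK: "t K = frac (real m * z) * v K"
    using fr2 by (simp add: t_def fr ramp_ident)
  have "(\<Sum>j<m. t j) = (\<Sum>j<Suc K. t j)"
  proof (cases "K = m")
    \<comment> \<open>This is the right end point: there is no summand with index \<open>m\<close>,
      but its factor, the fractional part, is 0.\<close>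
    case True
    then have "frac (real m * z) = 0" using fr fr2 mz by simp
    then show ?thesis using True tK by simp
  next
    case False
    then show ?thesis
      using Km t0 by (intro sum.mono_neutral_right) auto
  qed
  also have "\<dots> = (\<Sum>j<K. v j) + frac (real m * z) * v K"
    using t1 tK by simp
  finally show ?thesis by (simp add: interp_def t_def K_def)
qed

lemma partial_sum_eq_interp:
  assumes "0 \<le> z" "z \<le> 1"
  shows "partial_sum m a z = interp m (\<lambda>i. a (Suc i)) z"
proof -
  have "(\<Sum>i=1..k. a i) = (\<Sum>i<k. a (Suc i))" for k
    by (simp add: sum.atLeast1_atMost_eq)
  then show ?thesis
    using assms by (simp add: interp_eq_floor partial_sum_def frac_def)
qed

lemma interp_add: "interp m (\<lambda>i. v i + w i) z = interp m v z + interp m w z"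
  and interp_diff: "interp m (\<lambda>i. v i - w i) z = interp m v z - interp m w z"
  and interp_cmult: "interp m (\<lambda>i. c * v i) z = c * interp m v z"
  by (simp_all add: interp_def sum.distrib sum_subtractf sum_distrib_left algebra_simps)

lemma interp_0 [simp]: "interp m v 0 = 0"
  by (simp add: interp_def ramp_eq_0)

text \<open>For \<open>s \<le> u\<close> this is the length of the intersection of
  \<open>[i, i + 1]\<close> with \<open>[m * s, m * u]\<close>, that is, the share of the cell of
  \<open>v i\<close> that an increment from \<open>s\<close> to \<open>u\<close> picks up.\<close>

definition weight :: "nat \<Rightarrow> real \<Rightarrow> real \<Rightarrow> nat \<Rightarrow> real" where
  "weight m s u i = ramp (real m * u - real i) - ramp (real m * s - real i)"

lemma interp_weight: "interp m v u - interp m v s = (\<Sum>i<m. v i * weight m s u i)"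
  by (simp add: interp_def weight_def sum_subtractf right_diff_distrib)

lemma weight_bounds: "s \<le> u \<Longrightarrow> 0 \<le> weight m s u i" "s \<le> u \<Longrightarrow> weight m s u i \<le> 1"
proof -
  assume "s \<le> u"
  then have "real m * s \<le> real m * u" by (intro mult_left_mono) auto
  then have "weight m s u i \<in> {0..1}" unfolding weight_def by (intro ramp_diff_cases) auto
  then show "0 \<le> weight m s u i" "weight m s u i \<le> 1" by auto
qed

lemma sum_weight:
  assumes "0 \<le> s" "s \<le> 1" "0 \<le> u" "u \<le> 1"
  shows "(\<Sum>i<m. weight m s u i) = real m * (u - s)"
proof -
  have "interp m (\<lambda>_. 1) z = real m * z" if "0 \<le> z" "z \<le> 1" for z
    using that by (simp add: interp_eq_floor frac_def)
  then show ?thesis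
    using interp_weight[of m "\<lambda>_. 1" u s] assms by (simp add: right_diff_distrib)
qed

lemma weight_sum_blocks:
  assumes "i < n"
  shows "(\<Sum>j<m. weight n (real j / real m) (real (Suc j) / real m) i) = (if m = 0 then 0 else 1)"
proof -
  have "(\<Sum>j<m. weight n (real j / real m) (real (Suc j) / real m) i) =
      ramp (real n * (real m / real m) - real i) - ramp (real n * (real 0 / real m) - real i)"
    unfolding weight_def by (rule sum_lessThan_telescope)
  then show ?thesis
    using assms by (auto simp: ramp_eq_0 ramp_eq_1)
qed

text \<open>A cell is divided between blocks only if a grid point falls into it; the hypothesis
  excludes the at most \<open>m + 1\<close> cells for which this can happen.\<close>

lemma weight_block_01:
  assumes "m > 0" "\<And>j. j \<le> m \<Longrightarrow> i \<noteq> nat \<lfloor>real n * (real j / real m)\<rfloor>" "j < m"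
  shows "weight n (real j / real m) (real (Suc j) / real m) i \<in> {0, 1}"
proof -
  have "ramp (real n * (real k / real m) - real i) \<in> {0, 1}" if "k \<le> m" for k
  proof -
    define y where "y = real n * (real k / real m)"
    have "y \<ge> 0" by (simp add: y_def)
    moreover have "i \<noteq> nat \<lfloor>y\<rfloor>" using assms(2)[OF that] by (simp add: y_def)
    ultimately have "y - real i \<le> 0 \<or> y - real i \<ge> 1" by linarith
    then show ?thesis unfolding y_def[symmetric] using ramp_eq_0 ramp_eq_1 by auto
  qed
  from this[of j] this[of "Suc j"] have
    "ramp (real n * (real j / real m) - real i) \<in> {0, 1}"
    "ramp (real n * (real (Suc j) / real m) - real i) \<in> {0, 1}" using assms(3) by auto
  moreover have "weight n (real j / real m) (real (Suc j) / real m) i \<ge> 0"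
    by (intro weight_bounds) (simp add: divide_right_mono)
  ultimately show ?thesis unfolding weight_def by auto
qed

section \<open>Polygons through equidistant grid points\<close>

definition increments :: "nat \<Rightarrow> (real \<Rightarrow> real) \<Rightarrow> nat \<Rightarrow> real" where
  "increments m x j = x (real (Suc j) / real m) - x (real j / real m)"

text \<open>Written through increments rather than grid values because it is the increments whose
  joint laws converge; apart from the start value, the polygon is a linear function of them.\<close>

definition polygon :: "nat \<Rightarrow> (real \<Rightarrow> real) \<Rightarrow> real \<Rightarrow> real" where
  "polygon m x z = x 0 + interp m (increments m x) z"

lemma polygon_eq:
  assumes m: "m > 0" and j: "j < m" and z: "real j / real m \<le> z" "z \<le> real (Suc j) / real m"
  shows "polygon m x z = (1 - (real m * z - real j)) * x (real j / real m) +
    (real m * z - real j) * x (real (Suc j) / real m)"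
proof -
  have z': "real j \<le> real m * z" "real m * z \<le> real j + 1" using m z by (auto simp: field_simps)
  have "interp m (increments m x) z =
      (\<Sum>i<m. increments m x i * (if i < j then 1 else if i = j then real m * z - real j else 0))"
    unfolding interp_def using z' by (intro sum.cong refl) (auto simp: ramp_eq_0 ramp_eq_1 ramp_ident)
  also have "\<dots> = (\<Sum>i<Suc j. increments m x i * (if i < j then 1 else if i = j then real m * z - real j else 0))"
    using j by (intro sum.mono_neutral_right) auto
  also have "\<dots> = (\<Sum>i<j. increments m x i) + increments m x j * (real m * z - real j)"
    by simp
  also have "(\<Sum>i<j. increments m x i) = x (real j / real m) - x 0"
    unfolding increments_def by (subst sum_lessThan_telescope) simp
  finally have "interp m (increments m x) z = x (real j / real m) - x 0 +
      (x (real (Suc j) / real m) - x (real j / real m)) * (real m * z - real j)"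
    by (simp only: increments_def[of m x j])
  then show ?thesis unfolding polygon_def by (simp only: algebra_simps)
qed

lemma block_exists:
  assumes m: "m > 0" and z: "0 \<le> z" "z \<le> 1"
  obtains j where "j < m" "real j / real m \<le> z" "z \<le> real (Suc j) / real m"
proof (cases "z = 1")
  case True
  then show ?thesis using m by (intro that[of "m - 1"]) (auto simp: field_simps of_nat_diff)
next
  case False
  define j where "j = nat \<lfloor>real m * z\<rfloor>"
  have a: "0 \<le> real m * z" using z by simp
  then have j: "real j = of_int \<lfloor>real m * z\<rfloor>" by (simp add: j_def)
  have "real m * z < real m * 1" using m z False by (intro mult_strict_left_mono) auto
  then have "real j < real m" using j by linarith
  moreover have "real j \<le> real m * z" "real m * z \<le> real j + 1" using j by linarith+
  ultimately show ?thesis using m by (intro that[of j]) (auto simp: field_simps)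
qed

text \<open>On each block the polygon is a convex combination of two values of \<open>x\<close>.\<close>

lemma polygon_close:
  assumes m: "m > 0"
    and c: "\<And>j. j < m \<Longrightarrow> \<exists>c. \<forall>z. real j / real m \<le> z \<and> z \<le> real (Suc j) / real m \<longrightarrow> \<bar>x z - c\<bar> \<le> \<rho>"
    and z: "0 \<le> z" "z \<le> 1"
  shows "\<bar>x z - polygon m x z\<bar> \<le> 2 * \<rho>"
proof -
  obtain j where j: "j < m" "real j / real m \<le> z" "z \<le> real (Suc j) / real m"
    using block_exists[OF m z] .
  obtain c where c: "\<And>z. real j / real m \<le> z \<Longrightarrow> z \<le> real (Suc j) / real m \<Longrightarrow> \<bar>x z - c\<bar> \<le> \<rho>"
    using c[OF j(1)] by blast
  define s where "s = real m * z - real j"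
  have s: "0 \<le> s" "s \<le> 1" using j m by (auto simp: s_def field_simps)
  have a: "\<bar>x (real j / real m) - c\<bar> \<le> \<rho>" "\<bar>x (real (Suc j) / real m) - c\<bar> \<le> \<rho>"
    by (intro c; simp add: divide_right_mono)+
  have "polygon m x z - c = (1 - s) * (x (real j / real m) - c) + s * (x (real (Suc j) / real m) - c)"
    unfolding polygon_eq[OF m j] s_def by (simp add: algebra_simps)
  also have "\<bar>\<dots>\<bar> \<le> (1 - s) * \<rho> + s * \<rho>"
    using s a by (intro order_trans[OF abs_triangle_ineq] add_mono) (auto simp: abs_mult intro!: mult_left_mono)
  also have "\<dots> = \<rho>" by (simp add: algebra_simps)
  finally show ?thesis using c[OF j(2,3)] by linarith
qed

text \<open>Uniform continuity makes the oscillation over a block of length \<open>1 / m\<close>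
  small. Applied to each Brownian path, this gives both the measurability of the path and the
  convergence of expectations of its polygons.\<close>

lemma polygon_tendsto:
  assumes "continuous_on {0..1} x" and e: "e > 0"
  shows "\<exists>m0>0. \<forall>m\<ge>m0. \<forall>z. 0 \<le> z \<and> z \<le> 1 \<longrightarrow> \<bar>x z - polygon m x z\<bar> \<le> e"
proof -
  have "uniformly_continuous_on {0..1} x"
    using assms(1) by (intro compact_uniformly_continuous) auto
  then obtain d where d: "d > 0"
    "\<And>u s. u \<in> {0..1} \<Longrightarrow> s \<in> {0..1} \<Longrightarrow> dist s u < d \<Longrightarrow> dist (x s) (x u) < e / 2"
    unfolding uniformly_continuous_on_def using e by (metis half_gt_zero)
  obtain m0 :: nat where m0: "1 / d < real m0" using reals_Archimedean2 by blast
  have "m0 > 0" using m0 d(1) by (cases m0) (auto simp: field_simps)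
  moreover have "\<bar>x z - polygon m x z\<bar> \<le> e" if m: "m \<ge> m0" and z: "0 \<le> z" "z \<le> 1" for m z
  proof -
    have mpos: "m > 0" using \<open>m0 > 0\<close> m by simp
    have "1 / d < real m" using m m0 by linarith
    then have md: "1 / real m < d" using d(1) mpos by (simp add: field_simps)
    have "\<bar>x z - polygon m x z\<bar> \<le> 2 * (e / 2)"
    proof (rule polygon_close[OF mpos _ z])
      fix j assume j: "j < m"
      have j1: "real (Suc j) / real m \<le> 1" using j by simp
      have "\<bar>x z - x (real j / real m)\<bar> \<le> e / 2"
        if "real j / real m \<le> z" "z \<le> real (Suc j) / real m" for z
      proof -
        have "z - real j / real m \<le> 1 / real m" using that by (simp add: add_divide_distrib)
        moreover have "0 \<le> real j / real m" "0 \<le> z"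
          using order_trans[OF _ that(1), of 0] by simp_all
        ultimately have "dist z (real j / real m) < d" "z \<in> {0..1}" "real j / real m \<in> {0..1}"
          using that md j1 by (auto simp: dist_real_def)
        from d(2)[OF this(3) this(2) this(1)] show ?thesis by (simp add: dist_real_def)
      qed
      then show "\<exists>c. \<forall>z. real j / real m \<le> z \<and> z \<le> real (Suc j) / real m \<longrightarrow> \<bar>x z - c\<bar> \<le> e / 2"
        by blast
    qed
    then show ?thesis by simp
  qed
  ultimately show ?thesis by blast
qed

text \<open>The shares of an undivided cell are 0 or 1 and add up to 1, so exactly one of them is 1
  and both sides equal the square of \<theta> at that block.\<close>

lemma weight_mean_square:
  assumes i: "i < n" and m: "m > 0" "\<And>j. j \<le> m \<Longrightarrow> i \<noteq> nat \<lfloor>real n * (real j / real m)\<rfloor>"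
  shows "(\<Sum>j<m. \<theta> j * weight n (real j / real m) (real (Suc j) / real m) i)\<^sup>2 =
    (\<Sum>j<m. (\<theta> j)\<^sup>2 * weight n (real j / real m) (real (Suc j) / real m) i)"
proof -
  define w where "w j = weight n (real j / real m) (real (Suc j) / real m) i" for j
  have w01: "w j \<in> {0, 1}" if "j < m" for j
    unfolding w_def by (rule weight_block_01[OF m that])
  have sum1: "(\<Sum>j<m. w j) = 1" using weight_sum_blocks[OF i, of m] m by (simp add: w_def)
  then obtain j0 where j0: "j0 < m" "w j0 \<noteq> 0" by (metis lessThan_iff sum.neutral zero_neq_one)
  have "(\<Sum>j\<in>{..<m} - {j0}. w j) = 0"
    using sum1 w01[OF j0(1)] j0 by (subst (asm) sum.remove[of _ j0]) auto
  then have w0: "w j = 0" if "j \<in> {..<m} - {j0}" for j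
    using w01 that by (subst (asm) sum_nonneg_eq_0_iff) force+
  have "(\<Sum>j<m. a j * w j) = a j0" for a :: "nat \<Rightarrow> real"
    using w01[OF j0(1)] j0 w0 by (subst sum.remove[of _ j0]) auto
  then show ?thesis unfolding w_def[symmetric] by simp
qed

text \<open>This is the variance computation behind the limit: divided by \<open>n\<close>, the sum
  of squares tends to the variance of the same combination of Brownian increments. Squaring commutes
  with averaging over the shares except on the at most \<open>m + 1\<close> cells hit by grid
  points, and each of these costs at most \<open>C\<^sup>2\<close>.\<close>

lemma weight_square_sum:
  assumes m: "m > 0" and C: "C = (\<Sum>j<m. \<bar>\<theta> j\<bar>)"
  shows "\<bar>(\<Sum>i<n. (\<Sum>j<m. \<theta> j * weight n (real j / real m) (real (Suc j) / real m) i)\<^sup>2) -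
    real n * ((\<Sum>j<m. (\<theta> j)\<^sup>2) / real m)\<bar> \<le> real (Suc m) * C\<^sup>2"
proof -
  define w where "w i j = weight n (real j / real m) (real (Suc j) / real m) i" for i j
  have w: "0 \<le> w i j" "w i j \<le> 1" for i j
    unfolding w_def by (intro weight_bounds; simp add: divide_right_mono)+
  define f where "f i = (\<Sum>j<m. \<theta> j * w i j)\<^sup>2" for i
  define g where "g i = (\<Sum>j<m. (\<theta> j)\<^sup>2 * w i j)" for i
  have f: "0 \<le> f i" "f i \<le> C\<^sup>2" for i
  proof -
    have "\<bar>\<Sum>j<m. \<theta> j * w i j\<bar> \<le> (\<Sum>j<m. \<bar>\<theta> j\<bar> * 1)"
      using w[of i] by (intro order_trans[OF sum_abs] sum_mono) (auto simp: abs_mult intro!: mult_left_le)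
    then have "\<bar>\<Sum>j<m. \<theta> j * w i j\<bar> \<le> C" by (simp add: C)
    then have "\<bar>\<Sum>j<m. \<theta> j * w i j\<bar>\<^sup>2 \<le> C\<^sup>2" by (intro power_mono) auto
    then show "f i \<le> C\<^sup>2" by (simp add: f_def)
  qed (simp add: f_def)
  have g: "0 \<le> g i" "g i \<le> C\<^sup>2" for i
  proof -
    show "0 \<le> g i" unfolding g_def using w[of i] by (intro sum_nonneg) auto
    have "g i \<le> (\<Sum>j<m. \<bar>\<theta> j\<bar> * C * 1)"
      unfolding g_def
    proof (rule sum_mono)
      fix j assume "j \<in> {..<m}"
      then have "\<bar>\<theta> j\<bar> \<le> C" unfolding C by (intro member_le_sum) auto
      then have "\<bar>\<theta> j\<bar> * \<bar>\<theta> j\<bar> \<le> \<bar>\<theta> j\<bar> * C" by (intro mult_left_mono) auto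
      then have "(\<theta> j)\<^sup>2 \<le> \<bar>\<theta> j\<bar> * C" by (simp add: power2_eq_square)
      moreover have "0 \<le> C" unfolding C by (intro sum_nonneg) auto
      ultimately show "(\<theta> j)\<^sup>2 * w i j \<le> \<bar>\<theta> j\<bar> * C * 1" using w[of i j] by (intro mult_mono) auto
    qed
    also have "\<dots> = C\<^sup>2" by (simp add: C power2_eq_square sum_distrib_right)
    finally show "g i \<le> C\<^sup>2" .
  qed
  define E where "E = (\<lambda>j. nat \<lfloor>real n * (real j / real m)\<rfloor>) ` {..m}"
  have E: "finite E" "card E \<le> Suc m"
    unfolding E_def using card_image_le[of "{..m}"] by auto
  have eq: "f i = g i" if "i < n" "i \<notin> E" for i
  proof -
    have "\<And>j. j \<le> m \<Longrightarrow> i \<noteq> nat \<lfloor>real n * (real j / real m)\<rfloor>" using that(2) unfolding E_def by auto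
    then show ?thesis unfolding f_def g_def w_def by (rule weight_mean_square[OF that(1) m])
  qed
  have "(\<Sum>i<n. g i) = (\<Sum>j<m. (\<theta> j)\<^sup>2 * (\<Sum>i<n. w i j))"
    unfolding g_def sum_distrib_left by (rule sum.swap)
  also have "\<dots> = (\<Sum>j<m. (\<theta> j)\<^sup>2 * (real n / real m))"
  proof (intro sum.cong refl)
    fix j assume "j \<in> {..<m}"
    then have "(\<Sum>i<n. w i j) = real n * (real (Suc j) / real m - real j / real m)"
      unfolding w_def by (intro sum_weight) auto
    also have "\<dots> = real n / real m" by (simp add: diff_divide_distrib[symmetric])
    finally show "(\<theta> j)\<^sup>2 * (\<Sum>i<n. w i j) = (\<theta> j)\<^sup>2 * (real n / real m)" by simp
  qed
  also have "\<dots> = real n * ((\<Sum>j<m. (\<theta> j)\<^sup>2) / real m)"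
    unfolding sum_distrib_right[symmetric] by simp
  finally have gsum: "(\<Sum>i<n. g i) = real n * ((\<Sum>j<m. (\<theta> j)\<^sup>2) / real m)" .
  have "\<bar>(\<Sum>i<n. f i) - (\<Sum>i<n. g i)\<bar> \<le> (\<Sum>i<n. \<bar>f i - g i\<bar>)"
    unfolding sum_subtractf[symmetric] by (rule sum_abs)
  also have "\<dots> \<le> (\<Sum>i<n. if i \<in> E then C\<^sup>2 else 0)"
  proof (rule sum_mono)
    fix i assume "i \<in> {..<n}"
    then show "\<bar>f i - g i\<bar> \<le> (if i \<in> E then C\<^sup>2 else 0)"
      using eq[of i] f[of i] g[of i] by auto
  qed
  also have "\<dots> = real (card ({..<n} \<inter> E)) * C\<^sup>2"
    by (simp add: sum.If_cases)
  also have "\<dots> \<le> real (Suc m) * C\<^sup>2"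
    using card_mono[OF E(1), of "{..<n} \<inter> E"] E(2) by (intro mult_right_mono) auto
  finally show ?thesis unfolding gsum f_def w_def .
qed

subsection \<open>Finite-dimensional convergence from characteristic functions\<close>

lemma (in prob_space) expectation_diff_le:
  fixes f g :: "'a \<Rightarrow> real"
  assumes int: "integrable M f" "integrable M g" and B: "B \<in> events" "prob B \<le> p"
    and a: "\<And>\<omega>. \<omega> \<in> space M - B \<Longrightarrow> \<bar>f \<omega> - g \<omega>\<bar> \<le> a"
    and b: "\<And>\<omega>. \<omega> \<in> space M \<Longrightarrow> \<bar>f \<omega> - g \<omega>\<bar> \<le> b" and nonneg: "0 \<le> a" "0 \<le> b"
  shows "\<bar>expectation f - expectation g\<bar> \<le> a + b * p"
proof -
  have ind: "integrable M (indicat_real B)"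
    using B by (intro integrable_real_indicator) (auto simp: emeasure_eq_measure)
  have "\<bar>expectation f - expectation g\<bar> = \<bar>expectation (\<lambda>\<omega>. f \<omega> - g \<omega>)\<bar>"
    using int by simp
  also have "\<dots> \<le> expectation (\<lambda>\<omega>. \<bar>f \<omega> - g \<omega>\<bar>)"
    by (rule integral_abs_bound)
  also have "\<dots> \<le> expectation (\<lambda>\<omega>. a + b * indicator B \<omega>)"
  proof (rule integral_mono)
    fix \<omega> assume \<omega>: "\<omega> \<in> space M"
    show "\<bar>f \<omega> - g \<omega>\<bar> \<le> a + b * indicator B \<omega>"
    proof (cases "\<omega> \<in> B")
      case True
      then show ?thesis using b[OF \<omega>] nonneg by simp
    qed (use a \<omega> in auto)
  qed (use int ind in auto)
  also have "\<dots> = a + b * prob B"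
    using B ind by (simp add: prob_space)
  also have "\<dots> \<le> a + b * p"
    using B nonneg by (intro add_left_mono mult_left_mono) auto
  finally show ?thesis .
qed

lemma (in prob_space) prob_abs_gt_le:
  fixes X :: "'a \<Rightarrow> real"
  assumes X: "X \<in> borel_measurable M" "integrable M (\<lambda>\<omega>. (X \<omega>)\<^sup>2)" and R: "R > 0"
  shows "prob {\<omega> \<in> space M. R < \<bar>X \<omega>\<bar>} \<le> expectation (\<lambda>\<omega>. (X \<omega>)\<^sup>2) / R\<^sup>2"
proof -
  have ind: "integrable M (indicat_real {\<omega> \<in> space M. R < \<bar>X \<omega>\<bar>})"
    using X by (intro integrable_real_indicator) (auto simp: emeasure_eq_measure)
  have "R\<^sup>2 * prob {\<omega> \<in> space M. R < \<bar>X \<omega>\<bar>} = expectation (\<lambda>\<omega>. R\<^sup>2 * indicator {\<omega> \<in> space M. R < \<bar>X \<omega>\<bar>} \<omega>)"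
    using X by simp
  also have "\<dots> \<le> expectation (\<lambda>\<omega>. (X \<omega>)\<^sup>2)"
  proof (rule integral_mono)
    fix \<omega> assume "\<omega> \<in> space M"
    show "R\<^sup>2 * indicator {\<omega> \<in> space M. R < \<bar>X \<omega>\<bar>} \<omega> \<le> (X \<omega>)\<^sup>2"
      using R power_mono[of R "\<bar>X \<omega>\<bar>" 2] by (auto simp: indicator_def)
  qed (use X ind in auto)
  finally show ?thesis using R by (simp add: field_simps)
qed

text \<open>Multiplication is deliberately not a rule. Expectations are linear but not
  multiplicative, so convergence propagates along \<open>add\<close> and \<open>scale\<close> from
  the generators, which are the real and imaginary parts of characteristic functions. Closure under
  products, required for the Stone-Weierstrass theorem, comes from the product-to-sum formulas
  instead.\<close>

inductive_set trig :: "nat \<Rightarrow> ((nat \<Rightarrow> real) \<Rightarrow> real) set" for m where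
  cos: "(\<lambda>x. cos (\<Sum>j<m. \<theta> j * x j)) \<in> trig m"
| sin: "(\<lambda>x. sin (\<Sum>j<m. \<theta> j * x j)) \<in> trig m"
| add: "f \<in> trig m \<Longrightarrow> g \<in> trig m \<Longrightarrow> (\<lambda>x. f x + g x) \<in> trig m"
| scale: "f \<in> trig m \<Longrightarrow> (\<lambda>x. c * f x) \<in> trig m"

lemma trig_const: "(\<lambda>x. c) \<in> trig m"
  using trig.scale[OF trig.cos[of "\<lambda>_. 0" m], of c] by simp

lemma trig_mult:
  assumes "f \<in> trig m" "g \<in> trig m"
  shows "(\<lambda>x. f x * g x) \<in> trig m"
  using assms(1)
proof induction
  have comb: "(\<Sum>j<m. \<theta> j * x j) + (\<Sum>j<m. \<eta> j * x j) = (\<Sum>j<m. (\<theta> j + \<eta> j) * x j)"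
    "(\<Sum>j<m. \<theta> j * x j) - (\<Sum>j<m. \<eta> j * x j) = (\<Sum>j<m. (\<theta> j - \<eta> j) * x j)"
    for \<theta> \<eta> x :: "nat \<Rightarrow> real"
    by (simp_all add: sum.distrib sum_subtractf algebra_simps)
  have half: "(\<lambda>x. (f x + g x) / 2) \<in> trig m" "(\<lambda>x. (f x - g x) / 2) \<in> trig m"
    if "f \<in> trig m" "g \<in> trig m" for f g
    using trig.scale[OF trig.add[OF that], of "1/2"] trig.scale[OF trig.add[OF that(1) trig.scale[OF that(2), of "-1"]], of "1/2"]
    by simp_all
  {
    case (cos \<theta>)
    from assms(2) show ?case
    proof induction
      case (cos \<eta>)
      show ?case unfolding cos_times_cos comb by (intro half trig.intros)
    next
      case (sin \<eta>)
      show ?case unfolding cos_times_sin comb by (intro half trig.intros)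
    next
      case (add f g)
      from trig.add[OF add.IH] show ?case by (simp add: distrib_left)
    next
      case (scale f c)
      from trig.scale[OF scale.IH, of c] show ?case by (simp add: mult.left_commute)
    qed
  next
    case (sin \<theta>)
    from assms(2) show ?case
    proof induction
      case (cos \<eta>)
      show ?case unfolding sin_times_cos comb by (intro half trig.intros)
    next
      case (sin \<eta>)
      show ?case unfolding sin_times_sin comb by (intro half trig.intros)
    next
      case (add f g)
      from trig.add[OF add.IH] show ?case by (simp add: distrib_left)
    next
      case (scale f c)
      from trig.scale[OF scale.IH, of c] show ?case by (simp add: mult.left_commute)
    qed
  next
    case (add f g)
    from trig.add[OF add.IH] show ?case by (simp add: distrib_right)
  next
    case (scale f c)
    from trig.scale[OF scale.IH, of c] show ?case by (simp add: mult.assoc)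
  }
qed

lemma continuous_on_trig: "f \<in> trig m \<Longrightarrow> continuous_on S f"
proof (induction rule: trig.induct)
  have c: "continuous_on S (\<lambda>x :: nat \<Rightarrow> real. x j)" for j
    by (rule continuous_on_subset[OF continuous_on_product_coordinates]) simp
  case (cos \<theta>)
  show ?case by (intro continuous_intros c)
next
  have c: "continuous_on S (\<lambda>x :: nat \<Rightarrow> real. x j)" for j
    by (rule continuous_on_subset[OF continuous_on_product_coordinates]) simp
  case (sin \<theta>)
  show ?case by (intro continuous_intros c)
qed (auto intro!: continuous_intros)

lemma bounded_trig: "f \<in> trig m \<Longrightarrow> \<exists>K. \<forall>x. \<bar>f x\<bar> \<le> K"
proof (induction rule: trig.induct)
  case (add f g)
  then obtain K L where "\<And>x. \<bar>f x\<bar> \<le> K" "\<And>x. \<bar>g x\<bar> \<le> L" by blast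
  then show ?case by (intro exI[of _ "K + L"] allI order_trans[OF abs_triangle_ineq] add_mono)
next
  case (scale f c)
  then obtain K where "\<And>x. \<bar>f x\<bar> \<le> K" by blast
  then show ?case by (intro exI[of _ "\<bar>c\<bar> * K"]) (auto simp: abs_mult intro: mult_left_mono)
qed (intro exI[of _ 1]; simp)+

text \<open>Clipping leaves the algebra, but a polynomial close to the clipping function keeps the
  composition inside it.\<close>

lemma trig_polynomial:
  assumes "real_polynomial_function p" and f: "f \<in> trig m"
  shows "(\<lambda>x. p (f x)) \<in> trig m"
  using assms(1)
proof induction
  case (linear h)
  then obtain c where "h = (\<lambda>x. x * c)" by (auto simp: real_bounded_linear)
  then show ?case using trig.scale[OF f, of c] by (simp add: mult.commute)
next
  case (const c)
  show ?case by (rule trig_const)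
next
  case (add p q)
  then show ?case by (intro trig.add)
next
  case (mult p q)
  then show ?case by (intro trig_mult)
qed

text \<open>Clipping the trigonometric approximant keeps it bounded by \<open>K + e\<close> off the box as well.\<close>

lemma trig_approximation:
  fixes \<psi> :: "(nat \<Rightarrow> real) \<Rightarrow> real"
  assumes \<psi>: "continuous_on UNIV \<psi>" "\<And>x. \<bar>\<psi> x\<bar> \<le> K" and e: "e > 0" 
  obtains h where "h \<in> trig m" "\<And>x. \<bar>h x\<bar> \<le> K + e"
    "\<And>x. (\<And>j. j < m \<Longrightarrow> \<bar>x j\<bar> \<le> R) \<Longrightarrow> (\<And>j. j \<ge> m \<Longrightarrow> x j = 0) \<Longrightarrow> \<bar>h x - \<psi> x\<bar> \<le> 2 * e"
proof -
  have K: "K \<ge> 0" using order_trans[OF abs_ge_zero \<psi>(2)[of "\<lambda>_. 0"]] .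
  \<comment> \<open>Members of \<open>trig m\<close> see the first \<open>m\<close> coordinates
    only. Fixing the others at 0 makes the set compact and lets the algebra separate its
    points.\<close>
  define S where "S = PiE UNIV (\<lambda>j. if j < m then {-R..R} else {0::real})"
  have "compactin (product_topology (\<lambda>_. euclideanreal) UNIV) S"
    unfolding S_def by (subst compactin_PiE) auto
  then have S: "compact S" by (simp add: euclidean_product_topology)
  interpret function_ring_on "trig m" S
  proof
    fix x y assume "x \<in> S" "y \<in> S" "x \<noteq> y"
    then obtain j where j: "x j \<noteq> y j" by blast
    have "x j \<in> (if j < m then {-R..R} else {0})" "y j \<in> (if j < m then {-R..R} else {0})"
      using \<open>x \<in> S\<close> \<open>y \<in> S\<close> unfolding S_def by (blast dest: PiE_mem)+
    then have "j < m" using j by (auto split: if_splits)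
    \<comment> \<open>The scale brings both coordinates into the interval from
      \<open>- pi / 2\<close> to \<open>pi / 2\<close>, on which sine is injective.\<close>
    define c where "c = pi / (2 * (\<bar>x j\<bar> + \<bar>y j\<bar> + 1))"
    have c: "c > 0" unfolding c_def by (intro divide_pos_pos) auto
    have cz: "\<bar>c * z\<bar> \<le> pi / 2" if "\<bar>z\<bar> \<le> \<bar>x j\<bar> + \<bar>y j\<bar> + 1" for z
    proof -
      have "\<bar>c * z\<bar> \<le> c * (\<bar>x j\<bar> + \<bar>y j\<bar> + 1)" using that c by (simp add: abs_mult)
      also have "\<dots> = pi / 2" unfolding c_def by (simp add: field_simps) 
      finally show ?thesis .
    qed
    have "\<bar>c * x j\<bar> \<le> pi / 2" "\<bar>c * y j\<bar> \<le> pi / 2" by (intro cz; simp)+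
    then have "sin (c * x j) \<noteq> sin (c * y j)"
      using j c sin_inj_pi[of "c * x j" "c * y j"] unfolding abs_le_iff by fastforce
    moreover have "(\<lambda>x. sin (\<Sum>i<m. (if i = j then c else 0) * x i)) \<in> trig m" by (rule trig.sin)
    moreover have "(\<Sum>i<m. (if i = j then c else 0) * x i) = c * x j" for x
      using \<open>j < m\<close> by (simp add: if_distrib[of "\<lambda>a. a * _"] cong: if_cong)
    ultimately show "\<exists>f\<in>trig m. f x \<noteq> f y"
      by (intro bexI[of _ "\<lambda>x. sin (\<Sum>i<m. (if i = j then c else 0) * x i)"]) auto
  qed (use S in \<open>auto intro: trig.intros trig_mult trig_const continuous_on_trig\<close>)
  obtain g where g: "g \<in> trig m" "\<And>x. x \<in> S \<Longrightarrow> \<bar>\<psi> x - g x\<bar> < e"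
    using Stone_Weierstrass_basic[OF continuous_on_subset[OF \<psi>(1)] e] by blast
  obtain G where G: "\<And>x. \<bar>g x\<bar> \<le> G" using bounded_trig[OF g(1)] by blast
  \<comment> \<open>Outside \<open>S\<close> nothing is known about \<open>g\<close> except the
    global bound \<open>G\<close>; a polynomial that is close to \<open>clip\<close> on
    \<open>[-G, G]\<close> is therefore controlled everywhere. On \<open>S\<close> no accuracy is
    lost, because the values of \<psi> lie in \<open>[-K, K]\<close> and clipping to this interval
    does not increase the distance to them.\<close>
  define clip where "clip y = max (- K) (min K y)" for y :: real
  have "continuous_on {-G..G} clip" unfolding clip_def by (intro continuous_intros)
  then obtain p where p: "real_polynomial_function p" "\<And>y. y \<in> {-G..G} \<Longrightarrow> \<bar>clip y - p y\<bar> < e"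
    using Stone_Weierstrass_real_polynomial_function[of "{-G..G}" clip e] e by auto
  have pg: "\<bar>clip (g x) - p (g x)\<bar> < e" for x
    using G[of x] by (intro p(2)) (auto simp: abs_le_iff)
  show thesis
  proof (rule that[of "\<lambda>x. p (g x)"])
    show "(\<lambda>x. p (g x)) \<in> trig m" by (rule trig_polynomial[OF p(1) g(1)])
    show "\<bar>p (g x)\<bar> \<le> K + e" for x
      using pg[of x] K by (auto simp: clip_def)
    fix x assume "\<And>j. j < m \<Longrightarrow> \<bar>x j\<bar> \<le> R" "\<And>j. j \<ge> m \<Longrightarrow> x j = 0"
    then have "x \<in> S" by (auto simp: S_def PiE_iff abs_le_iff minus_le_iff)
    then have "\<bar>\<psi> x - g x\<bar> < e" by (rule g(2))
    then show "\<bar>p (g x) - \<psi> x\<bar> \<le> 2 * e"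
      using pg[of x] \<psi>(2)[of x] by (auto simp: clip_def)
  qed
qed

text \<open>By Chebyshev's inequality in each coordinate, the vector leaves the box of radius
  \<open>R\<close> with probability at most \<open>m * C / R\<^sup>2\<close>. There the crude bound
  \<open>(K + 1) + K\<close> is used, and inside the box the approximation error
  \<open>e\<close>.\<close>

lemma (in prob_space) expectation_trig_approx:
  fixes X :: "'a \<Rightarrow> nat \<Rightarrow> real" and \<psi> :: "(nat \<Rightarrow> real) \<Rightarrow> real"
  assumes X: "\<And>j. (\<lambda>\<omega>. X \<omega> j) \<in> borel_measurable M" "\<And>\<omega> j. j \<ge> m \<Longrightarrow> X \<omega> j = 0"
    and sq: "\<And>j. j < m \<Longrightarrow> integrable M (\<lambda>\<omega>. (X \<omega> j)\<^sup>2)"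
      "\<And>j. j < m \<Longrightarrow> expectation (\<lambda>\<omega>. (X \<omega> j)\<^sup>2) \<le> C"
    and \<psi>: "continuous_on UNIV \<psi>" "\<And>x. \<bar>\<psi> x\<bar> \<le> K" 
    and h: "continuous_on UNIV h" "\<And>x. \<bar>h x\<bar> \<le> K + 1" and e: "e > 0" and R: "R > 0"
    and hR: "\<And>x. (\<And>j. j < m \<Longrightarrow> \<bar>x j\<bar> \<le> R) \<Longrightarrow> (\<And>j. j \<ge> m \<Longrightarrow> x j = 0) \<Longrightarrow> \<bar>h x - \<psi> x\<bar> \<le> e"
  shows "\<bar>expectation (\<lambda>\<omega>. h (X \<omega>)) - expectation (\<lambda>\<omega>. \<psi> (X \<omega>))\<bar> \<le> e + (2 * K + 1) * (real m * C / R\<^sup>2)"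
proof (rule expectation_diff_le)
  have K: "K \<ge> 0" using order_trans[OF abs_ge_zero \<psi>(2)[of "\<lambda>_. 0"]] .
  have Xm: "X \<in> borel_measurable M" by (rule measurable_coordinatewise_then_product[OF X(1)])
  show "integrable M (\<lambda>\<omega>. h (X \<omega>))"
    using borel_measurable_continuous_on[OF h(1) Xm] h(2) by (intro integrable_const_bound[where B = "K + 1"]) auto
  show "integrable M (\<lambda>\<omega>. \<psi> (X \<omega>))"
    using borel_measurable_continuous_on[OF \<psi>(1) Xm] \<psi>(2) by (intro integrable_const_bound[where B = K]) auto
  let ?B = "\<Union>j<m. {\<omega> \<in> space M. R < \<bar>X \<omega> j\<bar>}"
  have ev: "{\<omega> \<in> space M. R < \<bar>X \<omega> j\<bar>} \<in> events" for j
    using X(1)[of j] by measurable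
  then show "?B \<in> events" by blast
  have "prob ?B \<le> (\<Sum>j<m. prob {\<omega> \<in> space M. R < \<bar>X \<omega> j\<bar>})"
    using ev by (intro finite_measure_subadditive_finite) auto
  also have "\<dots> \<le> (\<Sum>j<m. C / R\<^sup>2)"
  proof (rule sum_mono)
    fix j assume "j \<in> {..<m}"
    then have j: "j < m" by simp
    have "prob {\<omega> \<in> space M. R < \<bar>X \<omega> j\<bar>} \<le> expectation (\<lambda>\<omega>. (X \<omega> j)\<^sup>2) / R\<^sup>2"
      by (rule prob_abs_gt_le[OF X(1) sq(1)[OF j] R])
    also have "\<dots> \<le> C / R\<^sup>2" using sq(2)[OF j] by (rule divide_right_mono) simp
    finally show "prob {\<omega> \<in> space M. R < \<bar>X \<omega> j\<bar>} \<le> C / R\<^sup>2" .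
  qed
  finally show "prob ?B \<le> real m * C / R\<^sup>2" by simp
  show "\<bar>h (X \<omega>) - \<psi> (X \<omega>)\<bar> \<le> e" if "\<omega> \<in> space M - ?B" for \<omega>
    using that X(2) by (intro hR) (auto simp: not_less)
  show "\<bar>h (X \<omega>) - \<psi> (X \<omega>)\<bar> \<le> 2 * K + 1" for \<omega>
    using h(2)[of "X \<omega>"] \<psi>(2)[of "X \<omega>"] by linarith
  show "0 \<le> e" "0 \<le> 2 * K + 1" using e K by auto
qed

lemma integrable_trig:
  assumes f: "f \<in> trig m" and P: "prob_space P" and V: "\<And>j. (\<lambda>\<omega>. V \<omega> j) \<in> borel_measurable P"
  shows "integrable P (\<lambda>\<omega>. f (V \<omega>))"
proof -
  interpret prob_space P by fact
  obtain K where "\<And>x. \<bar>f x\<bar> \<le> K" using bounded_trig[OF f] by blast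
  moreover have "(\<lambda>\<omega>. f (V \<omega>)) \<in> borel_measurable P"
    using continuous_on_trig[OF f] measurable_coordinatewise_then_product[OF V]
    by (rule borel_measurable_continuous_on)
  ultimately show ?thesis by (intro integrable_const_bound[where B = K]) auto
qed

lemma expectation_trig_tendsto:
  fixes X :: "nat \<Rightarrow> 'a \<Rightarrow> nat \<Rightarrow> real" and Z :: "'b \<Rightarrow> nat \<Rightarrow> real"
  assumes M: "\<And>n. n \<ge> 1 \<Longrightarrow> prob_space (M n)" and N: "prob_space N"
    and X: "\<And>n j. n \<ge> 1 \<Longrightarrow> (\<lambda>\<omega>. X n \<omega> j) \<in> borel_measurable (M n)"
    and Z: "\<And>j. (\<lambda>\<omega>. Z \<omega> j) \<in> borel_measurable N"
    and cos: "\<And>\<theta>. (\<lambda>n. \<integral>\<omega>. cos (\<Sum>j<m. \<theta> j * X n \<omega> j) \<partial>M n) \<longlonglongrightarrow> (\<integral>\<omega>. cos (\<Sum>j<m. \<theta> j * Z \<omega> j) \<partial>N)"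
    and sin: "\<And>\<theta>. (\<lambda>n. \<integral>\<omega>. sin (\<Sum>j<m. \<theta> j * X n \<omega> j) \<partial>M n) \<longlonglongrightarrow> (\<integral>\<omega>. sin (\<Sum>j<m. \<theta> j * Z \<omega> j) \<partial>N)"
    and h: "h \<in> trig m"
  shows "(\<lambda>n. \<integral>\<omega>. h (X n \<omega>) \<partial>M n) \<longlonglongrightarrow> (\<integral>\<omega>. h (Z \<omega>) \<partial>N)"
  using h
proof induction
  case (cos \<theta>)
  show ?case by (rule assms(5))
next
  case (sin \<theta>)
  show ?case by (rule assms(6))
next
  case (scale f c)
  then show ?case by (simp add: tendsto_mult_left)
next
  case (add f g)
  have "(\<integral>\<omega>. f (Z \<omega>) + g (Z \<omega>) \<partial>N) = (\<integral>\<omega>. f (Z \<omega>) \<partial>N) + (\<integral>\<omega>. g (Z \<omega>) \<partial>N)"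
    using integrable_trig[OF add.hyps(1) N Z] integrable_trig[OF add.hyps(2) N Z] by simp
  \<comment> \<open>The rows are known to be probability spaces only for \<open>n \<ge> 1\<close>,
    so the integral is additive eventually rather than for all \<open>n\<close>.\<close>
  moreover have "\<forall>\<^sub>F n in sequentially.
      (\<integral>\<omega>. f (X n \<omega>) \<partial>M n) + (\<integral>\<omega>. g (X n \<omega>) \<partial>M n) = (\<integral>\<omega>. f (X n \<omega>) + g (X n \<omega>) \<partial>M n)"
    using eventually_ge_at_top[of 1]
  proof eventually_elim
    case (elim n)
    show ?case using integrable_trig[OF add.hyps(1) M[OF elim] X[OF elim]] integrable_trig[OF add.hyps(2) M[OF elim] X[OF elim]] by simp
  qed
  ultimately show ?case
    using Lim_transform_eventually[OF tendsto_add[OF add.IH]] by simp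
qed

text \<open>A continuity theorem for characteristic functions in dimension \<open>m\<close>. The
  common bound \<open>C\<close> on second moments makes one box work for all \<open>n\<close> and
  for the limit, which takes the place of a tightness argument.\<close>

lemma finite_dimensional_convergence:
  fixes X :: "nat \<Rightarrow> 'a \<Rightarrow> nat \<Rightarrow> real" and Z :: "'b \<Rightarrow> nat \<Rightarrow> real" and \<psi> :: "(nat \<Rightarrow> real) \<Rightarrow> real"
  assumes M: "\<And>n. n \<ge> 1 \<Longrightarrow> prob_space (M n)" and N: "prob_space N"
    and X: "\<And>n j. n \<ge> 1 \<Longrightarrow> (\<lambda>\<omega>. X n \<omega> j) \<in> borel_measurable (M n)" "\<And>n \<omega> j. j \<ge> m \<Longrightarrow> X n \<omega> j = 0"
    and Z: "\<And>j. (\<lambda>\<omega>. Z \<omega> j) \<in> borel_measurable N" "\<And>\<omega> j. j \<ge> m \<Longrightarrow> Z \<omega> j = 0"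
    and sqX: "\<And>n j. n \<ge> 1 \<Longrightarrow> j < m \<Longrightarrow> integrable (M n) (\<lambda>\<omega>. (X n \<omega> j)\<^sup>2)"
      "\<And>n j. n \<ge> 1 \<Longrightarrow> j < m \<Longrightarrow> (\<integral>\<omega>. (X n \<omega> j)\<^sup>2 \<partial>M n) \<le> C"
    and sqZ: "\<And>j. j < m \<Longrightarrow> integrable N (\<lambda>\<omega>. (Z \<omega> j)\<^sup>2)" "\<And>j. j < m \<Longrightarrow> (\<integral>\<omega>. (Z \<omega> j)\<^sup>2 \<partial>N) \<le> C"
    and cos: "\<And>\<theta>. (\<lambda>n. \<integral>\<omega>. cos (\<Sum>j<m. \<theta> j * X n \<omega> j) \<partial>M n) \<longlonglongrightarrow> (\<integral>\<omega>. cos (\<Sum>j<m. \<theta> j * Z \<omega> j) \<partial>N)"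
    and sin: "\<And>\<theta>. (\<lambda>n. \<integral>\<omega>. sin (\<Sum>j<m. \<theta> j * X n \<omega> j) \<partial>M n) \<longlonglongrightarrow> (\<integral>\<omega>. sin (\<Sum>j<m. \<theta> j * Z \<omega> j) \<partial>N)"
    and \<psi>: "continuous_on UNIV \<psi>" "\<And>x. \<bar>\<psi> x\<bar> \<le> K"
  shows "(\<lambda>n. \<integral>\<omega>. \<psi> (X n \<omega>) \<partial>M n) \<longlonglongrightarrow> (\<integral>\<omega>. \<psi> (Z \<omega>) \<partial>N)"
proof (rule LIMSEQ_I)
  fix r :: real assume r: "r > 0"
  have K: "K \<ge> 0" using order_trans[OF abs_ge_zero \<psi>(2)[of "\<lambda>_. 0"]] .
  \<comment> \<open>The 1 turns the bound \<open>K + e\<close> into \<open>K + 1\<close>, and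
    \<open>r / 12\<close> makes \<open>2 * e\<close> at most \<open>r / 6\<close>. The constant
    \<open>A\<close> below is chosen so that leaving the box contributes at most another
    \<open>r / 6\<close>.\<close>
  define e where "e = min 1 (r / 12)"
  have e: "e > 0" "e \<le> 1" "2 * e \<le> r / 6" using r by (auto simp: e_def)
  define C' where "C' = max 0 C"
  define A where "A = 6 * (2 * K + 1) * (real m * C') / r"
  have A: "A \<ge> 0" unfolding A_def C'_def using K r by (intro divide_nonneg_pos mult_nonneg_nonneg) auto
  define R where "R = sqrt (A + 1)"
  have R: "R > 0" "R\<^sup>2 = A + 1" using A by (auto simp: R_def)
  have RR: "(2 * K + 1) * (real m * C' / R\<^sup>2) \<le> r / 6"
  proof -
    have "(2 * K + 1) * (real m * C') = A * r / 6" using r by (simp add: A_def)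
    also have "\<dots> \<le> (A + 1) * r / 6" using r by simp
    finally show ?thesis using A r by (simp add: R field_simps)
  qed
  obtain h where h: "h \<in> trig m" "\<And>x. \<bar>h x\<bar> \<le> K + e"
    "\<And>x. (\<And>j. j < m \<Longrightarrow> \<bar>x j\<bar> \<le> R) \<Longrightarrow> (\<And>j. j \<ge> m \<Longrightarrow> x j = 0) \<Longrightarrow> \<bar>h x - \<psi> x\<bar> \<le> 2 * e"
    using trig_approximation[OF \<psi> e(1), of m R] by blast
  have h1: "\<bar>h x\<bar> \<le> K + 1" for x using h(2)[of x] e(2) by simp
  have "C \<le> C'" by (simp add: C'_def)
  have appX: "\<bar>(\<integral>\<omega>. h (X n \<omega>) \<partial>M n) - (\<integral>\<omega>. \<psi> (X n \<omega>) \<partial>M n)\<bar> \<le> r / 3" if n: "n \<ge> 1" for n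
  proof -
    interpret prob_space "M n" by (rule M[OF n])
    have "\<bar>(\<integral>\<omega>. h (X n \<omega>) \<partial>M n) - (\<integral>\<omega>. \<psi> (X n \<omega>) \<partial>M n)\<bar> \<le> 2 * e + (2 * K + 1) * (real m * C' / R\<^sup>2)"
      by (rule expectation_trig_approx[OF X(1)[OF n] X(2) sqX(1)[OF n] order_trans[OF sqX(2)[OF n] \<open>C \<le> C'\<close>] \<psi>
            continuous_on_trig[OF h(1)] h1 _ R(1) h(3)]) (use e in auto)
    then show ?thesis using RR e by linarith
  qed
  have appZ: "\<bar>(\<integral>\<omega>. h (Z \<omega>) \<partial>N) - (\<integral>\<omega>. \<psi> (Z \<omega>) \<partial>N)\<bar> \<le> r / 3"
  proof -
    interpret prob_space N by (rule N)
    have "\<bar>(\<integral>\<omega>. h (Z \<omega>) \<partial>N) - (\<integral>\<omega>. \<psi> (Z \<omega>) \<partial>N)\<bar> \<le> 2 * e + (2 * K + 1) * (real m * C' / R\<^sup>2)"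
      by (rule expectation_trig_approx[OF Z sqZ(1) order_trans[OF sqZ(2) \<open>C \<le> C'\<close>] \<psi>
            continuous_on_trig[OF h(1)] h1 _ R(1) h(3)]) (use e in auto)
    then show ?thesis using RR e by linarith
  qed
  obtain n0 where n0: "\<And>n. n \<ge> n0 \<Longrightarrow> norm ((\<integral>\<omega>. h (X n \<omega>) \<partial>M n) - (\<integral>\<omega>. h (Z \<omega>) \<partial>N)) < r / 3"
    using LIMSEQ_D[OF expectation_trig_tendsto[where X = X and Z = Z, OF M N X(1) Z(1) cos sin h(1)], of "r / 3"] r
    by auto
  have "norm ((\<integral>\<omega>. \<psi> (X n \<omega>) \<partial>M n) - (\<integral>\<omega>. \<psi> (Z \<omega>) \<partial>N)) < r" if "n \<ge> max 1 n0" for n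
  proof -
    have "n \<ge> 1" "n \<ge> n0" using that by auto
    then show ?thesis using appX[of n] n0[of n] appZ unfolding real_norm_def by linarith
  qed
  then show "\<exists>n0. \<forall>n\<ge>n0. norm ((\<integral>\<omega>. \<psi> (X n \<omega>) \<partial>M n) - (\<integral>\<omega>. \<psi> (Z \<omega>) \<partial>N)) < r"
    by blast
qed

subsection \<open>Independent errors\<close>

lemma exp_minus_approx:
  fixes x :: real
  assumes x: "x \<ge> 0"
  shows "\<bar>exp (- x) - (1 - x)\<bar> \<le> x\<^sup>2 / 2"
proof -
  have pos: "0 < 1 + x + x\<^sup>2 / 2" using x by (intro add_pos_nonneg) auto
  have "exp (- x) = 1 / exp x" by (simp add: exp_minus field_simps)
  also have "\<dots> \<le> 1 / (1 + x + x\<^sup>2 / 2)"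
    using exp_lower_Taylor_quadratic[OF x] pos by (intro divide_left_mono) auto
  also have "\<dots> \<le> 1 - x + x\<^sup>2 / 2"
  proof -
    \<comment> \<open>The product is a difference of squares,
      \<open>(1 + x\<^sup>2 / 2)\<^sup>2 - x\<^sup>2\<close>, whose terms of order two
      cancel.\<close>
    have "(1 - x + x\<^sup>2 / 2) * (1 + x + x\<^sup>2 / 2) = 1 + x ^ 4 / 4"
      by (simp add: algebra_simps power2_eq_square power4_eq_xxxx)
    then have "1 \<le> (1 - x + x\<^sup>2 / 2) * (1 + x + x\<^sup>2 / 2)" by simp
    then show ?thesis using pos by (simp add: divide_le_eq)
  qed
  finally show ?thesis using exp_ge_add_one_self[of "- x"] by (auto simp: abs_le_iff)
qed

section \<open>One row of errors: moments and characteristic functions\<close>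

locale error_row = prob_space +
  fixes n :: nat and \<epsilon> :: "nat \<Rightarrow> 'a \<Rightarrow> real"
  assumes indep: "indep_vars (\<lambda>_. borel) \<epsilon> {1..n}"
    and integrable_error: "\<And>i. i \<in> {1..n} \<Longrightarrow> integrable M (\<epsilon> i)"
    and mean_error: "\<And>i. i \<in> {1..n} \<Longrightarrow> expectation (\<epsilon> i) = 0"
    and integrable_square: "\<And>i. i \<in> {1..n} \<Longrightarrow> integrable M (\<lambda>\<omega>. (\<epsilon> i \<omega>)\<^sup>2)"
    and second_moment: "\<And>i. i \<in> {1..n} \<Longrightarrow> expectation (\<lambda>\<omega>. (\<epsilon> i \<omega>)\<^sup>2) = 1"
begin

lemma measurable_error: "i \<in> {1..n} \<Longrightarrow> \<epsilon> i \<in> borel_measurable M"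
  using integrable_error by blast

lemma
  assumes i: "i \<in> {1..n}" and j: "j \<in> {1..n}"
  shows integrable_error_mult: "integrable M (\<lambda>\<omega>. \<epsilon> i \<omega> * \<epsilon> j \<omega>)"
    and expectation_error_mult: "expectation (\<lambda>\<omega>. \<epsilon> i \<omega> * \<epsilon> j \<omega>) = (if i = j then 1 else 0)"
proof -
  \<comment> \<open>Independence of a member from a sum of other members, with a sum of a single
    term.\<close>
  have ne: "indep_var borel (\<epsilon> i) borel (\<epsilon> j)" if "i \<noteq> j"
    using indep_vars_sum[of "{j}" i \<epsilon>] indep_vars_subset[OF indep, of "{i, j}"] i j that by simp
  show "integrable M (\<lambda>\<omega>. \<epsilon> i \<omega> * \<epsilon> j \<omega>)"
    using integrable_square[OF i] indep_var_integrable[OF ne] integrable_error[OF i] integrable_error[OF j]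
    by (cases "i = j") (auto simp: power2_eq_square)
  show "expectation (\<lambda>\<omega>. \<epsilon> i \<omega> * \<epsilon> j \<omega>) = (if i = j then 1 else 0)"
    using second_moment[OF i] indep_var_lebesgue_integral[OF ne] integrable_error[OF i] integrable_error[OF j]
      mean_error[OF i] by (cases "i = j") (auto simp: power2_eq_square)
qed

lemma
  shows integrable_linear_square: "integrable M (\<lambda>\<omega>. (\<Sum>i=1..n. b i * \<epsilon> i \<omega>)\<^sup>2)"
    and expectation_linear_square: "expectation (\<lambda>\<omega>. (\<Sum>i=1..n. b i * \<epsilon> i \<omega>)\<^sup>2) = (\<Sum>i=1..n. (b i)\<^sup>2)"
proof -
  have eq: "(\<Sum>i=1..n. b i * \<epsilon> i \<omega>)\<^sup>2 = (\<Sum>i=1..n. \<Sum>j=1..n. b i * b j * (\<epsilon> i \<omega> * \<epsilon> j \<omega>))" for \<omega>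
    by (simp add: power2_eq_square sum_product algebra_simps)
  show "integrable M (\<lambda>\<omega>. (\<Sum>i=1..n. b i * \<epsilon> i \<omega>)\<^sup>2)"
    unfolding eq by (intro Bochner_Integration.integrable_sum integrable_mult_right integrable_error_mult)
  have "expectation (\<lambda>\<omega>. (\<Sum>i=1..n. b i * \<epsilon> i \<omega>)\<^sup>2) = (\<Sum>i=1..n. \<Sum>j=1..n. b i * b j * (if i = j then 1 else 0))"
  proof -
    have int: "integrable M (\<lambda>\<omega>. b i * b j * (\<epsilon> i \<omega> * \<epsilon> j \<omega>))" if "i \<in> {1..n}" "j \<in> {1..n}" for i j
      using integrable_error_mult[OF that] by (rule integrable_mult_right)
    have "expectation (\<lambda>\<omega>. (\<Sum>i=1..n. b i * \<epsilon> i \<omega>)\<^sup>2) =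
        (\<Sum>i=1..n. expectation (\<lambda>\<omega>. \<Sum>j=1..n. b i * b j * (\<epsilon> i \<omega> * \<epsilon> j \<omega>)))"
      unfolding eq by (intro Bochner_Integration.integral_sum Bochner_Integration.integrable_sum int)
    also have "\<dots> = (\<Sum>i=1..n. \<Sum>j=1..n. expectation (\<lambda>\<omega>. b i * b j * (\<epsilon> i \<omega> * \<epsilon> j \<omega>)))"
      by (intro sum.cong refl Bochner_Integration.integral_sum int)
    also have "\<dots> = (\<Sum>i=1..n. \<Sum>j=1..n. b i * b j * (if i = j then 1 else 0))"
      by (intro sum.cong refl) (simp only: integral_mult_right_zero expectation_error_mult)
    finally show ?thesis .
  qed
  also have "\<dots> = (\<Sum>i=1..n. (b i)\<^sup>2)"
    by (intro sum.cong refl) (simp add: power2_eq_square if_distrib[of "\<lambda>x. _ * x"] cong: if_cong)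
  finally show "expectation (\<lambda>\<omega>. (\<Sum>i=1..n. b i * \<epsilon> i \<omega>)\<^sup>2) = (\<Sum>i=1..n. (b i)\<^sup>2)" .
qed

text \<open>Lindeberg's estimate for one summand. The third order expansion leaves an error of
  \<open>min (6 * X\<^sup>2) (\<bar>X\<bar> ^ 3) / 6\<close> for
  \<open>X = b * \<epsilon> i\<close>. On the tail the square is used, giving \<open>v\<close>;
  elsewhere \<open>\<bar>X\<bar> \<le> \<beta> * \<delta>\<close>, so the cube is at most
  \<open>\<beta> * \<delta>\<close> times the square. The last term is the price of replacing
  \<open>1 - b\<^sup>2 / 2\<close> by the exponential.\<close>

lemma char_linear_error:
  assumes i: "i \<in> {1..n}" and \<beta>: "\<bar>b\<bar> \<le> \<beta> / sqrt (real n)" and \<delta>: "\<delta> > 0"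
    and v: "expectation (\<lambda>\<omega>. (\<epsilon> i \<omega>)\<^sup>2 * indicator {x. \<delta> * sqrt (real n) < \<bar>x\<bar>} (\<epsilon> i \<omega>)) \<le> v"
  shows "cmod (char (distr M borel (\<lambda>\<omega>. b * \<epsilon> i \<omega>)) 1 - complex_of_real (exp (- (b\<^sup>2 / 2)))) \<le>
    b\<^sup>2 * (v + \<beta> * \<delta> / 6 + \<beta>\<^sup>2 / (8 * real n))"
proof -
  have n: "real n > 0" using i by auto
  let ?I = "\<lambda>\<omega>. indicator {x. \<delta> * sqrt (real n) < \<bar>x\<bar>} (\<epsilon> i \<omega>) :: real"
  let ?X = "\<lambda>\<omega>. b * \<epsilon> i \<omega>"
  note [measurable] = measurable_error[OF i]
  have int: "integrable M (\<lambda>\<omega>. (?X \<omega>)\<^sup>2)"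
    using integrable_square[OF i] by (simp add: power_mult_distrib)
  have var: "variance ?X = b\<^sup>2"
    using mean_error[OF i] second_moment[OF i] by (simp add: power_mult_distrib)
  have "cmod (char (distr M borel ?X) 1 - (1 - 1\<^sup>2 * b\<^sup>2 / 2)) \<le>
      (1\<^sup>2 / 6) * expectation (\<lambda>\<omega>. min (6 * (?X \<omega>)\<^sup>2) (\<bar>1\<bar> * \<bar>?X \<omega>\<bar> ^ 3))"
    by (rule char_approx3'[OF _ _ int _ var refl]) (use integrable_error[OF i] mean_error[OF i] in auto)
  then have "cmod (char (distr M borel ?X) 1 - (1 - b\<^sup>2 / 2)) \<le>
      expectation (\<lambda>\<omega>. min (6 * (?X \<omega>)\<^sup>2) (\<bar>?X \<omega>\<bar> ^ 3)) / 6" by simp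
  also have "expectation (\<lambda>\<omega>. min (6 * (?X \<omega>)\<^sup>2) (\<bar>?X \<omega>\<bar> ^ 3)) \<le>
      expectation (\<lambda>\<omega>. 6 * b\<^sup>2 * ((\<epsilon> i \<omega>)\<^sup>2 * ?I \<omega>) + b\<^sup>2 * (\<beta> * \<delta>) * (\<epsilon> i \<omega>)\<^sup>2)"
  proof (rule integral_mono_AE)
    show "AE \<omega> in M. min (6 * (?X \<omega>)\<^sup>2) (\<bar>?X \<omega>\<bar> ^ 3) \<le> 6 * b\<^sup>2 * ((\<epsilon> i \<omega>)\<^sup>2 * ?I \<omega>) + b\<^sup>2 * (\<beta> * \<delta>) * (\<epsilon> i \<omega>)\<^sup>2"
    proof (rule AE_I2)
      fix \<omega>
      have \<beta>0: "\<beta> \<ge> 0" using order_trans[OF abs_ge_zero \<beta>] n by (simp add: zero_le_divide_iff)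
      show "min (6 * (?X \<omega>)\<^sup>2) (\<bar>?X \<omega>\<bar> ^ 3) \<le> 6 * b\<^sup>2 * ((\<epsilon> i \<omega>)\<^sup>2 * ?I \<omega>) + b\<^sup>2 * (\<beta> * \<delta>) * (\<epsilon> i \<omega>)\<^sup>2"
      proof (cases "\<delta> * sqrt (real n) < \<bar>\<epsilon> i \<omega>\<bar>")
        case True
        have "0 \<le> b\<^sup>2 * (\<beta> * \<delta>) * (\<epsilon> i \<omega>)\<^sup>2" using \<beta>0 \<delta> by simp
        then show ?thesis using True by (simp add: power_mult_distrib min_def)
      next
        case False
        have "\<bar>b\<bar> * \<bar>\<epsilon> i \<omega>\<bar> \<le> (\<beta> / sqrt (real n)) * (\<delta> * sqrt (real n))"
          using False \<beta> \<beta>0 n by (intro mult_mono) auto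
        also have "\<dots> = \<beta> * \<delta>" using n by simp
        finally have "(b\<^sup>2 * (\<epsilon> i \<omega>)\<^sup>2) * (\<bar>b\<bar> * \<bar>\<epsilon> i \<omega>\<bar>) \<le> (b\<^sup>2 * (\<epsilon> i \<omega>)\<^sup>2) * (\<beta> * \<delta>)"
          by (intro mult_left_mono) auto
        moreover have "\<bar>?X \<omega>\<bar> ^ 3 = (b\<^sup>2 * (\<epsilon> i \<omega>)\<^sup>2) * (\<bar>b\<bar> * \<bar>\<epsilon> i \<omega>\<bar>)"
          by (simp add: abs_mult power3_eq_cube power2_eq_square power_mult_distrib flip: abs_mult)
        ultimately show ?thesis using False by (simp add: min_le_iff_disj algebra_simps)
      qed
    qed
    show "integrable M (\<lambda>\<omega>. min (6 * (?X \<omega>)\<^sup>2) (\<bar>?X \<omega>\<bar> ^ 3))"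
      by (rule Bochner_Integration.integrable_bound[OF integrable_mult_right[OF int, of 6]]) auto
    show "integrable M (\<lambda>\<omega>. 6 * b\<^sup>2 * ((\<epsilon> i \<omega>)\<^sup>2 * ?I \<omega>) + b\<^sup>2 * (\<beta> * \<delta>) * (\<epsilon> i \<omega>)\<^sup>2)"
      by (intro Bochner_Integration.integrable_add integrable_mult_right integrable_square[OF i]
          Bochner_Integration.integrable_bound[OF integrable_square[OF i]]) (auto simp: indicator_def)
  qed
  also have "\<dots> = 6 * b\<^sup>2 * expectation (\<lambda>\<omega>. (\<epsilon> i \<omega>)\<^sup>2 * ?I \<omega>) + b\<^sup>2 * (\<beta> * \<delta>)"
  proof -
    have "integrable M (\<lambda>\<omega>. (\<epsilon> i \<omega>)\<^sup>2 * ?I \<omega>)"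
      by (rule Bochner_Integration.integrable_bound[OF integrable_square[OF i]]) (auto simp: indicator_def)
    then show ?thesis
      using integrable_square[OF i] second_moment[OF i] by (subst Bochner_Integration.integral_add) auto
  qed
  also have "\<dots> \<le> 6 * b\<^sup>2 * v + b\<^sup>2 * (\<beta> * \<delta>)" using v by (intro add_right_mono mult_left_mono) auto
  finally have 1: "cmod (char (distr M borel ?X) 1 - complex_of_real (1 - b\<^sup>2 / 2)) \<le> b\<^sup>2 * (v + \<beta> * \<delta> / 6)"
    by (simp add: algebra_simps)
  have "cmod (complex_of_real (1 - b\<^sup>2 / 2) - complex_of_real (exp (- (b\<^sup>2 / 2)))) = \<bar>exp (- (b\<^sup>2 / 2)) - (1 - b\<^sup>2 / 2)\<bar>"
    unfolding of_real_diff[symmetric] norm_of_real by (rule abs_minus_commute)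
  also have "\<dots> \<le> (b\<^sup>2 / 2)\<^sup>2 / 2" by (rule exp_minus_approx) simp
  also have "\<dots> = b\<^sup>2 * (b\<^sup>2 / 8)" by (simp add: power2_eq_square)
  also have "\<dots> \<le> b\<^sup>2 * (\<beta>\<^sup>2 / (8 * real n))"
  proof (rule mult_left_mono)
    have "\<bar>b\<bar>\<^sup>2 \<le> (\<beta> / sqrt (real n))\<^sup>2" using \<beta> by (intro power_mono) auto
    then show "b\<^sup>2 / 8 \<le> \<beta>\<^sup>2 / (8 * real n)" using n by (simp add: power_divide field_simps)
  qed simp
  finally show ?thesis
    using 1 norm_triangle_ineq[of "char (distr M borel ?X) 1 - complex_of_real (1 - b\<^sup>2 / 2)"
        "complex_of_real (1 - b\<^sup>2 / 2) - complex_of_real (exp (- (b\<^sup>2 / 2)))"]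
    by (simp add: distrib_left)
qed

text \<open>Independence turns the expectation into a product of characteristic functions, and the
  Gaussian value factorises in the same way. All factors have modulus at most 1, so the products
  differ by at most the sum of the differences of the factors.\<close>

lemma iexp_linear_error:
  assumes \<beta>: "\<And>i. i \<in> {1..n} \<Longrightarrow> \<bar>b i\<bar> \<le> \<beta> / sqrt (real n)" and \<delta>: "\<delta> > 0"
    and v: "\<And>i. i \<in> {1..n} \<Longrightarrow>
      expectation (\<lambda>\<omega>. (\<epsilon> i \<omega>)\<^sup>2 * indicator {x. \<delta> * sqrt (real n) < \<bar>x\<bar>} (\<epsilon> i \<omega>)) \<le> v"
  shows "cmod ((CLINT \<omega>|M. iexp (\<Sum>i=1..n. b i * \<epsilon> i \<omega>)) - complex_of_real (exp (- ((\<Sum>i=1..n. (b i)\<^sup>2) / 2)))) \<le>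
    (\<Sum>i=1..n. (b i)\<^sup>2) * (v + \<beta> * \<delta> / 6 + \<beta>\<^sup>2 / (8 * real n))"
proof -
  let ?X = "\<lambda>i \<omega>. b i * \<epsilon> i \<omega>"
  have meas [measurable]: "(\<lambda>\<omega>. \<Sum>i=1..n. ?X i \<omega>) \<in> borel_measurable M"
    using measurable_error by (intro borel_measurable_sum borel_measurable_times) auto
  have ind: "indep_vars (\<lambda>_. borel) ?X {1..n}"
    by (rule indep_vars_compose2[OF indep]) simp
  have "(CLINT \<omega>|M. iexp (\<Sum>i=1..n. ?X i \<omega>)) = char (distr M borel (\<lambda>\<omega>. \<Sum>i=1..n. ?X i \<omega>)) 1"
    unfolding char_def by (subst integral_distr[OF meas]) simp_all
  also have "\<dots> = (\<Prod>i=1..n. char (distr M borel (?X i)) 1)"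
    by (rule char_distr_sum[OF ind])
  finally have 1: "(CLINT \<omega>|M. iexp (\<Sum>i=1..n. ?X i \<omega>)) = (\<Prod>i=1..n. char (distr M borel (?X i)) 1)" .
  have 2: "complex_of_real (exp (- ((\<Sum>i=1..n. (b i)\<^sup>2) / 2))) = (\<Prod>i=1..n. complex_of_real (exp (- ((b i)\<^sup>2 / 2))))"
    by (simp add: sum_divide_distrib flip: sum_negf exp_sum of_real_prod)
  have "cmod ((\<Prod>i=1..n. char (distr M borel (?X i)) 1) - (\<Prod>i=1..n. complex_of_real (exp (- ((b i)\<^sup>2 / 2))))) \<le>
      (\<Sum>i=1..n. cmod (char (distr M borel (?X i)) 1 - complex_of_real (exp (- ((b i)\<^sup>2 / 2)))))"
  proof (rule norm_prod_diff)
    fix i assume i: "i \<in> {1..n}"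
    interpret D: real_distribution "distr M borel (?X i)"
      using measurable_error[OF i] by (intro real_distribution_distr) simp
    show "cmod (char (distr M borel (?X i)) 1) \<le> 1" by (rule D.cmod_char_le_1)
    show "cmod (complex_of_real (exp (- ((b i)\<^sup>2 / 2)))) \<le> 1" by (simp add: norm_of_real del: of_real_exp)
  qed
  also have "\<dots> \<le> (\<Sum>i=1..n. (b i)\<^sup>2 * (v + \<beta> * \<delta> / 6 + \<beta>\<^sup>2 / (8 * real n)))"
    by (intro sum_mono char_linear_error \<beta> v \<delta>)
  finally show ?thesis unfolding 1 2 by (simp add: sum_distrib_right)
qed

end

text \<open>Stop at the first index where the partial sum exceeds \<open>2 * r\<close>. The
  remaining sum is independent of the past and stays within \<open>r\<close> with probability at
  least one half, and whenever it does, the total sum still exceeds \<open>r\<close>.\<close>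

lemma (in prob_space) ottaviani_inequality:
  fixes X :: "nat \<Rightarrow> 'a \<Rightarrow> real"
  assumes indep: "indep_vars (\<lambda>_. borel) X I" and ab: "{a<..b} \<subseteq> I" "a \<le> b"
    and half: "\<And>k. a \<le> k \<Longrightarrow> k \<le> b \<Longrightarrow> prob {\<omega> \<in> space M. r < \<bar>\<Sum>i\<in>{k<..b}. X i \<omega>\<bar>} \<le> 1 / 2"
  shows "prob {\<omega> \<in> space M. \<exists>k\<in>{a..b}. 2 * r < \<bar>\<Sum>i\<in>{a<..k}. X i \<omega>\<bar>} \<le>
    2 * prob {\<omega> \<in> space M. r < \<bar>\<Sum>i\<in>{a<..b}. X i \<omega>\<bar>}"
proof -
  have X: "X i \<in> borel_measurable M" if "i \<in> {a<..b}" for i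
    using indep ab that unfolding indep_vars_def by blast
  have S[measurable]: "(\<lambda>\<omega>. \<Sum>i\<in>J. X i \<omega>) \<in> borel_measurable M" if "J \<subseteq> {a<..b}" for J
    using X that by (intro borel_measurable_sum) auto
  define S where "S k \<omega> = (\<Sum>i\<in>{a<..k}. X i \<omega>)" for k \<omega>
  define T where "T k \<omega> = (\<Sum>i\<in>{k<..b}. X i \<omega>)" for k \<omega>
  have Sm: "S k \<in> borel_measurable M" if "k \<le> b" for k
    unfolding S_def using that by (intro S) auto
  have Tm: "T k \<in> borel_measurable M" if "k \<ge> a" for k
    unfolding T_def using that by (intro S) auto
  have split: "S b \<omega> = S k \<omega> + T k \<omega>" if "a \<le> k" "k \<le> b" for k \<omega>
  proof -
    have "{a<..b} = {a<..k} \<union> {k<..b}" using that by auto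
    then show ?thesis unfolding S_def T_def by (simp add: sum.union_disjoint)
  qed
  define A where "A k = {\<omega> \<in> space M. 2 * r < \<bar>S k \<omega>\<bar> \<and> (\<forall>j\<in>{a..<k}. \<bar>S j \<omega>\<bar> \<le> 2 * r)}" for k
  define G where "G k = {\<omega> \<in> space M. \<bar>T k \<omega>\<bar> \<le> r}" for k
  have A[measurable]: "A k \<in> events" if "k \<le> b" for k
  proof -
    have "S j \<in> borel_measurable M" if "j \<in> insert k {a..<k}" for j
      using that \<open>k \<le> b\<close> by (intro Sm) auto
    then show ?thesis unfolding A_def
      by (intro sets.sets_Collect_conj sets.sets_Collect_finite_All) (auto simp: borel_measurable_le borel_measurable_less intro!: borel_measurable_abs borel_measurable_less borel_measurable_le)
  qed
  have G[measurable]: "G k \<in> events" if "a \<le> k" for k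
    using Tm[OF that] unfolding G_def by measurable
  have indepA: "prob (A k \<inter> G k) = prob (A k) * prob (G k)" if k: "a \<le> k" "k \<le> b" for k
  proof -
    \<comment> \<open>\<open>A k\<close> depends on the variables up to \<open>k\<close> and
      \<open>G k\<close> on the later ones. Both events are rewritten as preimages under the
      restrictions to these two index blocks, where independence of the restricted families
      applies.\<close>
    have iv: "indep_var (PiM {a<..k} (\<lambda>_. borel)) (\<lambda>\<omega>. restrict (\<lambda>i. X i \<omega>) {a<..k})
        (PiM {k<..b} (\<lambda>_. borel)) (\<lambda>\<omega>. restrict (\<lambda>i. X i \<omega>) {k<..b})"
      using ab k by (intro indep_var_restrict[OF indep]) auto
    let ?P = "PiM {a<..k} (\<lambda>_. borel) :: (nat \<Rightarrow> real) measure"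
    let ?Q = "PiM {k<..b} (\<lambda>_. borel) :: (nat \<Rightarrow> real) measure"
    have sm: "(\<lambda>f. \<Sum>i\<in>J. f i) \<in> borel_measurable (PiM I (\<lambda>_. borel :: real measure))" if "J \<subseteq> I" for J I :: "nat set"
      using that by (intro borel_measurable_sum measurable_component_singleton) auto
    define Xa where "Xa = {f \<in> space ?P. 2 * r < \<bar>\<Sum>i\<in>{a<..k}. f i\<bar> \<and> (\<forall>j\<in>{a..<k}. \<bar>\<Sum>i\<in>{a<..j}. f i\<bar> \<le> 2 * r)}"
    define Xb where "Xb = {f \<in> space ?Q. \<bar>\<Sum>i\<in>{k<..b}. f i\<bar> \<le> r}"
    have Xa: "Xa \<in> sets ?P"
      unfolding Xa_def using sm
      by (intro sets.sets_Collect_conj sets.sets_Collect_finite_All borel_measurable_less borel_measurable_le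
          borel_measurable_abs sm) auto
    have Xb: "Xb \<in> sets ?Q"
      unfolding Xb_def by (intro borel_measurable_le borel_measurable_abs sm) auto
    have a: "(\<lambda>\<omega>. restrict (\<lambda>i. X i \<omega>) {a<..k}) -` Xa \<inter> space M = A k"
    proof -
      have "(\<Sum>i\<in>{a<..j}. restrict (\<lambda>i. X i \<omega>) {a<..k} i) = S j \<omega>" if "j \<le> k" for j \<omega>
        unfolding S_def using that by (intro sum.cong) auto
      then show ?thesis unfolding Xa_def A_def by (auto simp: space_PiM simp del: restrict_apply)
    qed
    have b: "(\<lambda>\<omega>. restrict (\<lambda>i. X i \<omega>) {k<..b}) -` Xb \<inter> space M = G k"
    proof -
      have "(\<Sum>i\<in>{k<..b}. restrict (\<lambda>i. X i \<omega>) {k<..b} i) = T k \<omega>" for \<omega>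
        unfolding T_def by (intro sum.cong) auto
      then show ?thesis unfolding Xb_def G_def by (auto simp: space_PiM simp del: restrict_apply)
    qed
    have "(\<lambda>x. (restrict (\<lambda>i. X i x) {a<..k}, restrict (\<lambda>i. X i x) {k<..b})) -` (Xa \<times> Xb) \<inter> space M = A k \<inter> G k"
      unfolding a[symmetric] b[symmetric] by auto
    then show ?thesis using indep_varD[OF iv Xa Xb] unfolding a b by simp
  qed
  have halfG: "1 / 2 \<le> prob (G k)" if k: "a \<le> k" "k \<le> b" for k
  proof -
    have "G k = space M - {\<omega> \<in> space M. r < \<bar>T k \<omega>\<bar>}" unfolding G_def by auto
    moreover have "{\<omega> \<in> space M. r < \<bar>T k \<omega>\<bar>} \<in> events" using Tm[OF k(1)] by measurable
    ultimately show ?thesis using half[OF k] prob_compl[of "{\<omega> \<in> space M. r < \<bar>T k \<omega>\<bar>}"] by (simp add: T_def)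
  qed
  have disj: "disjoint_family_on A {a..b}"
  proof -
    have "A k \<inter> A j = {}" if "k < j" "a \<le> k" for k j
      unfolding A_def using that by force
    then show ?thesis unfolding disjoint_family_on_def by (metis Int_commute atLeastAtMost_iff linorder_neqE_nat)
  qed
  have Un: "{\<omega> \<in> space M. \<exists>k\<in>{a..b}. 2 * r < \<bar>S k \<omega>\<bar>} = (\<Union>k\<in>{a..b}. A k)"
  proof safe
    fix \<omega> k assume k: "\<omega> \<in> space M" "k \<in> {a..b}" "2 * r < \<bar>S k \<omega>\<bar>"
    define l where "l = (LEAST l. l \<in> {a..b} \<and> 2 * r < \<bar>S l \<omega>\<bar>)"
    have l: "l \<in> {a..b}" "2 * r < \<bar>S l \<omega>\<bar>"
      using LeastI[of "\<lambda>l. l \<in> {a..b} \<and> 2 * r < \<bar>S l \<omega>\<bar>" k] k unfolding l_def by auto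
    have "\<bar>S j \<omega>\<bar> \<le> 2 * r" if "j \<in> {a..<l}" for j
      using not_less_Least[of j "\<lambda>l. l \<in> {a..b} \<and> 2 * r < \<bar>S l \<omega>\<bar>"] that l unfolding l_def[symmetric] by auto
    then show "\<omega> \<in> (\<Union>k\<in>{a..b}. A k)" using l k unfolding A_def by auto
  qed (auto simp: A_def)
  have "prob {\<omega> \<in> space M. \<exists>k\<in>{a..b}. 2 * r < \<bar>S k \<omega>\<bar>} = (\<Sum>k\<in>{a..b}. prob (A k))"
    unfolding Un using disj by (intro finite_measure_finite_Union) auto
  also have "\<dots> \<le> (\<Sum>k\<in>{a..b}. 2 * prob (A k \<inter> G k))"
  proof (rule sum_mono)
    fix k assume k: "k \<in> {a..b}"
    have "prob (A k) * (1 / 2) \<le> prob (A k) * prob (G k)"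
      using halfG k by (intro mult_left_mono) auto
    then show "prob (A k) \<le> 2 * prob (A k \<inter> G k)" using indepA k by simp
  qed
  also have "\<dots> = 2 * prob (\<Union>k\<in>{a..b}. A k \<inter> G k)"
  proof -
    have "disjoint_family_on (\<lambda>k. A k \<inter> G k) {a..b}" using disj unfolding disjoint_family_on_def by blast
    then show ?thesis
      by (subst finite_measure_finite_Union) (auto simp: sum_distrib_left image_subset_iff A G)
  qed
  also have "\<dots> \<le> 2 * prob {\<omega> \<in> space M. r < \<bar>S b \<omega>\<bar>}"
  proof (intro mult_left_mono finite_measure_mono)
    show "(\<Union>k\<in>{a..b}. A k \<inter> G k) \<subseteq> {\<omega> \<in> space M. r < \<bar>S b \<omega>\<bar>}"
    proof
      fix \<omega> assume "\<omega> \<in> (\<Union>k\<in>{a..b}. A k \<inter> G k)"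
      then obtain k where "k \<in> {a..b}" "\<omega> \<in> A k" "\<omega> \<in> G k" by blast
      then show "\<omega> \<in> {\<omega> \<in> space M. r < \<bar>S b \<omega>\<bar>}"
        using split[of k \<omega>] unfolding A_def G_def by auto
    qed
    show "{\<omega> \<in> space M. r < \<bar>S b \<omega>\<bar>} \<in> events" using Sm[of b] by measurable
  qed simp
  finally show ?thesis by (simp add: S_def)
qed

subsection \<open>Recursive residuals of the errors\<close>

text \<open>Indexed by the number \<open>k\<close> of observations that precede, so
  \<open>residual y k\<close> is the recursive residual of observation \<open>k + 1\<close>.\<close>

definition residual :: "(nat \<Rightarrow> real) \<Rightarrow> nat \<Rightarrow> real" where
  "residual y k = (y (Suc k) - (\<Sum>j=1..k. y j) / real k) / sqrt (1 + 1 / real k)"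

text \<open>For \<open>k \<ge> 1\<close> these are the rows of a Helmert matrix other than the
  constant one.\<close>

definition residual_coeff :: "nat \<Rightarrow> nat \<Rightarrow> real" where
  "residual_coeff k i =
     (if i = Suc k then 1 else if i \<in> {1..k} then - (1 / real k) else 0) / sqrt (1 + 1 / real k)"

lemma residual_eq_sum:
  assumes "k < n"
  shows "residual y k = (\<Sum>i=1..n. residual_coeff k i * y i)"
proof -
  have "(\<Sum>i=1..n. residual_coeff k i * y i) = (\<Sum>i=1..Suc k. residual_coeff k i * y i)"
    using assms by (intro sum.mono_neutral_right) (auto simp: residual_coeff_def)
  also have "\<dots> = (\<Sum>i=1..k. - (1 / real k) / sqrt (1 + 1 / real k) * y i) + y (Suc k) / sqrt (1 + 1 / real k)"
    by (simp add: residual_coeff_def)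
  also have "\<dots> = residual y k"
    unfolding residual_def sum_distrib_left[symmetric] by (simp add: diff_divide_distrib)
  finally show ?thesis by simp
qed

text \<open>For \<open>k < l\<close> the row with index \<open>l\<close> is constant on the first
  \<open>k + 1\<close> positions, and the residual of a constant sequence is 0.\<close>

lemma residual_coeff_orthonormal:
  assumes k: "1 \<le> k" "k < n" and l: "1 \<le> l" "l < n"
  shows "(\<Sum>i=1..n. residual_coeff k i * residual_coeff l i) = (if k = l then 1 else 0)"
proof -
  have less: "(\<Sum>i=1..n. residual_coeff k i * residual_coeff l i) = 0" if k: "1 \<le> k" "k < l" "k < n" for k l
  proof -
    have "residual_coeff l j = - (1 / real l) / sqrt (1 + 1 / real l)" if "1 \<le> j" "j \<le> Suc k" for j
      using that k by (simp add: residual_coeff_def)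
    then have "residual (residual_coeff l) k = 0"
      using k by (simp add: residual_def)
    then show ?thesis using residual_eq_sum[OF k(3)] by simp
  qed
  have diag: "(\<Sum>i=1..n. residual_coeff k i * residual_coeff k i) = 1"
  proof -
    define s where "s = sqrt (1 + 1 / real k)"
    have s: "s * s = 1 + 1 / real k" "s > 0" using k by (auto simp: s_def add_pos_nonneg)
    have "residual (residual_coeff k) k = (1 / s - (\<Sum>j=1..k. - (1 / real k) / s) / real k) / s"
      by (simp add: residual_def residual_coeff_def s_def)
    also have "\<dots> = (1 + 1 / real k) / (s * s)" using k s by (simp add: field_simps)
    also have "\<dots> = 1" using s(1) mult_pos_pos[OF s(2) s(2)] by simp
    finally show ?thesis using residual_eq_sum[OF k(2)] by simp
  qed
  show ?thesis
    using less[of k l] less[of l k] diag k l by (cases k l rule: linorder_cases) (auto simp: mult.commute)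
qed

lemma residual_combination:
  assumes A: "A \<subseteq> {1..<n}"
  shows "(\<Sum>k\<in>A. c k * residual y k) = (\<Sum>i=1..n. (\<Sum>k\<in>A. c k * residual_coeff k i) * y i)"
proof -
  have "(\<Sum>k\<in>A. c k * residual y k) = (\<Sum>k\<in>A. \<Sum>i=1..n. c k * residual_coeff k i * y i)"
    using A residual_eq_sum[of _ n y] by (intro sum.cong refl) (auto simp: sum_distrib_left mult.assoc)
  also have "\<dots> = (\<Sum>i=1..n. \<Sum>k\<in>A. c k * residual_coeff k i * y i)" by (rule sum.swap)
  finally show ?thesis by (simp add: sum_distrib_right)
qed

text \<open>Parseval's identity for the orthonormal rows. For uncorrelated errors of unit variance
  it is the variance of a combination of residuals.\<close>

lemma residual_combination_square:
  assumes A: "A \<subseteq> {1..<n}"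
  shows "(\<Sum>i=1..n. (\<Sum>k\<in>A. c k * residual_coeff k i)\<^sup>2) = (\<Sum>k\<in>A. (c k)\<^sup>2)"
proof -
  have fin: "finite A" using A finite_subset by blast
  have "(\<Sum>i=1..n. (\<Sum>k\<in>A. c k * residual_coeff k i)\<^sup>2) =
      (\<Sum>i=1..n. \<Sum>k\<in>A. \<Sum>l\<in>A. c k * c l * (residual_coeff k i * residual_coeff l i))"
    by (intro sum.cong refl) (simp add: power2_eq_square sum_product algebra_simps)
  also have "\<dots> = (\<Sum>k\<in>A. \<Sum>i=1..n. \<Sum>l\<in>A. c k * c l * (residual_coeff k i * residual_coeff l i))"
    by (rule sum.swap)
  also have "\<dots> = (\<Sum>k\<in>A. \<Sum>l\<in>A. \<Sum>i=1..n. c k * c l * (residual_coeff k i * residual_coeff l i))"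
    by (intro sum.cong refl sum.swap)
  also have "\<dots> = (\<Sum>k\<in>A. \<Sum>l\<in>A. c k * c l * (if k = l then 1 else 0))"
  proof (intro sum.cong refl)
    fix k l assume "k \<in> A" "l \<in> A"
    then have "1 \<le> k" "k < n" "1 \<le> l" "l < n" using A by auto
    from residual_coeff_orthonormal[OF this]
    show "(\<Sum>i=1..n. c k * c l * (residual_coeff k i * residual_coeff l i)) = c k * c l * (if k = l then 1 else 0)"
      by (simp only: sum_distrib_left[symmetric])
  qed
  also have "\<dots> = (\<Sum>k\<in>A. (c k)\<^sup>2)"
    using fin by (intro sum.cong refl) (simp add: power2_eq_square if_distrib[of "\<lambda>x. _ * x"] cong: if_cong)
  finally show ?thesis .
qed

lemma residual_coeff_abs_le:
  "\<bar>residual_coeff k i\<bar> \<le> (if i = Suc k then 1 else 0) + 1 / real k"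
proof -
  define s where "s = sqrt (1 + 1 / real k)"
  have s: "1 \<le> s" by (simp add: s_def)
  define a where "a = (if i = Suc k then 1 else if i \<in> {1..k} then - (1 / real k) else 0)"
  have "\<bar>residual_coeff k i\<bar> = \<bar>a\<bar> / s"
    using s by (simp add: residual_coeff_def s_def a_def)
  also have "\<dots> \<le> \<bar>a\<bar> / 1" using s by (intro divide_left_mono) auto
  also have "\<dots> \<le> (if i = Suc k then 1 else 0) + 1 / real k" by (simp add: a_def)
  finally show ?thesis .
qed

text \<open>In \<open>tail\<close> one null sequence serves all entries of a row at once; it
  supplies the constant \<open>v\<close> of the Lindeberg estimate for each summand.\<close>

locale error_array =
  fixes M :: "nat \<Rightarrow> 'a measure" and \<epsilon> :: "nat \<Rightarrow> nat \<Rightarrow> 'a \<Rightarrow> real"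
  assumes row: "\<And>n. n \<ge> 1 \<Longrightarrow> error_row (M n) n (\<epsilon> n)"
    and tail: "\<And>\<delta>. \<delta> > 0 \<Longrightarrow> \<exists>v. v \<longlonglongrightarrow> 0 \<and> (\<forall>n\<ge>1. \<forall>i\<in>{1..n}.
      (\<integral>\<omega>. (\<epsilon> n i \<omega>)\<^sup>2 * indicator {x. \<delta> * sqrt (real n) < \<bar>x\<bar>} (\<epsilon> n i \<omega>) \<partial>M n) \<le> v n)"
begin

lemma prob_space_row: "n \<ge> 1 \<Longrightarrow> prob_space (M n)"
  using row error_row.axioms(1) by blast

text \<open>Stated as a difference because the sums of squares are only assumed bounded; where they
  converge, the limit is identified afterwards. Coefficients of order \<open>1 / sqrt n\<close> are
  what makes truncation of the errors at \<open>\<delta> * sqrt n\<close> effective.\<close>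

lemma iexp_linear_tendsto:
  assumes \<beta>: "\<And>n i. n \<ge> N \<Longrightarrow> i \<in> {1..n} \<Longrightarrow> \<bar>b n i\<bar> \<le> \<beta> / sqrt (real n)"
    and S: "\<And>n. n \<ge> N \<Longrightarrow> (\<Sum>i=1..n. (b n i)\<^sup>2) \<le> S"
  shows "(\<lambda>n. (CLINT \<omega>|M n. iexp (\<Sum>i=1..n. b n i * \<epsilon> n i \<omega>)) - complex_of_real (exp (- ((\<Sum>i=1..n. (b n i)\<^sup>2) / 2))))
    \<longlonglongrightarrow> 0"
proof (rule LIMSEQ_I)
  fix r :: real assume r: "r > 0"
  define S' where "S' = max 1 S"
  define \<beta>' where "\<beta>' = max 1 \<beta>"
  have S': "S' > 0" "S \<le> S'" and \<beta>': "\<beta>' > 0" "\<beta> \<le> \<beta>'" by (auto simp: S'_def \<beta>'_def)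
  \<comment> \<open>Chosen so that the contribution \<open>S' * (\<beta>' * \<delta> / 6)\<close> of
    the truncated part is exactly \<open>r / 6\<close>. The maxima with 1 make the denominator
    positive.\<close>
  define \<delta> where "\<delta> = r / (S' * \<beta>')"
  have \<delta>: "\<delta> > 0" using r S' \<beta>' by (simp add: \<delta>_def)
  obtain v where v: "v \<longlonglongrightarrow> 0" and vb: "\<And>n i. n \<ge> 1 \<Longrightarrow> i \<in> {1..n} \<Longrightarrow>
      (\<integral>\<omega>. (\<epsilon> n i \<omega>)\<^sup>2 * indicator {x. \<delta> * sqrt (real n) < \<bar>x\<bar>} (\<epsilon> n i \<omega>) \<partial>M n) \<le> v n"
    using tail[OF \<delta>] by blast
  have "(\<lambda>n. \<beta>'\<^sup>2 / (8 * real n)) \<longlonglongrightarrow> 0" by real_asymp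
  then have "(\<lambda>n. S' * (v n + \<beta>'\<^sup>2 / (8 * real n))) \<longlonglongrightarrow> S' * (0 + 0)"
    using v by (intro tendsto_intros)
  then have "\<forall>\<^sub>F n in sequentially. S' * (v n + \<beta>'\<^sup>2 / (8 * real n)) < r / 2"
    using r by (intro order_tendstoD) auto
  moreover have "\<forall>\<^sub>F n in sequentially. n \<ge> max 1 N" by (rule eventually_ge_at_top)
  ultimately have "\<forall>\<^sub>F n in sequentially. norm ((CLINT \<omega>|M n. iexp (\<Sum>i=1..n. b n i * \<epsilon> n i \<omega>)) -
      complex_of_real (exp (- ((\<Sum>i=1..n. (b n i)\<^sup>2) / 2))) - 0) < r"
  proof eventually_elim
    case (elim n)
    then have n: "n \<ge> 1" "n \<ge> N" by auto
    interpret error_row "M n" n "\<epsilon> n" by (rule row[OF n(1)])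
    have \<beta>n: "\<bar>b n i\<bar> \<le> \<beta>' / sqrt (real n)" if "i \<in> {1..n}" for i
      using order_trans[OF \<beta>[OF n(2) that] divide_right_mono[OF \<beta>'(2)]] by simp
    \<comment> \<open>Nonnegativity of \<open>v n\<close> is what allows the sum of squares in front
      to be replaced by its upper bound \<open>S'\<close>.\<close>
    have "0 \<le> (\<integral>\<omega>. (\<epsilon> n 1 \<omega>)\<^sup>2 * indicator {x. \<delta> * sqrt (real n) < \<bar>x\<bar>} (\<epsilon> n 1 \<omega>) \<partial>M n)"
      by (intro integral_nonneg_AE) (auto simp: indicator_def)
    also have "\<dots> \<le> v n" using vb[OF n(1), of 1] n by simp
    finally have vn: "v n \<ge> 0" .
    have "norm ((CLINT \<omega>|M n. iexp (\<Sum>i=1..n. b n i * \<epsilon> n i \<omega>)) - complex_of_real (exp (- ((\<Sum>i=1..n. (b n i)\<^sup>2) / 2))))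
      \<le> (\<Sum>i=1..n. (b n i)\<^sup>2) * (v n + \<beta>' * \<delta> / 6 + \<beta>'\<^sup>2 / (8 * real n))"
      by (rule iexp_linear_error[OF \<beta>n \<delta> vb[OF n(1)]])
    also have "\<dots> \<le> S' * (v n + \<beta>' * \<delta> / 6 + \<beta>'\<^sup>2 / (8 * real n))"
      using S[OF n(2)] S' vn \<beta>' \<delta> by (intro mult_right_mono) auto
    also have "\<dots> = S' * (v n + \<beta>'\<^sup>2 / (8 * real n)) + r / 6"
      using S' \<beta>' by (simp add: \<delta>_def distrib_left)
    also have "\<dots> < r" using elim(1) r by linarith
    finally show ?case by simp
  qed
  then show "\<exists>no. \<forall>n\<ge>no. norm ((CLINT \<omega>|M n. iexp (\<Sum>i=1..n. b n i * \<epsilon> n i \<omega>)) -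
      complex_of_real (exp (- ((\<Sum>i=1..n. (b n i)\<^sup>2) / 2))) - 0) < r"
    unfolding eventually_sequentially .
qed

lemma measurable_residual [measurable]:
  assumes "k < n"
  shows "(\<lambda>\<omega>. residual (\<lambda>j. \<epsilon> n j \<omega>) k) \<in> borel_measurable (M n)"
proof -
  interpret error_row "M n" n "\<epsilon> n" using assms by (intro row) auto
  show ?thesis
    unfolding residual_eq_sum[OF assms] using measurable_error
    by (intro borel_measurable_sum borel_measurable_times) auto
qed

lemma
  assumes n: "n \<ge> 1" and A: "A \<subseteq> {1..<n}"
  shows integrable_residual_square: "integrable (M n) (\<lambda>\<omega>. (\<Sum>k\<in>A. c k * residual (\<lambda>j. \<epsilon> n j \<omega>) k)\<^sup>2)"
    and expectation_residual_square:
      "(\<integral>\<omega>. (\<Sum>k\<in>A. c k * residual (\<lambda>j. \<epsilon> n j \<omega>) k)\<^sup>2 \<partial>M n) = (\<Sum>k\<in>A. (c k)\<^sup>2)"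
proof -
  interpret error_row "M n" n "\<epsilon> n" by (rule row[OF n])
  show "integrable (M n) (\<lambda>\<omega>. (\<Sum>k\<in>A. c k * residual (\<lambda>j. \<epsilon> n j \<omega>) k)\<^sup>2)"
    unfolding residual_combination[OF A] by (rule integrable_linear_square)
  show "(\<integral>\<omega>. (\<Sum>k\<in>A. c k * residual (\<lambda>j. \<epsilon> n j \<omega>) k)\<^sup>2 \<partial>M n) = (\<Sum>k\<in>A. (c k)\<^sup>2)"
    unfolding residual_combination[OF A] expectation_linear_square by (rule residual_combination_square[OF A])
qed

end

text \<open>The map \<open>x\<close> to \<open>iexp x\<close> is 1-Lipschitz, and nonnegativity of
  the variance of the absolute difference bounds its mean by the root of its second moment.
  Variables close in mean square thus have close characteristic functions.\<close>

lemma (in prob_space) iexp_expectation_diff: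
  assumes [measurable]: "U \<in> borel_measurable M" "V \<in> borel_measurable M"
    and sq: "integrable M (\<lambda>\<omega>. (U \<omega> - V \<omega>)\<^sup>2)"
  shows "cmod ((CLINT \<omega>|M. iexp (U \<omega>)) - (CLINT \<omega>|M. iexp (V \<omega>))) \<le> sqrt (expectation (\<lambda>\<omega>. (U \<omega> - V \<omega>)\<^sup>2))"
proof -
  let ?D = "\<lambda>\<omega>. \<bar>U \<omega> - V \<omega>\<bar>"
  have D: "integrable M ?D"
    by (rule square_integrable_imp_integrable) (use sq in simp_all)
  have int: "integrable M (\<lambda>\<omega>. iexp (U \<omega>) - iexp (V \<omega>))"
    by (intro Bochner_Integration.integrable_diff integrable_iexp) auto
  have "cmod ((CLINT \<omega>|M. iexp (U \<omega>)) - (CLINT \<omega>|M. iexp (V \<omega>))) = cmod (CLINT \<omega>|M. iexp (U \<omega>) - iexp (V \<omega>))"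
    by (subst Bochner_Integration.integral_diff) (auto intro!: integrable_iexp)
  also have "\<dots> \<le> expectation (\<lambda>\<omega>. cmod (iexp (U \<omega>) - iexp (V \<omega>)))"
    by (rule integral_norm_bound)
  also have "\<dots> \<le> expectation ?D"
  proof (rule integral_mono)
    fix \<omega>
    have "iexp (U \<omega>) - iexp (V \<omega>) = iexp (V \<omega>) * (iexp (U \<omega> - V \<omega>) - 1)"
      by (simp add: algebra_simps exp_diff)
    also have "cmod \<dots> = cmod (iexp (U \<omega> - V \<omega>) - 1)"
      by (simp add: norm_mult)
    also have "\<dots> \<le> ?D \<omega>" using iexp_approx1[of "U \<omega> - V \<omega>" 0] by simp
    finally show "cmod (iexp (U \<omega>) - iexp (V \<omega>)) \<le> ?D \<omega>" .
  qed (use D integrable_norm[OF int] in simp_all)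
  also have "\<dots> \<le> sqrt (expectation (\<lambda>\<omega>. (U \<omega> - V \<omega>)\<^sup>2))"
  proof (rule real_le_rsqrt)
    show "(expectation ?D)\<^sup>2 \<le> expectation (\<lambda>\<omega>. (U \<omega> - V \<omega>)\<^sup>2)"
      using variance_eq[OF D] variance_positive[of ?D] sq by simp
  qed
  finally show ?thesis .
qed

lemma card_nat_less_real: "real (card {k \<in> {1..<n}. real k < y}) \<le> max 0 y"
proof (cases "y > 0")
  case True
  have "{k \<in> {1..<n}. real k < y} \<subseteq> {1..nat \<lfloor>y\<rfloor>}" by (auto simp: le_nat_floor)
  then have "card {k \<in> {1..<n}. real k < y} \<le> nat \<lfloor>y\<rfloor>"
    using card_mono[of "{1..nat \<lfloor>y\<rfloor>}"] by simp
  then have "real (card {k \<in> {1..<n}. real k < y}) \<le> real (nat \<lfloor>y\<rfloor>)" by simp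
  also have "\<dots> \<le> y" using True by simp
  finally show ?thesis by simp
next
  case False
  then have *: "{k \<in> {1..<n}. real k < y} = {}" by auto
  show ?thesis unfolding * by simp
qed

section \<open>Characteristic functions of residual sums\<close>

context error_array
begin

text \<open>The coefficient of an early error in the residual sum is as large as \<open>ln n / sqrt n\<close>; dropping the
  residuals with index below \<open>\<eta> * n\<close> costs little in mean square and leaves coefficients of order \<open>1 / sqrt n\<close>.\<close>

lemma iexp_residual_tendsto:
  assumes C: "\<And>n k. \<bar>c n k\<bar> \<le> C"
    and s: "(\<lambda>n. (\<Sum>k=1..<n. (c n k)\<^sup>2) / (real n - 1)) \<longlonglongrightarrow> s"
  shows "(\<lambda>n. CLINT \<omega>|M n. iexp (\<Sum>k=1..<n. c n k / sqrt (real n - 1) * residual (\<lambda>j. \<epsilon> n j \<omega>) k))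
    \<longlonglongrightarrow> complex_of_real (exp (- (s / 2)))"
proof (rule LIMSEQ_I)
  fix r :: real assume r: "r > 0"
  have C0: "C \<ge> 0" using order_trans[OF abs_ge_zero C] .
  \<comment> \<open>Two costs of dropping the early residuals: \<open>C * sqrt \<eta>\<close> is the
    mean square distance to the full sum, and \<open>C\<^sup>2 * \<eta>\<close> is the variance that
    is lost.\<close>
  have "((\<lambda>\<eta>. C * sqrt \<eta> + C\<^sup>2 * \<eta>) \<longlongrightarrow> C * sqrt 0 + C\<^sup>2 * 0) (at_right 0)"
    by (intro tendsto_intros)
  then have "\<forall>\<^sub>F \<eta> in at_right 0. C * sqrt \<eta> + C\<^sup>2 * \<eta> < r / 2"
    using r by (intro order_tendstoD) auto
  then obtain \<eta> where \<eta>: "\<eta> > 0" "C * sqrt \<eta> + C\<^sup>2 * \<eta> < r / 2"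
    using eventually_happens'[OF _ eventually_conj[OF _ eventually_at_right_less[of 0]]] trivial_limit_at_right_real
    by (metis (no_types, lifting))
  define A where "A n = {k \<in> {1..<n}. \<eta> * (real n - 1) \<le> real k}" for n
  define B where "B n = {k \<in> {1..<n}. real k < \<eta> * (real n - 1)}" for n
  have AB: "A n \<subseteq> {1..<n}" "B n \<subseteq> {1..<n}" "A n \<union> B n = {1..<n}" "A n \<inter> B n = {}" "finite (A n)" "finite (B n)" for n
    unfolding A_def B_def by auto
  define d where "d n k = c n k / sqrt (real n - 1)" for n k
  define b where "b n i = (\<Sum>k\<in>A n. d n k * residual_coeff k i)" for n i
  have d2: "(d n k)\<^sup>2 = (c n k)\<^sup>2 / (real n - 1)" if "n \<ge> 2" for n k
    using that by (simp add: d_def power_divide)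
  have c2: "(c n k)\<^sup>2 \<le> C\<^sup>2" for n k
    using power_mono[OF C[of n k], of 2] by simp
  have bsq: "(\<Sum>i=1..n. (b n i)\<^sup>2) = (\<Sum>k\<in>A n. (c n k)\<^sup>2) / (real n - 1)" if "n \<ge> 2" for n
    unfolding b_def residual_combination_square[OF AB(1)] d2[OF that] by (simp add: sum_divide_distrib)
  have cardA: "real (card (A n)) \<le> real n - 1" if "n \<ge> 2" for n
    using card_mono[OF _ AB(1), of n] that by simp
  have bC: "(\<Sum>i=1..n. (b n i)\<^sup>2) \<le> C\<^sup>2" if n: "n \<ge> 2" for n
  proof -
    have "(\<Sum>k\<in>A n. (c n k)\<^sup>2) \<le> real (card (A n)) * C\<^sup>2" using c2 by (rule sum_bounded_above)
    also have "\<dots> \<le> (real n - 1) * C\<^sup>2" using cardA[OF n] by (intro mult_right_mono) auto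
    finally show ?thesis unfolding bsq[OF n] using n by (simp add: divide_le_eq mult.commute)
  qed
  have b\<beta>: "\<bar>b n i\<bar> \<le> 2 * C * (1 + 1 / \<eta>) / sqrt (real n)" if n: "n \<ge> 2" for n i
  proof -
    have n1: "real n - 1 > 0" using n by simp
    have "\<bar>b n i\<bar> \<le> (\<Sum>k\<in>A n. \<bar>d n k\<bar> * \<bar>residual_coeff k i\<bar>)"
      unfolding b_def by (rule order_trans[OF sum_abs]) (simp add: abs_mult)
    also have "\<dots> \<le> (\<Sum>k\<in>A n. C / sqrt (real n - 1) * ((if i = Suc k then 1 else 0) + 1 / (\<eta> * (real n - 1))))"
    proof (rule sum_mono)
      fix k assume k: "k \<in> A n"
      have "\<bar>d n k\<bar> \<le> C / sqrt (real n - 1)"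
        using C[of n k] n1 by (simp add: d_def divide_right_mono)
      moreover have "\<bar>residual_coeff k i\<bar> \<le> (if i = Suc k then 1 else 0) + 1 / (\<eta> * (real n - 1))"
      proof -
        have "1 / real k \<le> 1 / (\<eta> * (real n - 1))"
          using k \<eta> n1 unfolding A_def by (intro divide_left_mono) auto
        then show ?thesis using residual_coeff_abs_le[of k i] by linarith
      qed
      ultimately show "\<bar>d n k\<bar> * \<bar>residual_coeff k i\<bar> \<le>
          C / sqrt (real n - 1) * ((if i = Suc k then 1 else 0) + 1 / (\<eta> * (real n - 1)))"
        using C0 n1 by (intro mult_mono) auto
    qed
    also have "\<dots> = C / sqrt (real n - 1) * ((\<Sum>k\<in>A n. if i = Suc k then 1 else 0) + real (card (A n)) / (\<eta> * (real n - 1)))"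
      unfolding sum_distrib_left[symmetric] sum.distrib by simp
    also have "\<dots> \<le> C / sqrt (real n - 1) * (1 + 1 / \<eta>)"
    proof (intro mult_left_mono add_mono)
      have "(\<Sum>k\<in>A n. if i = Suc k then 1 else (0::real)) = (\<Sum>k\<in>A n. if i - 1 = k \<and> i \<noteq> 0 then 1 else 0)"
        by (intro sum.cong refl) auto
      also have "\<dots> \<le> 1" using AB(5) by (cases "i = 0") auto
      finally show "(\<Sum>k\<in>A n. if i = Suc k then 1 else (0::real)) \<le> 1" .
      have "real (card (A n)) / (\<eta> * (real n - 1)) \<le> (real n - 1) / (\<eta> * (real n - 1))"
        using cardA[OF n] \<eta> n1 by (intro divide_right_mono) auto
      then show "real (card (A n)) / (\<eta> * (real n - 1)) \<le> 1 / \<eta>" using n1 by simp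
    qed (use C0 n1 in auto)
    also have "\<dots> \<le> 2 * C / sqrt (real n) * (1 + 1 / \<eta>)"
    proof (rule mult_right_mono)
      \<comment> \<open>For \<open>n \<ge> 2\<close> one has \<open>n \<le> 4 * (n - 1)\<close>;
        this is the source of the factor 2 in the coefficient bound.\<close>
      have "sqrt (real n) \<le> sqrt (4 * (real n - 1))" using n by (intro real_sqrt_le_mono) auto
      also have "\<dots> = 2 * sqrt (real n - 1)" by (subst real_sqrt_mult) simp
      finally have "C * sqrt (real n) \<le> C * (2 * sqrt (real n - 1))" using C0 by (rule mult_left_mono)
      then show "C / sqrt (real n - 1) \<le> 2 * C / sqrt (real n)" using n n1 by (simp add: field_simps)
    qed (use \<eta> in auto)
    finally show ?thesis by simp
  qed
  define L where "L n \<omega> = (\<Sum>k=1..<n. d n k * residual (\<lambda>j. \<epsilon> n j \<omega>) k)" for n \<omega>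
  define L' where "L' n \<omega> = (\<Sum>i=1..n. b n i * \<epsilon> n i \<omega>)" for n \<omega>
  have "(\<lambda>n. (CLINT \<omega>|M n. iexp (L' n \<omega>)) - complex_of_real (exp (- ((\<Sum>i=1..n. (b n i)\<^sup>2) / 2)))) \<longlonglongrightarrow> 0"
    unfolding L'_def using b\<beta> bC by (rule iexp_linear_tendsto[where N = 2])
  then have 1: "\<forall>\<^sub>F n in sequentially. cmod ((CLINT \<omega>|M n. iexp (L' n \<omega>)) -
      complex_of_real (exp (- ((\<Sum>i=1..n. (b n i)\<^sup>2) / 2)))) < r / 4"
    using tendstoD[of _ _ _ "r / 4"] r by fastforce
  have 2: "\<forall>\<^sub>F n in sequentially. \<bar>(\<Sum>k=1..<n. (c n k)\<^sup>2) / (real n - 1) - s\<bar> < r / 4"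
    using tendstoD[OF s, of "r / 4"] r by (simp add: dist_real_def)
  have "\<forall>\<^sub>F n in sequentially. cmod ((CLINT \<omega>|M n. iexp (L n \<omega>)) - complex_of_real (exp (- (s / 2)))) < r"
    using 1 2 eventually_ge_at_top[of 2]
  proof eventually_elim
    case (elim n)
    then have n: "n \<ge> 2" "n \<ge> 1" and n1: "real n - 1 > 0" by auto
    interpret error_row "M n" n "\<epsilon> n" by (rule row[OF n(2)])
    define \<sigma> where "\<sigma> = (\<Sum>i=1..n. (b n i)\<^sup>2)"
    have Bsum: "(\<Sum>k\<in>B n. (c n k)\<^sup>2) / (real n - 1) \<le> C\<^sup>2 * \<eta>"
    proof -
      have "(\<Sum>k\<in>B n. (c n k)\<^sup>2) \<le> real (card (B n)) * C\<^sup>2" using c2 by (rule sum_bounded_above)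
      also have "\<dots> \<le> \<eta> * (real n - 1) * C\<^sup>2"
        using card_nat_less_real[of n "\<eta> * (real n - 1)"] \<eta> n1 unfolding B_def by (intro mult_right_mono) auto
      finally show ?thesis using n1 by (simp add: divide_le_eq mult_ac)
    qed
    have split: "sum f {1..<n} = sum f (A n) + sum f (B n)" for f :: "nat \<Rightarrow> real"
      using AB[of n] sum.union_disjoint[of "A n" "B n" f] by simp
    have LL': "L n \<omega> - L' n \<omega> = (\<Sum>k\<in>B n. d n k * residual (\<lambda>j. \<epsilon> n j \<omega>) k)" for \<omega>
      unfolding L_def L'_def b_def residual_combination[OF AB(1), symmetric] split by simp
    have diff2: "integrable (M n) (\<lambda>\<omega>. (L n \<omega> - L' n \<omega>)\<^sup>2)"
      "(\<integral>\<omega>. (L n \<omega> - L' n \<omega>)\<^sup>2 \<partial>M n) \<le> C\<^sup>2 * \<eta>"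
      unfolding LL' expectation_residual_square[OF n(2) AB(2)] d2[OF n(1)]
      using integrable_residual_square[OF n(2) AB(2)] Bsum by (simp_all add: sum_divide_distrib)
    have "L n \<in> borel_measurable (M n)"
      unfolding L_def[abs_def] by (intro borel_measurable_sum borel_measurable_times measurable_residual) auto
    moreover have "L' n \<in> borel_measurable (M n)"
      unfolding L'_def[abs_def] by (intro borel_measurable_sum borel_measurable_times measurable_error) auto
    ultimately have "cmod ((CLINT \<omega>|M n. iexp (L n \<omega>)) - (CLINT \<omega>|M n. iexp (L' n \<omega>))) \<le>
        sqrt (expectation (\<lambda>\<omega>. (L n \<omega> - L' n \<omega>)\<^sup>2))"
      by (rule iexp_expectation_diff[OF _ _ diff2(1)])
    also have "\<dots> \<le> sqrt (C\<^sup>2 * \<eta>)" using diff2(2) by (rule real_sqrt_le_mono)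
    also have "\<dots> = C * sqrt \<eta>" using C0 by (simp add: real_sqrt_mult)
    finally have a: "cmod ((CLINT \<omega>|M n. iexp (L n \<omega>)) - (CLINT \<omega>|M n. iexp (L' n \<omega>))) \<le> C * sqrt \<eta>" .
    have \<sigma>_ge: "\<sigma> \<ge> 0" unfolding \<sigma>_def by (intro sum_nonneg) auto
    have "(\<Sum>k=1..<n. (c n k)\<^sup>2) / (real n - 1) = \<sigma> + (\<Sum>k\<in>B n. (c n k)\<^sup>2) / (real n - 1)"
      unfolding \<sigma>_def bsq[OF n(1)] split by (simp add: add_divide_distrib)
    moreover have "0 \<le> (\<Sum>k\<in>B n. (c n k)\<^sup>2) / (real n - 1)" using n1 by (intro divide_nonneg_nonneg sum_nonneg) auto
    ultimately have \<sigma>s: "\<bar>\<sigma> - s\<bar> \<le> C\<^sup>2 * \<eta> + r / 4" using elim(2) Bsum by linarith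
    have s0: "s \<ge> 0"
      by (rule LIMSEQ_le_const[OF s]) (auto intro!: exI[of _ 1] divide_nonneg_nonneg sum_nonneg)
    \<comment> \<open>The function \<open>exp (- x)\<close> is 1-Lipschitz on the nonnegative half
      line, so an error in the variance carries over to the Gaussian factor.\<close>
    have expl: "exp (- x) - exp (- y) \<le> y - x" if "0 \<le> x" "x \<le> y" for x y :: real
    proof -
      have h: "1 - exp (- (y - x)) \<le> y - x"
        using exp_ge_add_one_self[of "- (y - x)"] by linarith
      have "exp (- x) - exp (- y) = exp (- x) * (1 - exp (- (y - x)))"
        by (simp add: algebra_simps flip: exp_add)
      also have "\<dots> \<le> 1 * (y - x)"
        using that h by (intro mult_mono) auto
      finally show ?thesis by simp
    qed
    have "\<bar>exp (- (\<sigma> / 2)) - exp (- (s / 2))\<bar> \<le> \<bar>\<sigma> - s\<bar>"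
      using expl[of "\<sigma> / 2" "s / 2"] expl[of "s / 2" "\<sigma> / 2"] s0 \<sigma>_ge
      by (cases "\<sigma> \<le> s") (auto simp: abs_if)
    then have c: "cmod (complex_of_real (exp (- (\<sigma> / 2))) - complex_of_real (exp (- (s / 2)))) \<le> C\<^sup>2 * \<eta> + r / 4"
      using \<sigma>s unfolding of_real_diff[symmetric] norm_of_real by linarith
    \<comment> \<open>The three distances are the dropped residuals, the Gaussian approximation
      (\<open>r / 4\<close>) and the variance (\<open>C\<^sup>2 * \<eta> + r / 4\<close>). By the
      choice of \<eta> they add up to less than \<open>r\<close>.\<close>
    have "cmod ((CLINT \<omega>|M n. iexp (L n \<omega>)) - complex_of_real (exp (- (s / 2)))) \<le>
        cmod ((CLINT \<omega>|M n. iexp (L n \<omega>)) - (CLINT \<omega>|M n. iexp (L' n \<omega>))) +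
        cmod ((CLINT \<omega>|M n. iexp (L' n \<omega>)) - complex_of_real (exp (- (\<sigma> / 2)))) +
        cmod (complex_of_real (exp (- (\<sigma> / 2))) - complex_of_real (exp (- (s / 2))))"
      using norm_triangle_ineq[of "(CLINT \<omega>|M n. iexp (L n \<omega>)) - (CLINT \<omega>|M n. iexp (L' n \<omega>))"
          "(CLINT \<omega>|M n. iexp (L' n \<omega>)) - complex_of_real (exp (- (\<sigma> / 2)))"]
        norm_triangle_ineq[of "(CLINT \<omega>|M n. iexp (L n \<omega>)) - complex_of_real (exp (- (\<sigma> / 2)))"
          "complex_of_real (exp (- (\<sigma> / 2))) - complex_of_real (exp (- (s / 2)))"]
      by simp
    then show ?case using a c elim(1) \<eta>(2) unfolding \<sigma>_def by linarith
  qed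
  then show "\<exists>n0. \<forall>n\<ge>n0. norm ((CLINT \<omega>|M n. iexp (\<Sum>k=1..<n. c n k / sqrt (real n - 1) * residual (\<lambda>j. \<epsilon> n j \<omega>) k)) -
      complex_of_real (exp (- (s / 2)))) < r"
    unfolding eventually_sequentially L_def d_def .
qed

end

subsection \<open>Brownian increments\<close>

lemma char_normal_distribution:
  assumes "prob_space N" and D: "distributed N lborel X (normal_density 0 \<sigma>)" and \<sigma>: "\<sigma> > 0"
  shows "char (distr N borel X) t = complex_of_real (exp (- (\<sigma>\<^sup>2 * t\<^sup>2 / 2)))"
proof -
  interpret N: prob_space N by fact
  have X [measurable]: "X \<in> borel_measurable N" using distributed_measurable[OF D] by simp
  have "distributed N lborel (\<lambda>x. (X x - 0) / \<sigma>) std_normal_density"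
    using D N.normal_standard_normal_convert[OF \<sigma>, of X 0] by simp
  then have "distr N lborel (\<lambda>x. X x / \<sigma>) = std_normal_distribution"
    using distributed_distr_eq_density by fastforce
  then have "distr N borel (\<lambda>x. X x / \<sigma>) = std_normal_distribution"
    by (metis distr_cong sets_lborel)
  then have "char (distr N borel (\<lambda>x. X x / \<sigma>)) (\<sigma> * t) = complex_of_real (exp (- ((\<sigma> * t)\<^sup>2) / 2))"
    using fun_cong[OF char_std_normal_distribution, of "\<sigma> * t"] by simp
  moreover have "char (distr N borel (\<lambda>x. X x / \<sigma>)) (\<sigma> * t) = char (distr N borel X) t"
    unfolding char_def using \<sigma> by (simp add: integral_distr)
  ultimately show ?thesis by (simp add: power_mult_distrib)
qed

text \<open>The case \<open>k = 1\<close> supplies the variance of an increment, and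
  \<open>k = 2\<close> the fourth moment that makes the block bounds summable.\<close>

lemma normal_moments:
  assumes "prob_space N" and D: "distributed N lborel X (normal_density 0 \<sigma>)" and \<sigma>: "\<sigma> > 0"
  shows "integrable N (\<lambda>\<omega>. X \<omega> ^ (2 * k))"
    and "(\<integral>\<omega>. X \<omega> ^ (2 * k) \<partial>N) = fact (2 * k) / ((2 / \<sigma>\<^sup>2) ^ k * fact k)"
proof -
  interpret prob_space N by fact
  have H: "has_bochner_integral lborel (\<lambda>x. normal_density 0 \<sigma> x * x ^ (2 * k)) (fact (2 * k) / ((2 / \<sigma>\<^sup>2) ^ k * fact k))"
    using normal_moment_even[OF \<sigma>, of 0 k] by simp
  show "integrable N (\<lambda>\<omega>. X \<omega> ^ (2 * k))"
    using distributed_integrable[OF D, of "\<lambda>x. x ^ (2 * k)"] H by (auto simp: has_bochner_integral_iff)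
  show "(\<integral>\<omega>. X \<omega> ^ (2 * k) \<partial>N) = fact (2 * k) / ((2 / \<sigma>\<^sup>2) ^ k * fact k)"
    using distributed_integral[OF D, of "\<lambda>x. x ^ (2 * k)"] H by (auto simp: has_bochner_integral_iff)
qed

locale brownian =
  fixes N :: "'b measure" and B :: "real \<Rightarrow> 'b \<Rightarrow> real"
  assumes bm: "standard_brownian_motion N B"
begin

sublocale N: prob_space N
  using bm by (simp add: standard_brownian_motion_def)

lemma measurable_bm: "0 \<le> s \<Longrightarrow> s \<le> 1 \<Longrightarrow> B s \<in> borel_measurable N"
  using bm by (simp add: standard_brownian_motion_def)

lemma continuous_bm: "\<omega> \<in> space N \<Longrightarrow> continuous_on {0..1} (\<lambda>s. B s \<omega>)"
  using bm by (simp add: standard_brownian_motion_def)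

lemma bm_0: "AE \<omega> in N. B 0 \<omega> = 0"
  using bm by (simp add: standard_brownian_motion_def)

lemma bm_distributed:
  "0 \<le> s \<Longrightarrow> s < u \<Longrightarrow> u \<le> 1 \<Longrightarrow>
    distributed N lborel (\<lambda>\<omega>. B u \<omega> - B s \<omega>) (normal_density 0 (sqrt (u - s)))"
  using bm unfolding standard_brownian_motion_def by blast

abbreviation incr :: "nat \<Rightarrow> nat \<Rightarrow> 'b \<Rightarrow> real" where
  "incr m j \<equiv> \<lambda>\<omega>. increments m (\<lambda>s. B s \<omega>) j"

lemma measurable_incr: "j < m \<Longrightarrow> incr m j \<in> borel_measurable N"
  unfolding increments_def by (intro borel_measurable_diff measurable_bm) auto

lemma distributed_incr:
  assumes "j < m"
  shows "distributed N lborel (incr m j) (normal_density 0 (sqrt (1 / real m)))"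
proof -
  have "real j / real m < real (Suc j) / real m" using assms by (intro divide_strict_right_mono) auto
  moreover have "real (Suc j) / real m \<le> 1" using assms by simp
  ultimately have "distributed N lborel (\<lambda>\<omega>. B (real (Suc j) / real m) \<omega> - B (real j / real m) \<omega>)
      (normal_density 0 (sqrt (real (Suc j) / real m - real j / real m)))"
    using bm_distributed by simp
  moreover have "real (Suc j) / real m - real j / real m = 1 / real m"
    by (simp add: diff_divide_distrib[symmetric])
  ultimately show ?thesis unfolding increments_def by simp
qed

lemma
  assumes "j < m"
  shows integrable_incr_square: "integrable N (\<lambda>\<omega>. (incr m j \<omega>)\<^sup>2)"
    and expectation_incr_square: "N.expectation (\<lambda>\<omega>. (incr m j \<omega>)\<^sup>2) = 1 / real m"
    and integrable_incr_4: "integrable N (\<lambda>\<omega>. incr m j \<omega> ^ 4)"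
    and expectation_incr_4: "N.expectation (\<lambda>\<omega>. incr m j \<omega> ^ 4) = 3 / (real m)\<^sup>2"
proof -
  have m: "sqrt (1 / real m) > 0" using assms by simp
  note mom = normal_moments[OF N.prob_space_axioms distributed_incr[OF assms] m]
  show "integrable N (\<lambda>\<omega>. (incr m j \<omega>)\<^sup>2)" using mom(1)[of 1] by simp
  show "N.expectation (\<lambda>\<omega>. (incr m j \<omega>)\<^sup>2) = 1 / real m" using mom(2)[of 1] by (simp add: fact_numeral)
  show "integrable N (\<lambda>\<omega>. incr m j \<omega> ^ 4)" using mom(1)[of 2] by simp
  show "N.expectation (\<lambda>\<omega>. incr m j \<omega> ^ 4) = 3 / (real m)\<^sup>2"
    using mom(2)[of 2] by (simp add: fact_numeral power2_eq_square)
qed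

lemma iexp_incr:
  "(CLINT \<omega>|N. iexp (\<Sum>j<m. \<theta> j * incr m j \<omega>)) = complex_of_real (exp (- ((\<Sum>j<m. (\<theta> j)\<^sup>2) / real m / 2)))"
proof -
  have "N.indep_vars (\<lambda>_. borel) (\<lambda>j \<omega>. B (real (Suc j) / real m) \<omega> - B (real j / real m) \<omega>) {..<m}"
  proof -
    have "mono_on {..m} (\<lambda>i. real i / real m)" by (auto simp: mono_on_def divide_right_mono)
    moreover have "(\<lambda>i. real i / real m) ` {..m} \<subseteq> {0..1}" by (auto simp: divide_le_eq_1)
    ultimately show ?thesis
      using bm unfolding standard_brownian_motion_def by blast
  qed
  then have ind: "N.indep_vars (\<lambda>_. borel) (\<lambda>j \<omega>. \<theta> j * incr m j \<omega>) {..<m}"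
    unfolding increments_def by (rule N.indep_vars_compose2) simp
  have meas [measurable]: "(\<lambda>\<omega>. \<Sum>j<m. \<theta> j * incr m j \<omega>) \<in> borel_measurable N"
    by (intro borel_measurable_sum borel_measurable_times measurable_incr) auto
  have "(CLINT \<omega>|N. iexp (\<Sum>j<m. \<theta> j * incr m j \<omega>)) = char (distr N borel (\<lambda>\<omega>. \<Sum>j<m. \<theta> j * incr m j \<omega>)) 1"
    unfolding char_def by (subst integral_distr[OF meas]) simp_all
  also have "\<dots> = (\<Prod>j<m. char (distr N borel (\<lambda>\<omega>. \<theta> j * incr m j \<omega>)) 1)"
    by (rule N.char_distr_sum[OF ind])
  also have "\<dots> = (\<Prod>j<m. complex_of_real (exp (- ((\<theta> j)\<^sup>2 / real m / 2))))"
  proof (rule prod.cong[OF refl])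
    fix j assume "j \<in> {..<m}"
    then have j: "j < m" by simp
    have [measurable]: "incr m j \<in> borel_measurable N" by (rule measurable_incr[OF j])
    have "char (distr N borel (\<lambda>\<omega>. \<theta> j * incr m j \<omega>)) 1 = char (distr N borel (incr m j)) (\<theta> j)"
      unfolding char_def by (simp add: integral_distr)
    also have "\<dots> = complex_of_real (exp (- ((\<theta> j)\<^sup>2 / real m / 2)))"
      using char_normal_distribution[OF N.prob_space_axioms distributed_incr[OF j], of "\<theta> j"] j
      by (simp add: real_sqrt_divide power_divide)
    finally show "char (distr N borel (\<lambda>\<omega>. \<theta> j * incr m j \<omega>)) 1 = complex_of_real (exp (- ((\<theta> j)\<^sup>2 / real m / 2)))" .
  qed
  also have "\<dots> = complex_of_real (exp (- ((\<Sum>j<m. (\<theta> j)\<^sup>2) / real m / 2)))"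
    by (simp add: sum_divide_distrib flip: sum_negf exp_sum of_real_prod)
  finally show ?thesis .
qed

end

lemma iexp_tendsto_imp_cos_sin:
  assumes M: "\<And>n. n \<ge> 1 \<Longrightarrow> prob_space (M n)" and N: "prob_space N"
    and U: "\<And>n. n \<ge> 1 \<Longrightarrow> U n \<in> borel_measurable (M n)" and V: "V \<in> borel_measurable N"
    and lim: "(\<lambda>n. CLINT \<omega>|M n. iexp (U n \<omega>)) \<longlonglongrightarrow> (CLINT \<omega>|N. iexp (V \<omega>))"
  shows "(\<lambda>n. \<integral>\<omega>. cos (U n \<omega>) \<partial>M n) \<longlonglongrightarrow> (\<integral>\<omega>. cos (V \<omega>) \<partial>N)"
    and "(\<lambda>n. \<integral>\<omega>. sin (U n \<omega>) \<partial>M n) \<longlonglongrightarrow> (\<integral>\<omega>. sin (V \<omega>) \<partial>N)"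
proof -
  have eq: "(\<integral>\<omega>. cos (f \<omega>) \<partial>P) = Re (CLINT \<omega>|P. iexp (f \<omega>))" "(\<integral>\<omega>. sin (f \<omega>) \<partial>P) = Im (CLINT \<omega>|P. iexp (f \<omega>))"
    if "prob_space P" "f \<in> borel_measurable P" for f and P :: "'c measure"
  proof -
    interpret prob_space P by fact
    have "integrable P (\<lambda>\<omega>. iexp (f \<omega>))" using that(2) by (intro integrable_iexp) auto
    from integral_Re[OF this] integral_Im[OF this]
    show "(\<integral>\<omega>. cos (f \<omega>) \<partial>P) = Re (CLINT \<omega>|P. iexp (f \<omega>))" "(\<integral>\<omega>. sin (f \<omega>) \<partial>P) = Im (CLINT \<omega>|P. iexp (f \<omega>))"
      by (simp_all add: Re_exp Im_exp)
  qed
  show "(\<lambda>n. \<integral>\<omega>. cos (U n \<omega>) \<partial>M n) \<longlonglongrightarrow> (\<integral>\<omega>. cos (V \<omega>) \<partial>N)"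
  proof (rule Lim_transform_eventually)
    show "(\<lambda>n. Re (CLINT \<omega>|M n. iexp (U n \<omega>))) \<longlonglongrightarrow> (\<integral>\<omega>. cos (V \<omega>) \<partial>N)"
      unfolding eq(1)[OF N V] by (intro tendsto_Re lim)
    show "\<forall>\<^sub>F n in sequentially. Re (CLINT \<omega>|M n. iexp (U n \<omega>)) = (\<integral>\<omega>. cos (U n \<omega>) \<partial>M n)"
      using eventually_ge_at_top[of 1] by eventually_elim (simp only: eq(1)[OF M U])
  qed
  show "(\<lambda>n. \<integral>\<omega>. sin (U n \<omega>) \<partial>M n) \<longlonglongrightarrow> (\<integral>\<omega>. sin (V \<omega>) \<partial>N)"
  proof (rule Lim_transform_eventually)
    show "(\<lambda>n. Im (CLINT \<omega>|M n. iexp (U n \<omega>))) \<longlonglongrightarrow> (\<integral>\<omega>. sin (V \<omega>) \<partial>N)"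
      unfolding eq(2)[OF N V] by (intro tendsto_Im lim)
    show "\<forall>\<^sub>F n in sequentially. Im (CLINT \<omega>|M n. iexp (U n \<omega>)) = (\<integral>\<omega>. sin (U n \<omega>) \<partial>M n)"
      using eventually_ge_at_top[of 1] by eventually_elim (simp only: eq(2)[OF M U])
  qed
qed

locale error_array_bm = error_array M \<epsilon> + brownian N B
  for M :: "nat \<Rightarrow> 'a measure" and \<epsilon> and N :: "'b measure" and B
begin

text \<open>The stochastic part of the process: the normalised partial sums of the residuals
  computed from the errors alone.\<close>

definition W :: "nat \<Rightarrow> 'a \<Rightarrow> real \<Rightarrow> real" where
  "W n \<omega> = interp (n - 1) (\<lambda>i. residual (\<lambda>j. \<epsilon> n j \<omega>) (Suc i) / sqrt (real n - 1))"

text \<open>The share of the \<open>k\<close>-th residual in the increment over the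
  \<open>j\<close>-th of \<open>m\<close> blocks. The shift to \<open>k - 1\<close> is needed
  because residuals are counted from 1 and the entries of \<open>interp\<close> from 0.\<close>

definition wt :: "nat \<Rightarrow> nat \<Rightarrow> nat \<Rightarrow> nat \<Rightarrow> real" where
  "wt m n j k = weight (n - 1) (real j / real m) (real (Suc j) / real m) (k - 1)"

lemma wt: "0 \<le> wt m n j k" "wt m n j k \<le> 1"
  unfolding wt_def by (intro weight_bounds; simp add: divide_right_mono)+

lemma sum_shift_residuals: "(\<Sum>k=1..<n. f k) = (\<Sum>i<n - 1. f (Suc i))"
proof (cases n)
  case (Suc k)
  show ?thesis
    unfolding Suc One_nat_def sum.atLeast_Suc_lessThan_Suc_shift by (simp add: lessThan_atLeast0)
qed simp

lemma increments_W:
  "increments m (W n \<omega>) j = (\<Sum>k=1..<n. wt m n j k / sqrt (real n - 1) * residual (\<lambda>j. \<epsilon> n j \<omega>) k)"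
  unfolding increments_def W_def interp_weight sum_shift_residuals
  by (intro sum.cong refl) (simp add: wt_def)

text \<open>The cells divided by grid points cause an error bounded independently of
  \<open>n\<close>, which disappears after division by \<open>n - 1\<close>.\<close>

lemma wt_square_tendsto:
  assumes m: "m > 0"
  shows "(\<lambda>n. (\<Sum>k=1..<n. (\<Sum>j<m. \<theta> j * wt m n j k)\<^sup>2) / (real n - 1)) \<longlonglongrightarrow> (\<Sum>j<m. (\<theta> j)\<^sup>2) / real m"
proof (rule LIM_zero_cancel, rule Lim_null_comparison)
  let ?C = "\<Sum>j<m. \<bar>\<theta> j\<bar>"
  let ?s = "(\<Sum>j<m. (\<theta> j)\<^sup>2) / real m"
  have "(\<lambda>n. c / (real n - 1)) \<longlonglongrightarrow> 0" for c :: real by real_asymp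
  then show "(\<lambda>n. real (Suc m) * ?C\<^sup>2 / (real n - 1)) \<longlonglongrightarrow> 0" .
  show "\<forall>\<^sub>F n in sequentially. norm ((\<Sum>k=1..<n. (\<Sum>j<m. \<theta> j * wt m n j k)\<^sup>2) / (real n - 1) - ?s) \<le>
      real (Suc m) * ?C\<^sup>2 / (real n - 1)"
    using eventually_ge_at_top[of 2]
  proof eventually_elim
    case (elim n)
    then have n: "real n - 1 > 0" "real (n - 1) = real n - 1" by (auto simp: of_nat_diff)
    have "\<bar>(\<Sum>k=1..<n. (\<Sum>j<m. \<theta> j * wt m n j k)\<^sup>2) - (real n - 1) * ?s\<bar> \<le> real (Suc m) * ?C\<^sup>2"
      using weight_square_sum[OF m refl, of \<theta> "n - 1"] unfolding sum_shift_residuals wt_def n(2) by simp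
    moreover have "(\<Sum>k=1..<n. (\<Sum>j<m. \<theta> j * wt m n j k)\<^sup>2) / (real n - 1) - ?s =
        ((\<Sum>k=1..<n. (\<Sum>j<m. \<theta> j * wt m n j k)\<^sup>2) - (real n - 1) * ?s) / (real n - 1)"
      using n by (simp add: diff_divide_distrib)
    ultimately show ?case using n by (simp add: abs_divide divide_right_mono)
  qed
qed

lemma measurable_residual_sum:
  assumes "A \<subseteq> {1..<n}"
  shows "(\<lambda>\<omega>. \<Sum>k\<in>A. c k * residual (\<lambda>j. \<epsilon> n j \<omega>) k) \<in> borel_measurable (M n)"
  using assms by (intro borel_measurable_sum borel_measurable_times measurable_residual) auto

text \<open>A linear combination of increments is again a combination of residuals, with
  coefficients bounded by the sum of the absolute values of \<theta>. Its limiting variance is that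
  of the same combination of Brownian increments. The zeros beyond \<open>m\<close> put both vectors
  into the form required by the continuity theorem.\<close>

lemma finite_dimensional_convergence_W:
  fixes \<psi> :: "(nat \<Rightarrow> real) \<Rightarrow> real"
  assumes m: "m > 0" and \<psi>: "continuous_on UNIV \<psi>" "\<And>x. \<bar>\<psi> x\<bar> \<le> K"
  shows "(\<lambda>n. \<integral>\<omega>. \<psi> (\<lambda>j. if j < m then increments m (W n \<omega>) j else 0) \<partial>M n)
    \<longlonglongrightarrow> N.expectation (\<lambda>\<omega>. \<psi> (\<lambda>j. if j < m then incr m j \<omega> else 0))"
proof (rule finite_dimensional_convergence[where m = m and C = 1, OF prob_space_row N.prob_space_axioms _ _ _ _ _ _ _ _ _ _ \<psi>])
  let ?X = "\<lambda>n \<omega> j. if j < m then increments m (W n \<omega>) j else 0"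
  let ?Z = "\<lambda>\<omega> j. if j < m then incr m j \<omega> else 0"
  show mX: "(\<lambda>\<omega>. ?X n \<omega> j) \<in> borel_measurable (M n)" for n j
    unfolding increments_W by (cases "j < m") (auto intro!: measurable_residual_sum)
  show mZ: "(\<lambda>\<omega>. ?Z \<omega> j) \<in> borel_measurable N" for j
    using measurable_incr by (cases "j < m") auto
  show "integrable (M n) (\<lambda>\<omega>. (?X n \<omega> j)\<^sup>2)" if "n \<ge> 1" "j < m" for n j
    unfolding increments_W using integrable_residual_square[OF that(1) subset_refl] by (simp only: that(2) if_True)
  show "(\<integral>\<omega>. (?X n \<omega> j)\<^sup>2 \<partial>M n) \<le> 1" if n: "n \<ge> 1" and j: "j < m" for n j
  proof -
    have "(\<integral>\<omega>. (?X n \<omega> j)\<^sup>2 \<partial>M n) = (\<Sum>k=1..<n. (wt m n j k / sqrt (real n - 1))\<^sup>2)"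
      unfolding increments_W using expectation_residual_square[OF n subset_refl] by (simp only: j if_True)
    also have "\<dots> \<le> (\<Sum>k=1..<n. 1 / (real n - 1))"
    proof (rule sum_mono)
      fix k assume "k \<in> {1..<n}"
      then have "real n - 1 > 0" by auto
      moreover have "(wt m n j k)\<^sup>2 \<le> 1" using wt[of m n j k] by (simp add: power_le_one)
      ultimately show "(wt m n j k / sqrt (real n - 1))\<^sup>2 \<le> 1 / (real n - 1)"
        by (simp add: power_divide divide_right_mono)
    qed
    \<comment> \<open>For \<open>n = 1\<close> the sum is empty, in agreement with the convention
      that division by 0 gives 0.\<close>
    also have "\<dots> \<le> 1" using n by (simp add: of_nat_diff divide_le_eq_1)
    finally show ?thesis .
  qed
  show "integrable N (\<lambda>\<omega>. (?Z \<omega> j)\<^sup>2)" if "j < m" for j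
    using integrable_incr_square[OF that] that by simp
  show "N.expectation (\<lambda>\<omega>. (?Z \<omega> j)\<^sup>2) \<le> 1" if "j < m" for j
    using expectation_incr_square[OF that] that by simp
  fix \<theta> :: "nat \<Rightarrow> real"
  have eqX: "(\<Sum>j<m. \<theta> j * ?X n \<omega> j) =
      (\<Sum>k=1..<n. (\<Sum>j<m. \<theta> j * wt m n j k) / sqrt (real n - 1) * residual (\<lambda>j. \<epsilon> n j \<omega>) k)" for n \<omega>
  proof -
    have "(\<Sum>j<m. \<theta> j * ?X n \<omega> j) =
        (\<Sum>j<m. \<Sum>k=1..<n. \<theta> j * wt m n j k / sqrt (real n - 1) * residual (\<lambda>j. \<epsilon> n j \<omega>) k)"
      by (intro sum.cong refl) (simp add: increments_W sum_distrib_left mult.assoc)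
    also have "\<dots> = (\<Sum>k=1..<n. \<Sum>j<m. \<theta> j * wt m n j k / sqrt (real n - 1) * residual (\<lambda>j. \<epsilon> n j \<omega>) k)"
      by (rule sum.swap)
    finally show ?thesis by (simp add: sum_distrib_right sum_divide_distrib)
  qed
  have eqZ: "(\<Sum>j<m. \<theta> j * ?Z \<omega> j) = (\<Sum>j<m. \<theta> j * incr m j \<omega>)" for \<omega>
    by (intro sum.cong) auto
  have "\<bar>\<Sum>j<m. \<theta> j * wt m n j k\<bar> \<le> (\<Sum>j<m. \<bar>\<theta> j\<bar>)" for n k
    using wt[of m n _ k] by (intro order_trans[OF sum_abs] sum_mono) (auto simp: abs_mult intro!: mult_left_le)
  from iexp_residual_tendsto[OF this wt_square_tendsto[OF m]]
  have lim: "(\<lambda>n. CLINT \<omega>|M n. iexp (\<Sum>j<m. \<theta> j * ?X n \<omega> j)) \<longlonglongrightarrow> (CLINT \<omega>|N. iexp (\<Sum>j<m. \<theta> j * ?Z \<omega> j))"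
    unfolding eqX eqZ iexp_incr by simp
  have "(\<lambda>\<omega>. \<Sum>j<m. \<theta> j * ?X n \<omega> j) \<in> borel_measurable (M n)" if "n \<ge> 1" for n
    by (intro borel_measurable_sum borel_measurable_times mX) auto
  moreover have "(\<lambda>\<omega>. \<Sum>j<m. \<theta> j * ?Z \<omega> j) \<in> borel_measurable N"
    by (intro borel_measurable_sum borel_measurable_times mZ) auto
  ultimately show
    "(\<lambda>n. \<integral>\<omega>. cos (\<Sum>j<m. \<theta> j * ?X n \<omega> j) \<partial>M n) \<longlonglongrightarrow> N.expectation (\<lambda>\<omega>. cos (\<Sum>j<m. \<theta> j * ?Z \<omega> j))"
    "(\<lambda>n. \<integral>\<omega>. sin (\<Sum>j<m. \<theta> j * ?X n \<omega> j) \<partial>M n) \<longlonglongrightarrow> N.expectation (\<lambda>\<omega>. sin (\<Sum>j<m. \<theta> j * ?Z \<omega> j))"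
    using iexp_tendsto_imp_cos_sin[OF prob_space_row N.prob_space_axioms _ _ lim] by blast+
qed auto

end

subsection \<open>Modulus of continuity of the residual partial sums\<close>

lemma sum_inverse_sqrt_le: "(\<Sum>i<k. 1 / sqrt (real (Suc i))) \<le> 2 * sqrt (real k)"
proof (induction k)
  case (Suc k)
  define a b where "a = sqrt (real (Suc k))" and "b = sqrt (real k)"
  have a: "a > 0" "a\<^sup>2 = b\<^sup>2 + 1" by (auto simp: a_def b_def)
  \<comment> \<open>Since \<open>a\<^sup>2 = b\<^sup>2 + 1\<close>, expanding this square gives
    \<open>1 \<le> 2 * a * (a - b)\<close>, that is, \<open>1 / a\<close> is at most the increment
    of the telescoping bound \<open>2 * sqrt k\<close>.\<close>
  have "0 \<le> (a - b)\<^sup>2" by simp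
  then have "1 \<le> (2 * (a - b)) * a" using a(2) by (simp add: power2_eq_square algebra_simps)
  then have "1 / a \<le> 2 * (a - b)" using a(1) by (simp add: divide_le_eq)
  then show ?case using Suc by (simp add: a_def b_def)
qed simp

text \<open>The weights \<open>sqrt (i + 1)\<close> make both Cauchy-Schwarz factors summable although the
  second moments of the summands decay only like \<open>1 / i\<close>.\<close>

lemma weighted_sum_square_le:
  assumes m: "m > 0" and su: "0 \<le> s" "s \<le> u" "u \<le> 1" "u - s \<le> 1 / real m"
  shows "(\<Sum>i<n. a i * weight n s u i)\<^sup>2 \<le> 3 * sqrt (real n / real m) * (\<Sum>i<n. sqrt (real (Suc i)) * (a i)\<^sup>2)"
proof (cases "n = 0")
  case False
  define w where "w i = weight n s u i" for i
  have w: "0 \<le> w i" "w i \<le> 1" for i unfolding w_def using su by (auto intro: weight_bounds)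
  define l where "l = real n / real m"
  have l: "l > 0" using False m by (simp add: l_def)
  have wsum: "(\<Sum>i<n. w i) \<le> l"
  proof -
    have "(\<Sum>i<n. w i) = real n * (u - s)" unfolding w_def using su by (intro sum_weight) auto
    also have "\<dots> \<le> real n * (1 / real m)" using su by (intro mult_left_mono) auto
    finally show ?thesis by (simp add: l_def)
  qed
  define q where "q i = sqrt (real (Suc i))" for i
  have q: "q i > 0" for i by (simp add: q_def)
  have 1: "(\<Sum>i<n. w i / q i) \<le> 3 * sqrt l"
  proof -
    \<comment> \<open>Split at the number \<open>l\<close> of cells per block. Early indices use
      \<open>w i \<le> 1\<close> and contribute at most \<open>2 * sqrt l\<close>; for later ones
      \<open>q i \<ge> sqrt l\<close>, and the total weight \<open>l\<close> yields one more
      \<open>sqrt l\<close>. This is where the constant 3 comes from.\<close>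
    have "(\<Sum>i<n. w i / q i) \<le> (\<Sum>i<n. (if real (Suc i) \<le> l then 1 / q i else 0) + w i / sqrt l)"
    proof (rule sum_mono)
      fix i
      show "w i / q i \<le> (if real (Suc i) \<le> l then 1 / q i else 0) + w i / sqrt l"
      proof (cases "real (Suc i) \<le> l")
        case True
        have "w i / q i \<le> 1 / q i" using w[of i] q[of i] by (intro divide_right_mono) auto
        moreover have "0 \<le> w i / sqrt l" using w[of i] l by simp
        ultimately show ?thesis using True by simp
      next
        case False
        then have "sqrt l \<le> q i" unfolding q_def by (intro real_sqrt_le_mono) auto
        then have "w i / q i \<le> w i / sqrt l" using w[of i] l q[of i] by (intro divide_left_mono) auto
        then show ?thesis using False by simp
      qed
    qed
    also have "\<dots> = (\<Sum>i<n. if real (Suc i) \<le> l then 1 / q i else 0) + (\<Sum>i<n. w i) / sqrt l"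
      by (simp add: sum.distrib sum_divide_distrib)
    also have "(\<Sum>i<n. if real (Suc i) \<le> l then 1 / q i else 0) \<le> (\<Sum>i<nat \<lfloor>l\<rfloor>. 1 / q i)"
    proof -
      have "(\<Sum>i<n. if real (Suc i) \<le> l then 1 / q i else 0) = (\<Sum>i\<in>{i \<in> {..<n}. real (Suc i) \<le> l}. 1 / q i)"
        by (rule sum.inter_filter[symmetric]) simp
      also have "\<dots> \<le> (\<Sum>i<nat \<lfloor>l\<rfloor>. 1 / q i)"
        using q by (intro sum_mono2) (auto simp: less_imp_le Suc_le_eq[symmetric] le_nat_floor simp del: of_nat_Suc)
      finally show ?thesis .
    qed
    also have "(\<Sum>i<nat \<lfloor>l\<rfloor>. 1 / q i) \<le> 2 * sqrt (real (nat \<lfloor>l\<rfloor>))"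
      unfolding q_def by (rule sum_inverse_sqrt_le)
    also have "\<dots> \<le> 2 * sqrt l" using l by simp
    also have "(\<Sum>i<n. w i) / sqrt l \<le> l / sqrt l" using wsum l by (intro divide_right_mono) auto
    also have "l / sqrt l = sqrt l" using l by (simp add: real_div_sqrt)
    finally show ?thesis by simp
  qed
  \<comment> \<open>The weight \<open>w i\<close> is written as
    \<open>sqrt (w i / q i) * sqrt (w i * q i)\<close> before the Cauchy-Schwarz inequality is
    applied.\<close>
  have "(\<Sum>i<n. a i * w i)\<^sup>2 = (\<Sum>i<n. sqrt (w i / q i) * (a i * sqrt (w i * q i)))\<^sup>2"
  proof -
    have "sqrt (w i / q i) * sqrt (w i * q i) = w i" for i
      using w[of i] q[of i] by (simp add: real_sqrt_mult[symmetric])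
    then have "sqrt (w i / q i) * (a i * sqrt (w i * q i)) = a i * w i" for i
      by (metis mult.left_commute)
    then show ?thesis by (simp only:)
  qed
  also have "\<dots> \<le> (\<Sum>i<n. (sqrt (w i / q i))\<^sup>2) * (\<Sum>i<n. (a i * sqrt (w i * q i))\<^sup>2)"
    by (rule Cauchy_Schwarz_ineq_sum)
  also have "\<dots> \<le> (3 * sqrt l) * (\<Sum>i<n. q i * (a i)\<^sup>2)"
  proof (rule mult_mono)
    show "(\<Sum>i<n. (sqrt (w i / q i))\<^sup>2) \<le> 3 * sqrt l"
      using 1 w q by (simp add: less_imp_le)
    show "(\<Sum>i<n. (a i * sqrt (w i * q i))\<^sup>2) \<le> (\<Sum>i<n. q i * (a i)\<^sup>2)"
    proof (rule sum_mono)
      fix i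
      have "(a i * sqrt (w i * q i))\<^sup>2 = w i * (q i * (a i)\<^sup>2)"
        using w[of i] q[of i] by (simp add: power_mult_distrib less_imp_le)
      also have "\<dots> \<le> 1 * (q i * (a i)\<^sup>2)"
        using w[of i] q[of i] by (intro mult_right_mono) (auto simp: less_imp_le)
      finally show "(a i * sqrt (w i * q i))\<^sup>2 \<le> q i * (a i)\<^sup>2" by simp
    qed
  qed (use l in \<open>auto intro!: sum_nonneg\<close>)
  finally show ?thesis unfolding w_def q_def l_def .
qed simp

lemma polygon_diff: "polygon m (\<lambda>z. x z - y z) z = polygon m x z - polygon m y z"
proof -
  have "increments m (\<lambda>z. x z - y z) = (\<lambda>j. increments m x j - increments m y j)"
    by (simp add: increments_def fun_eq_iff)
  then show ?thesis by (simp add: polygon_def interp_diff)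
qed

lemma (in error_row) expectation_error_sum_square:
  assumes "J \<subseteq> {1..n}"
  shows "integrable M (\<lambda>\<omega>. (\<Sum>i\<in>J. \<epsilon> i \<omega>)\<^sup>2)" "expectation (\<lambda>\<omega>. (\<Sum>i\<in>J. \<epsilon> i \<omega>)\<^sup>2) = real (card J)"
proof -
  have eq: "(\<Sum>i\<in>J. \<epsilon> i \<omega>) = (\<Sum>i=1..n. (if i \<in> J then 1 else 0) * \<epsilon> i \<omega>)" for \<omega>
    using assms by (simp add: if_distrib[of "\<lambda>x. x * _"] sum.If_cases Int_absorb1 cong: if_cong)
  show "integrable M (\<lambda>\<omega>. (\<Sum>i\<in>J. \<epsilon> i \<omega>)\<^sup>2)" unfolding eq by (rule integrable_linear_square)
  have "(\<Sum>i=1..n. (if i \<in> J then 1 else (0::real))\<^sup>2) = (\<Sum>i=1..n. if i \<in> J then 1 else 0)"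
    by (intro sum.cong) auto
  also have "\<dots> = real (card J)" using assms by (simp add: sum.If_cases Int_absorb1)
  finally show "expectation (\<lambda>\<omega>. (\<Sum>i\<in>J. \<epsilon> i \<omega>)\<^sup>2) = real (card J)" unfolding eq expectation_linear_square .
qed

context error_array_bm
begin

text \<open>Unrelated to the deterministic drift under the alternative: it is the correction between
  an error and its residual, for large \<open>k\<close> essentially the mean of the first
  \<open>k\<close> errors.\<close>

definition drift_step :: "nat \<Rightarrow> 'a \<Rightarrow> nat \<Rightarrow> real" where
  "drift_step n \<omega> k = \<epsilon> n (Suc k) \<omega> - residual (\<lambda>j. \<epsilon> n j \<omega>) k"

text \<open>The double successor combines two shifts: \<open>interp\<close> counts from 0 while
  residuals start at 1, and residual \<open>k\<close> belongs to observation
  \<open>k + 1\<close>.\<close>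

definition U :: "nat \<Rightarrow> 'a \<Rightarrow> real \<Rightarrow> real" where
  "U n \<omega> = interp (n - 1) (\<lambda>i. \<epsilon> n (Suc (Suc i)) \<omega> / sqrt (real n - 1))"

definition D :: "nat \<Rightarrow> 'a \<Rightarrow> real \<Rightarrow> real" where
  "D n \<omega> = interp (n - 1) (\<lambda>i. drift_step n \<omega> (Suc i) / sqrt (real n - 1))"

lemma W_eq: "W n \<omega> = (\<lambda>z. U n \<omega> z - D n \<omega> z)"
  unfolding W_def U_def D_def interp_diff[symmetric] drift_step_def by (simp add: diff_divide_distrib)

text \<open>The coefficient vector of the correction is a difference of two unit vectors, so its
  squared length is 2 minus twice their inner product. That inner product is
  \<open>1 / sqrt (1 + 1 / k)\<close>, which is at least \<open>1 - 1 / k\<close>.\<close>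

lemma
  assumes k: "1 \<le> k" "k < n"
  shows integrable_drift_step_square: "integrable (M n) (\<lambda>\<omega>. (drift_step n \<omega> k)\<^sup>2)"
    and expectation_drift_step_square: "(\<integral>\<omega>. (drift_step n \<omega> k)\<^sup>2 \<partial>M n) \<le> 2 / real k"
proof -
  interpret error_row "M n" n "\<epsilon> n" using k by (intro row) auto
  define \<kappa> where "\<kappa> i = (if i = Suc k then 1 else (0 :: real))" for i
  have eq: "drift_step n \<omega> k = (\<Sum>i=1..n. (\<kappa> i - residual_coeff k i) * \<epsilon> n i \<omega>)" for \<omega>
  proof -
    have "(\<Sum>i=1..n. \<kappa> i * \<epsilon> n i \<omega>) = \<epsilon> n (Suc k) \<omega>"
      using k by (simp add: \<kappa>_def if_distrib[of "\<lambda>x. x * _"] cong: if_cong)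
    then show ?thesis
      unfolding drift_step_def residual_eq_sum[OF k(2)] by (simp add: left_diff_distrib sum_subtractf)
  qed
  show "integrable (M n) (\<lambda>\<omega>. (drift_step n \<omega> k)\<^sup>2)" unfolding eq by (rule integrable_linear_square)
  have "(\<integral>\<omega>. (drift_step n \<omega> k)\<^sup>2 \<partial>M n) = (\<Sum>i=1..n. (\<kappa> i - residual_coeff k i)\<^sup>2)"
    unfolding eq by (rule expectation_linear_square)
  also have "\<dots> = (\<Sum>i=1..n. \<kappa> i - 2 * (\<kappa> i * residual_coeff k i) + residual_coeff k i * residual_coeff k i)"
    by (intro sum.cong refl) (simp add: \<kappa>_def power2_eq_square algebra_simps)
  also have "\<dots> = (\<Sum>i=1..n. \<kappa> i) - 2 * (\<Sum>i=1..n. \<kappa> i * residual_coeff k i) + 1"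
    using residual_coeff_orthonormal[OF k k] by (simp add: sum.distrib sum_subtractf sum_distrib_left)
  also have "\<dots> = 2 * (1 - residual_coeff k (Suc k))"
    using k by (simp add: \<kappa>_def if_distrib[of "\<lambda>x. x * _"] cong: if_cong)
  also have "\<dots> \<le> 2 * (1 / real k)"
  proof -
    define x where "x = 1 / real k"
    have x: "x > 0" using k by (simp add: x_def)
    have "1 + x \<le> (1 + x)\<^sup>2" using x by (simp add: power2_eq_square algebra_simps)
    then have "sqrt (1 + x) \<le> 1 + x" using x by (intro real_le_lsqrt) auto
    then have "1 / (1 + x) \<le> 1 / sqrt (1 + x)" using x by (intro divide_left_mono mult_pos_pos) auto
    moreover have "1 - x \<le> 1 / (1 + x)" using x by (simp add: field_simps)
    ultimately show ?thesis by (simp add: residual_coeff_def x_def)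
  qed
  finally show "(\<integral>\<omega>. (drift_step n \<omega> k)\<^sup>2 \<partial>M n) \<le> 2 / real k" by simp
qed

text \<open>The second factor of the weighted Cauchy-Schwarz inequality. It does not involve the
  block, so a single exceptional event serves all blocks and all \<open>m\<close>.\<close>

definition Q :: "nat \<Rightarrow> 'a \<Rightarrow> real" where
  "Q n \<omega> = (\<Sum>i<n - 1. sqrt (real (Suc i)) * (drift_step n \<omega> (Suc i))\<^sup>2)"

text \<open>Markov's inequality: the weight \<open>sqrt i\<close> against the second moment
  \<open>2 / i\<close> leaves summands \<open>2 / sqrt i\<close>, which add up to at most
  \<open>4 * sqrt (n - 1)\<close>.\<close>

lemma
  assumes n: "n \<ge> 2" and R: "R > 0"
  shows drift_exceptional_events: "{\<omega> \<in> space (M n). R * sqrt (real n - 1) < Q n \<omega>} \<in> sets (M n)"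
    and drift_exceptional_prob: "measure (M n) {\<omega> \<in> space (M n). R * sqrt (real n - 1) < Q n \<omega>} \<le> 4 / R"
proof -
  interpret error_row "M n" n "\<epsilon> n" using n by (intro row) auto
  have int: "integrable (M n) (\<lambda>\<omega>. sqrt (real (Suc i)) * (drift_step n \<omega> (Suc i))\<^sup>2)" if "i < n - 1" for i
    using that by (intro integrable_mult_right integrable_drift_step_square) auto
  have Q: "integrable (M n) (Q n)" unfolding Q_def[abs_def] using int by (intro Bochner_Integration.integrable_sum) auto
  have "expectation (Q n) = (\<Sum>i<n - 1. sqrt (real (Suc i)) * expectation (\<lambda>\<omega>. (drift_step n \<omega> (Suc i))\<^sup>2))"
    unfolding Q_def[abs_def] using int by (subst Bochner_Integration.integral_sum) auto
  also have "\<dots> \<le> (\<Sum>i<n - 1. 2 * (1 / sqrt (real (Suc i))))"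
  proof (rule sum_mono)
    fix i assume "i \<in> {..<n - 1}"
    then have "sqrt (real (Suc i)) * expectation (\<lambda>\<omega>. (drift_step n \<omega> (Suc i))\<^sup>2) \<le> sqrt (real (Suc i)) * (2 / real (Suc i))"
      by (intro mult_left_mono expectation_drift_step_square) auto
    also have "\<dots> = 2 * (sqrt (real (Suc i)) / real (Suc i))" by simp
    also have "sqrt (real (Suc i)) / real (Suc i) = 1 / sqrt (real (Suc i))"
      using real_div_sqrt[of "real (Suc i)"] by (simp add: field_simps)
    finally show "sqrt (real (Suc i)) * expectation (\<lambda>\<omega>. (drift_step n \<omega> (Suc i))\<^sup>2) \<le> 2 * (1 / sqrt (real (Suc i)))" .
  qed
  also have "\<dots> \<le> 2 * (2 * sqrt (real (n - 1)))"
    unfolding sum_distrib_left[symmetric] by (intro mult_left_mono sum_inverse_sqrt_le) auto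
  finally have EQ: "expectation (Q n) \<le> 4 * sqrt (real n - 1)" using n by (simp add: of_nat_diff)
  let ?E = "{\<omega> \<in> space (M n). R * sqrt (real n - 1) < Q n \<omega>}"
  have [measurable]: "Q n \<in> borel_measurable (M n)" using Q by blast
  show E: "?E \<in> events" by measurable
  have ind: "integrable (M n) (indicat_real ?E)"
    using E by (intro integrable_real_indicator) (auto simp: emeasure_eq_measure)
  have Q0: "Q n \<omega> \<ge> 0" for \<omega> unfolding Q_def by (intro sum_nonneg) auto
  have "R * sqrt (real n - 1) * prob ?E = expectation (\<lambda>\<omega>. R * sqrt (real n - 1) * indicator ?E \<omega>)"
    using ind by simp
  also have "\<dots> \<le> expectation (Q n)"
  proof (rule integral_mono[OF integrable_mult_right[OF ind] Q])
    show "R * sqrt (real n - 1) * indicator ?E \<omega> \<le> Q n \<omega>" for \<omega>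
      using Q0[of \<omega>] by (cases "\<omega> \<in> ?E") auto
  qed
  also note EQ
  finally have "sqrt (real n - 1) * (R * prob ?E) \<le> sqrt (real n - 1) * 4" by (simp add: mult_ac)
  then have "R * prob ?E \<le> 4" using n by (subst (asm) mult_le_cancel_left_pos) auto
  then show "prob ?E \<le> 4 / R" using R by (simp add: le_divide_eq mult.commute)
qed

text \<open>A pathwise bound: the factor \<open>sqrt ((n - 1) / m)\<close> of the weighted
  inequality and the bound on \<open>Q\<close> together cancel the normalisation, so the modulus
  depends on \<open>m\<close> and \<open>R\<close> only.\<close>

lemma D_polygon_close:
  assumes n: "n \<ge> 2" and m: "m > 0" and Q: "Q n \<omega> \<le> R * sqrt (real n - 1)" and z: "0 \<le> z" "z \<le> 1"
  shows "\<bar>D n \<omega> z - polygon m (D n \<omega>) z\<bar> \<le> 2 * sqrt (3 * R / sqrt (real m))"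
proof (rule polygon_close[OF m _ z])
  fix j assume j: "j < m"
  have n1: "real (n - 1) = real n - 1" "real n - 1 > 0" using n by (auto simp: of_nat_diff)
  have "\<bar>D n \<omega> z - D n \<omega> (real j / real m)\<bar> \<le> sqrt (3 * R / sqrt (real m))"
    if z: "real j / real m \<le> z" "z \<le> real (Suc j) / real m" for z
  proof -
    define s where "s = real j / real m"
    have "real (Suc j) / real m \<le> 1" using j by simp
    then have su: "0 \<le> s" "s \<le> z" "z \<le> 1" "z - s \<le> 1 / real m"
      using z by (auto simp: s_def add_divide_distrib)
    have "D n \<omega> z - D n \<omega> s = (\<Sum>i<n - 1. drift_step n \<omega> (Suc i) * weight (n - 1) s z i) / sqrt (real n - 1)"
      unfolding D_def interp_weight by (simp add: sum_divide_distrib)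
    then have "(D n \<omega> z - D n \<omega> s)\<^sup>2 = (\<Sum>i<n - 1. drift_step n \<omega> (Suc i) * weight (n - 1) s z i)\<^sup>2 / (real n - 1)"
      using n1 by (simp add: power_divide)
    also have "\<dots> \<le> 3 * sqrt (real (n - 1) / real m) * Q n \<omega> / (real n - 1)"
      unfolding Q_def using n1 by (intro divide_right_mono weighted_sum_square_le[OF m su]) auto
    also have "\<dots> \<le> 3 * sqrt (real (n - 1) / real m) * (R * sqrt (real n - 1)) / (real n - 1)"
      using Q n1 by (intro divide_right_mono mult_left_mono) auto
    also have "\<dots> = 3 * R / sqrt (real m)"
    proof -
      define s t where "s = sqrt (real n - 1)" and "t = sqrt (real m)"
      have st: "s > 0" "t > 0" "real n - 1 = s * s" using n1 m by (auto simp: s_def t_def)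
      show ?thesis
        unfolding n1(1) real_sqrt_divide s_def[symmetric] t_def[symmetric]
        unfolding st(3) using st(1,2) by (simp add: field_simps)
    qed
    finally have "sqrt ((D n \<omega> z - D n \<omega> s)\<^sup>2) \<le> sqrt (3 * R / sqrt (real m))" by (rule real_sqrt_le_mono)
    then show ?thesis by (simp add: s_def)
  qed
  then show "\<exists>c. \<forall>z. real j / real m \<le> z \<and> z \<le> real (Suc j) / real m \<longrightarrow> \<bar>D n \<omega> z - c\<bar> \<le> sqrt (3 * R / sqrt (real m))"
    by blast
qed

definition lo :: "nat \<Rightarrow> nat \<Rightarrow> nat \<Rightarrow> nat" where
  "lo m n j = nat \<lfloor>real (n - 1) * (real j / real m)\<rfloor>"

text \<open>One index beyond the end of the block, because interpolation inside a cell uses the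
  partial sums at both of its ends; the minimum caps this at the end of the row.\<close>

definition hi :: "nat \<Rightarrow> nat \<Rightarrow> nat \<Rightarrow> nat" where
  "hi m n j = min (n - 1) (nat \<lfloor>real (n - 1) * (real (Suc j) / real m)\<rfloor> + 1)"

lemma lo_hi:
  assumes j: "j < m"
  shows "lo m n j \<le> hi m n j" "hi m n j \<le> n - 1"
    "\<bar>real (hi m n j - lo m n j) - real (n - 1) / real m\<bar> \<le> 2"
proof -
  define x y where "x = real (n - 1) * (real j / real m)" and "y = real (n - 1) * (real (Suc j) / real m)"
  have y: "y = x + real (n - 1) / real m" using j by (simp add: x_def y_def field_simps)
  have x0: "0 \<le> x" by (simp add: x_def)
  have xy: "x \<le> y" unfolding y by simp
  have "real (Suc j) / real m \<le> 1" using j by simp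
  then have "y \<le> real (n - 1) * 1" unfolding y_def by (rule mult_left_mono) simp
  then have yn: "y \<le> real (n - 1)" by simp
  have lo: "real (lo m n j) \<le> x" "x < real (lo m n j) + 1"
    using x0 unfolding lo_def x_def[symmetric] by linarith+
  have hi: "real (hi m n j) \<le> y + 1" "y \<le> real (hi m n j)"
    using x0 xy yn unfolding hi_def y_def[symmetric] by (auto simp: min_def) linarith+
  have "real (lo m n j) \<le> real (hi m n j)" using lo hi xy by linarith
  then show le: "lo m n j \<le> hi m n j" by simp
  show "hi m n j \<le> n - 1" by (simp add: hi_def)
  show "\<bar>real (hi m n j - lo m n j) - real (n - 1) / real m\<bar> \<le> 2"
    using lo hi y le by (simp add: of_nat_diff abs_le_iff)
qed

text \<open>Indices are shifted by one because the first residual belongs to the second observation.\<close>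

definition block_bad :: "nat \<Rightarrow> nat \<Rightarrow> nat \<Rightarrow> real \<Rightarrow> 'a set" where
  "block_bad m n j r = {\<omega> \<in> space (M n). \<exists>k\<in>{lo m n j + 1..hi m n j + 1}.
     2 * (r * sqrt (real n - 1)) < \<bar>\<Sum>i\<in>{lo m n j + 1<..k}. \<epsilon> n i \<omega>\<bar>}"

text \<open>At every point of a block the process is a convex combination of two consecutive partial
  sums, and off the bad events both stay within \<open>2 * r\<close>, after normalisation, of the
  one at the start of the block.\<close>

lemma U_polygon_close:
  assumes n: "n \<ge> 2" and m: "m > 0" and \<omega>: "\<omega> \<in> space (M n)"
    and good: "\<And>j. j < m \<Longrightarrow> \<omega> \<notin> block_bad m n j r" and z: "0 \<le> z" "z \<le> 1"
  shows "\<bar>U n \<omega> z - polygon m (U n \<omega>) z\<bar> \<le> 2 * (2 * r)"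
proof (rule polygon_close[OF m _ z])
  fix j assume j: "j < m"
  have n1: "real (n - 1) = real n - 1" "real n - 1 > 0" using n by (auto simp: of_nat_diff)
  define a b where "a = lo m n j" and "b = hi m n j"
  define V where "V k = (\<Sum>i<k. \<epsilon> n (Suc (Suc i)) \<omega>)" for k
  have Vdiff: "V k - V a = (\<Sum>i\<in>{a + 1<..k + 1}. \<epsilon> n i \<omega>)" if "a \<le> k" for k
    using that
  proof (induction k rule: dec_induct)
    case (step k)
    have "{a + 1<..Suc k + 1} = insert (Suc (Suc k)) {a + 1<..k + 1}" using step by auto
    then show ?case using step by (simp add: V_def)
  qed simp
  have Vle: "\<bar>V k - V a\<bar> \<le> 2 * r * sqrt (real n - 1)" if "a \<le> k" "k \<le> b" for k
  proof -
    have "k + 1 \<in> {a + 1..b + 1}" using that by auto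
    then have "\<not> 2 * (r * sqrt (real n - 1)) < \<bar>\<Sum>i\<in>{a + 1<..k + 1}. \<epsilon> n i \<omega>\<bar>"
      using good[OF j] \<omega> unfolding block_bad_def a_def[symmetric] b_def[symmetric] by blast
    then show ?thesis unfolding Vdiff[OF that(1)] by simp
  qed
  have "\<bar>U n \<omega> z - V a / sqrt (real n - 1)\<bar> \<le> 2 * r"
    if z: "real j / real m \<le> z" "z \<le> real (Suc j) / real m" for z
  proof -
    have j1: "real (Suc j) / real m \<le> 1" using j by simp
    have z01: "0 \<le> z" "z \<le> 1" using z j1 order_trans[OF _ z(1), of 0] by auto
    define x where "x = real (n - 1) * z"
    define p f where "p = nat \<lfloor>x\<rfloor>" and "f = frac x"
    have x0: "x \<ge> 0" using z01 by (simp add: x_def)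
    have xn: "x \<le> real (n - 1)" using mult_left_mono[OF z01(2), of "real (n - 1)"] by (simp add: x_def)
    have px: "real p = x - f" using x0 by (simp add: p_def f_def frac_def)
    have f: "0 \<le> f" "f < 1" by (auto simp: f_def frac_lt_1)
    have ap: "a \<le> p"
      unfolding a_def lo_def p_def x_def using z by (intro nat_mono floor_mono mult_left_mono) auto
    have pj: "p \<le> nat \<lfloor>real (n - 1) * (real (Suc j) / real m)\<rfloor>"
      unfolding p_def x_def using z by (intro nat_mono floor_mono mult_left_mono) auto
    have pn: "p \<le> n - 1" using px f xn by linarith
    have pb: "p \<le> b" using pj pn by (simp add: b_def hi_def)
    have "U n \<omega> z = (V p + f * \<epsilon> n (Suc (Suc p)) \<omega>) / sqrt (real n - 1)"
      unfolding U_def interp_eq_floor[OF z01] x_def[symmetric] p_def[symmetric] f_def[symmetric] V_def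
      by (simp add: sum_divide_distrib add_divide_distrib)
    also have "V p + f * \<epsilon> n (Suc (Suc p)) \<omega> = (1 - f) * V p + f * V (Suc p)"
      by (simp add: V_def algebra_simps)
    finally have Uz: "U n \<omega> z - V a / sqrt (real n - 1) =
        ((1 - f) * (V p - V a) + f * (V (Suc p) - V a)) / sqrt (real n - 1)"
      by (simp add: diff_divide_distrib[symmetric] algebra_simps)
    have fp: "f * \<bar>V (Suc p) - V a\<bar> \<le> f * (2 * r * sqrt (real n - 1))"
    proof (cases "p < n - 1")
      case True
      then have "Suc p \<le> b" using pj by (simp add: b_def hi_def)
      then show ?thesis using Vle[of "Suc p"] ap f by (intro mult_left_mono) auto
    next
      \<comment> \<open>At the very end of the row the next partial sum is not controlled, but it
        enters with the fractional part as its factor, and this is 0.\<close>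
      case False
      then have "f = 0" using px f xn pn by linarith
      then show ?thesis by simp
    qed
    have "\<bar>(1 - f) * (V p - V a) + f * (V (Suc p) - V a)\<bar> \<le> (1 - f) * \<bar>V p - V a\<bar> + f * \<bar>V (Suc p) - V a\<bar>"
      using f by (intro order_trans[OF abs_triangle_ineq]) (simp add: abs_mult)
    also have "\<dots> \<le> (1 - f) * (2 * r * sqrt (real n - 1)) + f * (2 * r * sqrt (real n - 1))"
      using f Vle[OF ap pb] by (intro add_mono[OF mult_left_mono fp]) auto
    also have "\<dots> = 2 * r * sqrt (real n - 1)" by (simp add: algebra_simps)
    finally show ?thesis unfolding Uz using n1 by (simp add: abs_divide divide_le_eq)
  qed
  then show "\<exists>c. \<forall>z. real j / real m \<le> z \<and> z \<le> real (Suc j) / real m \<longrightarrow> \<bar>U n \<omega> z - c\<bar> \<le> 2 * r"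
    by blast
qed

end

section \<open>Block sums of the errors and the exceptional events\<close>

context error_array_bm
begin

definition block_sum :: "nat \<Rightarrow> nat \<Rightarrow> nat \<Rightarrow> 'a \<Rightarrow> real" where
  "block_sum m j n \<omega> = (\<Sum>i\<in>{lo m n j + 1<..hi m n j + 1}. \<epsilon> n i \<omega>) / sqrt (real n - 1)"

text \<open>The coefficients are constant on the block and of order \<open>1 / sqrt n\<close>, so
  the Lindeberg estimate applies directly. Only the relative length of the block matters, and
  rounding changes its limit \<open>1 / m\<close> by nothing.\<close>

lemma iexp_block_sum_tendsto:
  assumes j: "j < m"
  shows "(\<lambda>n. CLINT \<omega>|M n. iexp (\<theta> * block_sum m j n \<omega>)) \<longlonglongrightarrow> (CLINT \<omega>|N. iexp (\<theta> * incr m j \<omega>))"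
proof -
  define J where "J n = {lo m n j + 1<..hi m n j + 1}" for n
  have J: "J n \<subseteq> {1..n}" if "n \<ge> 2" for n
    using lo_hi(2)[OF j, of n] that by (auto simp: J_def)
  have cardJ: "card (J n) = hi m n j - lo m n j" for n by (simp add: J_def)
  define b where "b n i = (if i \<in> J n then \<theta> / sqrt (real n - 1) else 0)" for n i
  have sum_b: "(\<Sum>i=1..n. b n i * \<epsilon> n i \<omega>) = \<theta> * block_sum m j n \<omega>" if "n \<ge> 2" for n \<omega>
  proof -
    have "(\<Sum>i=1..n. b n i * \<epsilon> n i \<omega>) = (\<Sum>i\<in>J n. \<theta> / sqrt (real n - 1) * \<epsilon> n i \<omega>)"
      using J[OF that] by (simp add: b_def if_distrib[of "\<lambda>x. x * _"] sum.If_cases Int_absorb1 cong: if_cong)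
    then show ?thesis unfolding block_sum_def J_def sum_distrib_left[symmetric] by simp
  qed
  have sum_b2: "(\<Sum>i=1..n. (b n i)\<^sup>2) = \<theta>\<^sup>2 * (real (hi m n j - lo m n j) / (real n - 1))" if "n \<ge> 2" for n
  proof -
    have "(\<Sum>i=1..n. (b n i)\<^sup>2) = (\<Sum>i=1..n. if i \<in> J n then \<theta>\<^sup>2 / (real n - 1) else 0)"
      using that by (intro sum.cong refl) (simp add: b_def power_divide)
    also have "\<dots> = real (card (J n)) * (\<theta>\<^sup>2 / (real n - 1))"
      using J[OF that] by (simp add: sum.If_cases Int_absorb1)
    finally show ?thesis by (simp add: cardJ)
  qed
  have "(\<lambda>n. (CLINT \<omega>|M n. iexp (\<Sum>i=1..n. b n i * \<epsilon> n i \<omega>)) - complex_of_real (exp (- ((\<Sum>i=1..n. (b n i)\<^sup>2) / 2))))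
      \<longlonglongrightarrow> 0"
  proof (rule iexp_linear_tendsto[where N = 2 and \<beta> = "2 * \<bar>\<theta>\<bar>" and S = "\<theta>\<^sup>2"])
    fix n :: nat assume n: "n \<ge> 2"
    have n1: "real n - 1 > 0" using n by simp
    show "\<bar>b n i\<bar> \<le> 2 * \<bar>\<theta>\<bar> / sqrt (real n)" for i
    proof -
      have "sqrt (real n) \<le> sqrt (4 * (real n - 1))" using n by (intro real_sqrt_le_mono) auto
      also have "\<dots> = 2 * sqrt (real n - 1)" by (subst real_sqrt_mult) simp
      finally have "\<bar>\<theta>\<bar> * sqrt (real n) \<le> \<bar>\<theta>\<bar> * (2 * sqrt (real n - 1))" by (rule mult_left_mono) simp
      then have "\<bar>\<theta>\<bar> / sqrt (real n - 1) \<le> 2 * \<bar>\<theta>\<bar> / sqrt (real n)" using n n1 by (simp add: field_simps)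
      then show ?thesis using n1 by (auto simp: b_def)
    qed
    have "real (hi m n j - lo m n j) \<le> real n - 1" using lo_hi(2)[OF j, of n] n by linarith
    then have "real (hi m n j - lo m n j) / (real n - 1) \<le> 1" using n1 by simp
    then show "(\<Sum>i=1..n. (b n i)\<^sup>2) \<le> \<theta>\<^sup>2"
      unfolding sum_b2[OF n] using mult_left_mono[of _ 1 "\<theta>\<^sup>2"] by fastforce
  qed
  moreover have "(\<lambda>n. complex_of_real (exp (- ((\<Sum>i=1..n. (b n i)\<^sup>2) / 2)))) \<longlonglongrightarrow> complex_of_real (exp (- (\<theta>\<^sup>2 * (1 / real m) / 2)))"
  proof (intro tendsto_intros)
    have "(\<lambda>n. real (hi m n j - lo m n j) / (real n - 1)) \<longlonglongrightarrow> 1 / real m"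
    proof (rule LIM_zero_cancel, rule Lim_null_comparison)
      show "(\<lambda>n. 2 / (real n - 1)) \<longlonglongrightarrow> 0" by real_asymp
      show "\<forall>\<^sub>F n in sequentially. norm (real (hi m n j - lo m n j) / (real n - 1) - 1 / real m) \<le> 2 / (real n - 1)"
        using eventually_ge_at_top[of 2]
      proof eventually_elim
        case (elim n)
        then have n1: "real n - 1 > 0" "real (n - 1) = real n - 1" by (auto simp: of_nat_diff)
        have "real (hi m n j - lo m n j) / (real n - 1) - 1 / real m =
            (real (hi m n j - lo m n j) - real (n - 1) / real m) / (real n - 1)"
        proof -
          have "x / c - 1 / y = (x - c / y) / c" if "c > 0" for c x y :: real
            using that by (simp add: diff_divide_distrib)
          then show ?thesis unfolding n1(2) using n1(1) .
        qed
        then show ?case using lo_hi(3)[OF j, of n] n1 by (simp add: abs_divide divide_right_mono)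
      qed
    qed
    then have "(\<lambda>n. \<theta>\<^sup>2 * (real (hi m n j - lo m n j) / (real n - 1))) \<longlonglongrightarrow> \<theta>\<^sup>2 * (1 / real m)"
      by (rule tendsto_mult_left)
    then show "(\<lambda>n. \<Sum>i=1..n. (b n i)\<^sup>2) \<longlonglongrightarrow> \<theta>\<^sup>2 * (1 / real m)"
      by (rule Lim_transform_eventually) (use sum_b2 in \<open>auto simp: eventually_sequentially intro!: exI[of _ 2]\<close>)
  qed auto
  ultimately have "(\<lambda>n. CLINT \<omega>|M n. iexp (\<Sum>i=1..n. b n i * \<epsilon> n i \<omega>)) \<longlonglongrightarrow> complex_of_real (exp (- (\<theta>\<^sup>2 * (1 / real m) / 2)))"
    using tendsto_add[of _ 0 sequentially] by fastforce
  then have "(\<lambda>n. CLINT \<omega>|M n. iexp (\<theta> * block_sum m j n \<omega>)) \<longlonglongrightarrow> complex_of_real (exp (- (\<theta>\<^sup>2 * (1 / real m) / 2)))"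
  proof (rule Lim_transform_eventually)
    show "\<forall>\<^sub>F n in sequentially. (CLINT \<omega>|M n. iexp (\<Sum>i=1..n. b n i * \<epsilon> n i \<omega>)) =
        (CLINT \<omega>|M n. iexp (\<theta> * block_sum m j n \<omega>))"
      using eventually_ge_at_top[of 2] by eventually_elim (simp only: sum_b)
  qed
  \<comment> \<open>A coefficient vector supported at \<open>j\<close> extracts the law of a single
    increment from the joint characteristic function.\<close>
  also have "complex_of_real (exp (- (\<theta>\<^sup>2 * (1 / real m) / 2))) = (CLINT \<omega>|N. iexp (\<theta> * incr m j \<omega>))"
    using iexp_incr[where m = m and \<theta> = "\<lambda>i. if i = j then \<theta> else 0"] j
    by (simp add: if_distrib[of "\<lambda>x. x * _"] if_distrib[of "\<lambda>x. x\<^sup>2"] cong: if_cong)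
  finally show ?thesis .
qed

lemma measurable_error_sum: "n \<ge> 1 \<Longrightarrow> J \<subseteq> {1..n} \<Longrightarrow> (\<lambda>\<omega>. \<Sum>i\<in>J. \<epsilon> n i \<omega>) \<in> borel_measurable (M n)"
  using error_row.measurable_error[OF row] by (intro borel_measurable_sum) auto

lemma block_indices: "n \<ge> 1 \<Longrightarrow> j < m \<Longrightarrow> k \<le> hi m n j + 1 \<Longrightarrow> {l<..k} \<subseteq> {1..n}"
  using lo_hi(2)[of j m n] by auto

text \<open>The scalar case of the continuity theorem, with the block sum placed in coordinate
  0.\<close>

lemma block_sum_tendsto:
  fixes f :: "real \<Rightarrow> real"
  assumes j: "j < m" and f: "continuous_on UNIV f" "\<And>x. \<bar>f x\<bar> \<le> K"
  shows "(\<lambda>n. \<integral>\<omega>. f (block_sum m j n \<omega>) \<partial>M n) \<longlonglongrightarrow> N.expectation (\<lambda>\<omega>. f (incr m j \<omega>))"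
proof -
  let ?X = "\<lambda>n \<omega> i. if i < (1::nat) then block_sum m j n \<omega> else 0"
  let ?Z = "\<lambda>\<omega> i. if i < (1::nat) then incr m j \<omega> else 0"
  have mX: "block_sum m j n \<in> borel_measurable (M n)" if "n \<ge> 1" for n
    unfolding block_sum_def[abs_def] using block_indices[OF that j]
    by (intro borel_measurable_divide measurable_error_sum that) auto
  have cont: "continuous_on UNIV (\<lambda>x :: nat \<Rightarrow> real. f (x 0))"
    using f(1) by (rule continuous_on_compose2[OF _ continuous_on_product_coordinates]) auto
  have "(\<lambda>n. \<integral>\<omega>. f (?X n \<omega> 0) \<partial>M n) \<longlonglongrightarrow> N.expectation (\<lambda>\<omega>. f (?Z \<omega> 0))"
  proof (rule finite_dimensional_convergence[where m = 1 and C = 1 and X = ?X and Z = ?Z and \<psi> = "\<lambda>x. f (x 0)",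
        OF prob_space_row N.prob_space_axioms _ _ _ _ _ _ _ _ _ _ cont f(2)])
    show "(\<lambda>\<omega>. ?X n \<omega> i) \<in> borel_measurable (M n)" if "n \<ge> 1" for n i
      using mX[OF that] by (cases "i < 1") auto
    show "(\<lambda>\<omega>. ?Z \<omega> i) \<in> borel_measurable N" for i
      using measurable_incr[OF j] by (cases "i < 1") auto
    fix n i assume n: "n \<ge> (1::nat)" and i: "i < (1::nat)"
    interpret error_row "M n" n "\<epsilon> n" by (rule row[OF n])
    note sq = expectation_error_sum_square[OF block_indices[OF n j order_refl, of "lo m n j + 1"]]
    show "integrable (M n) (\<lambda>\<omega>. (?X n \<omega> i)\<^sup>2)"
      using sq(1) i by (simp add: block_sum_def power_divide)
    have "real (hi m n j - lo m n j) \<le> real n - 1" using lo_hi(2)[OF j, of n] n by linarith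
    then show "expectation (\<lambda>\<omega>. (?X n \<omega> i)\<^sup>2) \<le> 1"
      using sq(2) i n by (auto simp: block_sum_def power_divide divide_le_eq_1)
  next
    fix i assume i: "i < (1::nat)"
    show "integrable N (\<lambda>\<omega>. (?Z \<omega> i)\<^sup>2)" using integrable_incr_square[OF j] i by simp
    show "N.expectation (\<lambda>\<omega>. (?Z \<omega> i)\<^sup>2) \<le> 1" using expectation_incr_square[OF j] i j by simp
  next
    fix \<theta> :: "nat \<Rightarrow> real"
    have m1: "(\<lambda>\<omega>. \<theta> 0 * block_sum m j n \<omega>) \<in> borel_measurable (M n)" if "n \<ge> 1" for n
      using mX[OF that] by simp
    have m2: "(\<lambda>\<omega>. \<theta> 0 * incr m j \<omega>) \<in> borel_measurable N" using measurable_incr[OF j] by simp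
    note cs = iexp_tendsto_imp_cos_sin[OF prob_space_row N.prob_space_axioms m1 m2 iexp_block_sum_tendsto[OF j, of "\<theta> 0"]]
    show "(\<lambda>n. \<integral>\<omega>. cos (\<Sum>i<1. \<theta> i * ?X n \<omega> i) \<partial>M n) \<longlonglongrightarrow> N.expectation (\<lambda>\<omega>. cos (\<Sum>i<1. \<theta> i * ?Z \<omega> i))"
      using cs(1) by simp
    show "(\<lambda>n. \<integral>\<omega>. sin (\<Sum>i<1. \<theta> i * ?X n \<omega> i) \<partial>M n) \<longlonglongrightarrow> N.expectation (\<lambda>\<omega>. sin (\<Sum>i<1. \<theta> i * ?Z \<omega> i))"
      using cs(2) by simp
  qed auto
  then show ?thesis by simp
qed

text \<open>By Ottaviani's inequality the maximum over a block is controlled by the total sum of the block; its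
  limit is normal with variance \<open>1 / m\<close>, so the fourth moment gives a bound summable over the \<open>m\<close> blocks.\<close>

lemma block_bad_prob:
  assumes j: "j < m" and r: "r > 0" "8 \<le> real m * r\<^sup>2"
  shows "\<forall>\<^sub>F n in sequentially. block_bad m n j r \<in> sets (M n) \<and>
    measure (M n) (block_bad m n j r) \<le> 8 / ((real m)\<^sup>2 * r ^ 4)"
proof -
  \<comment> \<open>A bounded continuous majorant of the indicator of
    \<open>\<bar>x\<bar> > r\<close>, to which the convergence of block sums applies, and which is
    itself dominated by the fourth power that the normal limit can integrate.\<close>
  define f where "f x = min 1 ((x / r) ^ 4)" for x :: real
  have f: "continuous_on UNIV f" "0 \<le> f x" "f x \<le> 1" "f x \<le> x ^ 4 / r ^ 4" for x
    unfolding f_def using r by (auto intro!: continuous_intros simp: power_divide)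
  have f1: "\<bar>f x\<bar> \<le> 1" for x using f(2,3)[of x] by simp
  have f_gt: "f x = 1" if "r < \<bar>x\<bar>" for x
  proof -
    have "1 \<le> \<bar>x / r\<bar>" using that r by (simp add: le_divide_eq)
    then have "1 \<le> \<bar>x / r\<bar> ^ 4" by (rule one_le_power)
    also have "\<bar>x / r\<bar> ^ 4 = (x / r) ^ 4" by (rule power_even_abs) simp
    finally show ?thesis by (simp add: f_def)
  qed
  have "N.expectation (\<lambda>\<omega>. f (incr m j \<omega>)) \<le> N.expectation (\<lambda>\<omega>. incr m j \<omega> ^ 4 / r ^ 4)"
  proof (rule integral_mono)
    show "integrable N (\<lambda>\<omega>. f (incr m j \<omega>))"
      using f1 borel_measurable_continuous_on[OF f(1) measurable_incr[OF j]]
      by (intro N.integrable_const_bound[where B = 1]) auto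
    show "integrable N (\<lambda>\<omega>. incr m j \<omega> ^ 4 / r ^ 4)" using integrable_incr_4[OF j] by simp
  qed (rule f(4))
  also have "\<dots> = 3 / ((real m)\<^sup>2 * r ^ 4)" using expectation_incr_4[OF j] by simp
  \<comment> \<open>The strict step from 3 to 4 leaves room for the passage to the limit, so the
    bound holds for all large \<open>n\<close>; Ottaviani's factor 2 then produces the 8.\<close>
  also have "\<dots> < 4 / ((real m)\<^sup>2 * r ^ 4)" using r j by (intro divide_strict_right_mono) auto
  finally have lim: "N.expectation (\<lambda>\<omega>. f (incr m j \<omega>)) < 4 / ((real m)\<^sup>2 * r ^ 4)" .
  have "\<forall>\<^sub>F n in sequentially. (\<integral>\<omega>. f (block_sum m j n \<omega>) \<partial>M n) < 4 / ((real m)\<^sup>2 * r ^ 4)"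
    by (rule order_tendstoD(2)[OF block_sum_tendsto[OF j f(1) f1] lim])
  then show ?thesis
    using eventually_ge_at_top[of "2 * m + 2"]
  proof eventually_elim
    case (elim n)
    then have n: "n \<ge> 1" "n \<ge> 2" and n1: "real n - 1 > 0" "real (n - 1) = real n - 1" "2 * real m \<le> real n - 1" by auto
    interpret error_row "M n" n "\<epsilon> n" by (rule row[OF n(1)])
    let ?a = "lo m n j + 1" and ?b = "hi m n j + 1" and ?r = "r * sqrt (real n - 1)"
    have sub: "{k<..l} \<subseteq> {1..n}" if "l \<le> ?b" for k l by (rule block_indices[OF n(1) j that])
    have sum_meas: "(\<lambda>\<omega>. \<Sum>i\<in>{k<..l}. \<epsilon> n i \<omega>) \<in> borel_measurable (M n)" if "l \<le> ?b" for k l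
      by (rule measurable_error_sum[OF n(1) sub[OF that]])
    \<comment> \<open>For \<open>n \<ge> 2 * m + 2\<close> the rounding error 2 is at most
      \<open>(n - 1) / m\<close>, so the block length is at most doubled.\<close>
    have len: "real (hi m n j - lo m n j) \<le> 2 * (real n - 1) / real m"
    proof -
      have "2 \<le> (real n - 1) / real m" using n1 j by (simp add: le_divide_eq)
      then have "real (hi m n j - lo m n j) \<le> 2 * ((real n - 1) / real m)"
        using lo_hi(3)[OF j, of n] unfolding n1(2) by linarith
      then show ?thesis by simp
    qed
    \<comment> \<open>Chebyshev's inequality bounds this by \<open>2 / (m * r\<^sup>2)\<close>,
      which the assumption \<open>8 \<le> m * r\<^sup>2\<close> makes at most one quarter.\<close>
    have half: "prob {\<omega> \<in> space (M n). ?r < \<bar>\<Sum>i\<in>{k<..?b}. \<epsilon> n i \<omega>\<bar>} \<le> 1 / 2" if k: "?a \<le> k" "k \<le> ?b" for k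
    proof -
      have "prob {\<omega> \<in> space (M n). ?r < \<bar>\<Sum>i\<in>{k<..?b}. \<epsilon> n i \<omega>\<bar>} \<le>
          expectation (\<lambda>\<omega>. (\<Sum>i\<in>{k<..?b}. \<epsilon> n i \<omega>)\<^sup>2) / ?r\<^sup>2"
        using r n1 by (intro prob_abs_gt_le sum_meas expectation_error_sum_square sub) auto
      also have "\<dots> = real (?b - k) / (r\<^sup>2 * (real n - 1))"
        using n1 expectation_error_sum_square(2)[OF sub[OF order_refl, of k]] by (simp add: power_mult_distrib)
      also have "\<dots> \<le> (2 * (real n - 1) / real m) / (r\<^sup>2 * (real n - 1))"
      proof (rule divide_right_mono)
        have "real (?b - k) \<le> real (hi m n j - lo m n j)" using k by simp
        then show "real (?b - k) \<le> 2 * (real n - 1) / real m" using len by linarith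
      qed (use n1 in auto)
      also have "\<dots> = 2 / (real m * r\<^sup>2)"
      proof -
        have "(2 * c / x) / (y * c) = 2 / (x * y)" if "c > 0" for c x y :: real
          using that by simp
        then show ?thesis using n1(1) .
      qed
      also have "\<dots> \<le> 2 / 8" using r j by (intro divide_left_mono) auto
      finally show ?thesis by simp
    qed
    have bad: "block_bad m n j r = {\<omega> \<in> space (M n). \<exists>k\<in>{?a..?b}. 2 * ?r < \<bar>\<Sum>i\<in>{?a<..k}. \<epsilon> n i \<omega>\<bar>}"
      by (simp add: block_bad_def)
    have "block_bad m n j r = (\<Union>k\<in>{?a..?b}. {\<omega> \<in> space (M n). 2 * ?r < \<bar>\<Sum>i\<in>{?a<..k}. \<epsilon> n i \<omega>\<bar>})"
      unfolding bad by blast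
    also have "\<dots> \<in> events"
    proof (intro sets.finite_UN finite_atLeastAtMost)
      fix k assume "k \<in> {?a..?b}"
      then have [measurable]: "(\<lambda>\<omega>. \<Sum>i\<in>{?a<..k}. \<epsilon> n i \<omega>) \<in> borel_measurable (M n)" by (intro sum_meas) simp
      show "{\<omega> \<in> space (M n). 2 * ?r < \<bar>\<Sum>i\<in>{?a<..k}. \<epsilon> n i \<omega>\<bar>} \<in> events" by measurable
    qed
    finally have bad_events: "block_bad m n j r \<in> events" .
    let ?E = "{\<omega> \<in> space (M n). ?r < \<bar>\<Sum>i\<in>{?a<..?b}. \<epsilon> n i \<omega>\<bar>}"
    have [measurable]: "(\<lambda>\<omega>. \<Sum>i\<in>{?a<..?b}. \<epsilon> n i \<omega>) \<in> borel_measurable (M n)" by (intro sum_meas) simp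
    have E: "?E \<in> events" by measurable
    have "prob (block_bad m n j r) \<le> 2 * prob ?E"
      unfolding bad using lo_hi(1)[OF j, of n] by (intro ottaviani_inequality[OF indep] half sub) auto
    also have "prob ?E = expectation (indicator ?E)" using E by simp
    also have "\<dots> \<le> expectation (\<lambda>\<omega>. f (block_sum m j n \<omega>))"
    proof (rule integral_mono)
      show "integrable (M n) (indicat_real ?E)"
        using E by (intro integrable_real_indicator) (auto simp: emeasure_eq_measure)
      have "block_sum m j n \<in> borel_measurable (M n)" unfolding block_sum_def[abs_def] by measurable
      then show "integrable (M n) (\<lambda>\<omega>. f (block_sum m j n \<omega>))"
        using f1 borel_measurable_continuous_on[OF f(1)] by (intro integrable_const_bound[where B = 1]) auto
      fix \<omega>
      show "indicat_real ?E \<omega> \<le> f (block_sum m j n \<omega>)"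
      proof (cases "\<omega> \<in> ?E")
        case True
        then have "r < \<bar>block_sum m j n \<omega>\<bar>" using n1 by (simp add: block_sum_def abs_divide less_divide_eq)
        then show ?thesis using f_gt by simp
      next
        case False
        then show ?thesis using f(2) by simp
      qed
    qed
    also have "\<dots> \<le> 4 / ((real m)\<^sup>2 * r ^ 4)" using elim(1) by simp
    finally show ?case using bad_events by simp
  qed
qed

text \<open>The tightness statement of the proof. The threshold for \<open>n\<close> may depend on
  \<open>m\<close>, because the bounds on the block events are obtained from a limit in
  \<open>n\<close> with \<open>m\<close> fixed.\<close>

lemma W_polygon_close:
  assumes e: "e > 0"
  shows "\<forall>\<^sub>F m in sequentially. \<forall>\<^sub>F n in sequentially. \<exists>E\<in>sets (M n). measure (M n) E \<le> e \<and>
    (\<forall>\<omega>\<in>space (M n) - E. \<forall>z. 0 \<le> z \<and> z \<le> 1 \<longrightarrow> \<bar>W n \<omega> z - polygon m (W n \<omega>) z\<bar> \<le> e)"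
proof -
  \<comment> \<open>Both the probability and the distance are split into halves: \<open>R\<close>
    makes the event for \<open>Q\<close> cost \<open>e / 2\<close> regardless of \<open>m\<close>,
    and \<open>r\<close> makes the distance for the plain partial sums \<open>e / 2\<close>. Large
    \<open>m\<close> then takes care of the two remaining halves.\<close>
  define R where "R = 8 / e"
  define r where "r = e / 8"
  have R: "R > 0" "4 / R = e / 2" and r: "r > 0" "2 * (2 * r) = e / 2" using e by (auto simp: R_def r_def)
  have "(\<lambda>m. 2 * sqrt (3 * R / sqrt (real m))) \<longlonglongrightarrow> 0" using R by real_asymp
  then have 1: "\<forall>\<^sub>F m in sequentially. 2 * sqrt (3 * R / sqrt (real m)) < e / 2" by (rule order_tendstoD) (use e in simp)
  have "(\<lambda>m. 8 / (real m * r ^ 4)) \<longlonglongrightarrow> 0" using r by real_asymp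
  then have 2: "\<forall>\<^sub>F m in sequentially. 8 / (real m * r ^ 4) < e / 2" by (rule order_tendstoD) (use e in simp)
  have "filterlim (\<lambda>m. real m * r\<^sup>2) at_top sequentially" using r by real_asymp
  then have 3: "\<forall>\<^sub>F m in sequentially. 8 \<le> real m * r\<^sup>2" by (simp add: filterlim_at_top)
  show ?thesis
    using 1 2 3 eventually_gt_at_top[of 0]
  proof eventually_elim
    case (elim m)
    have "\<forall>\<^sub>F n in sequentially. \<forall>j\<in>{..<m}. block_bad m n j r \<in> sets (M n) \<and>
        measure (M n) (block_bad m n j r) \<le> 8 / ((real m)\<^sup>2 * r ^ 4)"
      using block_bad_prob[OF _ r(1) elim(3)] by (intro eventually_ball_finite) auto
    then show ?case
      using eventually_ge_at_top[of 2]
    proof eventually_elim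
      case (elim n)
      interpret prob_space "M n" using elim by (intro prob_space_row) simp
      let ?Q = "{\<omega> \<in> space (M n). R * sqrt (real n - 1) < Q n \<omega>}"
      let ?E = "?Q \<union> (\<Union>j<m. block_bad m n j r)"
      have Q: "?Q \<in> events" "prob ?Q \<le> e / 2"
        using drift_exceptional_events[OF elim(2) R(1)] drift_exceptional_prob[OF elim(2) R(1)] R(2) by auto
      have blocks: "(\<Union>j<m. block_bad m n j r) \<in> events" using elim by auto
      have "prob (\<Union>j<m. block_bad m n j r) \<le> (\<Sum>j<m. prob (block_bad m n j r))"
        using elim by (intro finite_measure_subadditive_finite) auto
      also have "\<dots> \<le> (\<Sum>j<m. 8 / ((real m)\<^sup>2 * r ^ 4))" using elim by (intro sum_mono) auto
      also have "\<dots> = 8 / (real m * r ^ 4)" using \<open>m > 0\<close> by (simp add: power2_eq_square)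
      also have "\<dots> \<le> e / 2" using \<open>8 / (real m * r ^ 4) < e / 2\<close> by simp
      finally have "prob ?E \<le> e"
        using measure_Un_le[OF Q(1) blocks] Q(2) by linarith
      moreover have "?E \<in> events" using Q blocks by auto
      moreover have "\<bar>W n \<omega> z - polygon m (W n \<omega>) z\<bar> \<le> e" if \<omega>: "\<omega> \<in> space (M n) - ?E" and z: "0 \<le> z" "z \<le> 1" for \<omega> z
      proof -
        have "\<bar>D n \<omega> z - polygon m (D n \<omega>) z\<bar> \<le> 2 * sqrt (3 * R / sqrt (real m))"
          using \<omega> by (intro D_polygon_close elim \<open>m > 0\<close> z) auto
        moreover have "\<bar>U n \<omega> z - polygon m (U n \<omega>) z\<bar> \<le> 2 * (2 * r)"
          using \<omega> by (intro U_polygon_close elim \<open>m > 0\<close> z) auto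
        ultimately show ?thesis
          unfolding W_eq polygon_diff using r(2) \<open>2 * sqrt (3 * R / sqrt (real m)) < e / 2\<close> by linarith
      qed
      ultimately show ?case by blast
    qed
  qed
qed

end

subsection \<open>Weak convergence of the residual partial sums\<close>

lemma restrict_interp_in_C01: "(\<lambda>z\<in>{0..1}. interp m v z) \<in> mspace C01"
  by (rule restrict_in_C01[OF continuous_on_interp])

lemma interp_cong: "(\<And>j. j < m \<Longrightarrow> v j = w j) \<Longrightarrow> interp m v = interp m w"
  by (simp add: interp_def fun_eq_iff)

text \<open>Each ramp lies between 0 and 1, so the supremum distance of two interpolations is at
  most the sum of the coordinate distances. This turns a functional of paths into an admissible test
  function for the finite-dimensional limit.\<close>

lemma continuous_on_lipschitz_interp:
  fixes \<phi> :: "(real \<Rightarrow> real) \<Rightarrow> real"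
  assumes lip: "\<And>x y. x \<in> mspace C01 \<Longrightarrow> y \<in> mspace C01 \<Longrightarrow> \<bar>\<phi> x - \<phi> y\<bar> \<le> L * mdist C01 x y"
  shows "continuous_on UNIV (\<lambda>v. \<phi> (\<lambda>z\<in>{0..1}. interp m v z))"
proof -
  let ?f = "\<lambda>v. \<phi> (\<lambda>z\<in>{0..1}. interp m v z)"
  have bound: "\<bar>?f w - ?f v\<bar> \<le> \<bar>L\<bar> * (\<Sum>j<m. \<bar>w j - v j\<bar>)" for v w
  proof -
    have "\<bar>?f w - ?f v\<bar> \<le> L * mdist C01 (\<lambda>z\<in>{0..1}. interp m w z) (\<lambda>z\<in>{0..1}. interp m v z)"
      by (intro lip restrict_interp_in_C01)
    also have "\<dots> \<le> \<bar>L\<bar> * (\<Sum>j<m. \<bar>w j - v j\<bar>)"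
    proof (rule mult_mono)
      show "mdist C01 (\<lambda>z\<in>{0..1}. interp m w z) (\<lambda>z\<in>{0..1}. interp m v z) \<le> (\<Sum>j<m. \<bar>w j - v j\<bar>)"
      proof (rule C01_mdist_le)
        fix z :: real assume z: "0 \<le> z" "z \<le> 1"
        have "\<bar>interp m w z - interp m v z\<bar> \<le> (\<Sum>j<m. \<bar>(w j - v j) * ramp (real m * z - real j)\<bar>)"
          unfolding interp_diff[symmetric] unfolding interp_def by (rule sum_abs)
        also have "\<dots> \<le> (\<Sum>j<m. \<bar>w j - v j\<bar>)"
          by (intro sum_mono) (auto simp: abs_mult intro!: mult_left_le)
        finally show "\<bar>(\<lambda>z\<in>{0..1}. interp m w z) z - (\<lambda>z\<in>{0..1}. interp m v z) z\<bar> \<le> (\<Sum>j<m. \<bar>w j - v j\<bar>)"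
          using z by simp
      qed (auto intro: sum_nonneg)
    qed (auto intro: sum_nonneg)
    finally show ?thesis .
  qed
  have "(?f \<longlongrightarrow> ?f v) (at v)" for v
  proof (rule LIM_zero_cancel, rule Lim_null_comparison)
    show "\<forall>\<^sub>F w in at v. norm (?f w - ?f v) \<le> \<bar>L\<bar> * (\<Sum>j<m. \<bar>w j - v j\<bar>)"
      using bound by simp
    have "continuous_on UNIV (\<lambda>w :: nat \<Rightarrow> real. w j)" for j
      by (rule continuous_on_product_coordinates)
    then have "isCont (\<lambda>w :: nat \<Rightarrow> real. w j) v" for j
      using continuous_on_eq_continuous_at[OF open_UNIV] by blast
    then have "((\<lambda>w :: nat \<Rightarrow> real. w j) \<longlongrightarrow> v j) (at v)" for j
      by (simp add: isCont_def)
    then have "((\<lambda>w. \<bar>L\<bar> * (\<Sum>j<m. \<bar>w j - v j\<bar>)) \<longlongrightarrow> \<bar>L\<bar> * (\<Sum>j<m. \<bar>v j - v j\<bar>)) (at v)"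
      by (intro tendsto_intros)
    then show "((\<lambda>w. \<bar>L\<bar> * (\<Sum>j<m. \<bar>w j - v j\<bar>)) \<longlongrightarrow> 0) (at v)" by simp
  qed
  then show ?thesis by (simp add: continuous_on_def)
qed

section \<open>Brownian paths as random elements of the path space\<close>

context brownian
begin

lemma measurable_polygon_bm:
  assumes h: "continuous_on {0..1} h"
  shows "(\<lambda>\<omega>. \<lambda>z\<in>{0..1}. h z + polygon m (\<lambda>s. B s \<omega>) z) \<in> N \<rightarrow>\<^sub>M borel_metric C01"
proof -
  \<comment> \<open>Coordinate 0 carries the start value, which vanishes almost surely but perhaps
    not everywhere and so cannot be dropped from the path; the increments are shifted by
    one.\<close>
  let ?V = "\<lambda>j \<omega>. case j of 0 \<Rightarrow> B 0 \<omega> | Suc j \<Rightarrow> incr m j \<omega>"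
  let ?g = "\<lambda>j z. case j of 0 \<Rightarrow> 1 | Suc j \<Rightarrow> ramp (real m * z - real j)"
  have "(\<lambda>\<omega>. \<lambda>z\<in>{0..1}. h z + (\<Sum>j<Suc m. ?V j \<omega> * ?g j z)) \<in> N \<rightarrow>\<^sub>M borel_metric C01"
  proof (rule measurable_C01_combination[OF _ h])
    show "?V j \<in> borel_measurable N" if "j < Suc m" for j
      using that measurable_bm[of 0] measurable_incr by (cases j) auto
    show "continuous_on {0..1} (?g j)" for j
      by (cases j) (auto intro: continuous_on_ramp)
  qed
  then show ?thesis
    unfolding polygon_def interp_def by (simp add: sum.lessThan_Suc_shift del: sum.lessThan_Suc)
qed

lemma bm_path_in_C01:
  "continuous_on {0..1} h \<Longrightarrow> \<omega> \<in> space N \<Longrightarrow> (\<lambda>z\<in>{0..1}. h z + B z \<omega>) \<in> mspace C01"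
  by (intro restrict_in_C01 continuous_on_add continuous_bm)

lemma polygon_bm_tendsto:
  assumes "\<omega> \<in> space N"
  shows "(\<lambda>m. mdist C01 (\<lambda>z\<in>{0..1}. h z + polygon m (\<lambda>s. B s \<omega>) z) (\<lambda>z\<in>{0..1}. h z + B z \<omega>)) \<longlonglongrightarrow> 0"
proof (rule LIMSEQ_I)
  fix e :: real assume e: "e > 0"
  obtain m0 where m0: "\<And>m z. m \<ge> m0 \<Longrightarrow> 0 \<le> z \<Longrightarrow> z \<le> 1 \<Longrightarrow> \<bar>B z \<omega> - polygon m (\<lambda>s. B s \<omega>) z\<bar> \<le> e / 2"
    using polygon_tendsto[OF continuous_bm[OF assms], of "e / 2"] e by auto
  have "mdist C01 (\<lambda>z\<in>{0..1}. h z + polygon m (\<lambda>s. B s \<omega>) z) (\<lambda>z\<in>{0..1}. h z + B z \<omega>) \<le> e / 2" if "m \<ge> m0" for m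
    using m0[OF that] e by (intro C01_mdist_le) (auto simp: abs_minus_commute)
  then show "\<exists>m0. \<forall>m\<ge>m0. norm (mdist C01 (\<lambda>z\<in>{0..1}. h z + polygon m (\<lambda>s. B s \<omega>) z) (\<lambda>z\<in>{0..1}. h z + B z \<omega>) - 0) < e"
    using e by (intro exI[of _ m0]) force
qed

lemma measurable_bm_path:
  assumes h: "continuous_on {0..1} h"
  shows "(\<lambda>\<omega>. \<lambda>z\<in>{0..1}. h z + B z \<omega>) \<in> N \<rightarrow>\<^sub>M borel_metric C01"
  by (rule measurable_borel_metric_limit[OF measurable_polygon_bm[OF h] bm_path_in_C01[OF h] polygon_bm_tendsto])

lemma expectation_interp_bm_tendsto:
  fixes \<phi> :: "(real \<Rightarrow> real) \<Rightarrow> real"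
  assumes K: "\<And>x. x \<in> mspace C01 \<Longrightarrow> \<bar>\<phi> x\<bar> \<le> K"
    and lip: "\<And>x y. x \<in> mspace C01 \<Longrightarrow> y \<in> mspace C01 \<Longrightarrow> \<bar>\<phi> x - \<phi> y\<bar> \<le> L * mdist C01 x y"
  shows "(\<lambda>m. N.expectation (\<lambda>\<omega>. \<phi> (\<lambda>z\<in>{0..1}. interp m (\<lambda>j. incr m j \<omega>) z)))
    \<longlonglongrightarrow> N.expectation (\<lambda>\<omega>. \<phi> (\<lambda>z\<in>{0..1}. B z \<omega>))"
proof -
  have c0: "continuous_on {0..1} (\<lambda>_. 0 :: real)" by simp
  note cont = continuous_map_lipschitz[OF lip]
  let ?P = "\<lambda>m \<omega>. \<lambda>z\<in>{0..1}. polygon m (\<lambda>s. B s \<omega>) z"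
  have mP: "?P m \<in> N \<rightarrow>\<^sub>M borel_metric C01" for m using measurable_polygon_bm[OF c0] by simp
  have mB: "(\<lambda>\<omega>. \<lambda>z\<in>{0..1}. B z \<omega>) \<in> N \<rightarrow>\<^sub>M borel_metric C01" using measurable_bm_path[OF c0] by simp
  have "(\<lambda>m. N.expectation (\<lambda>\<omega>. \<phi> (?P m \<omega>))) \<longlonglongrightarrow> N.expectation (\<lambda>\<omega>. \<phi> (\<lambda>z\<in>{0..1}. B z \<omega>))"
  proof (rule integral_dominated_convergence[where w = "\<lambda>_. K"])
    show "(\<lambda>\<omega>. \<phi> (\<lambda>z\<in>{0..1}. B z \<omega>)) \<in> borel_measurable N"
      by (rule measurable_borel_metric_continuous[OF mB cont])
    show "(\<lambda>\<omega>. \<phi> (?P m \<omega>)) \<in> borel_measurable N" for m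
      by (rule measurable_borel_metric_continuous[OF mP cont])
    show "AE \<omega> in N. (\<lambda>m. \<phi> (?P m \<omega>)) \<longlonglongrightarrow> \<phi> (\<lambda>z\<in>{0..1}. B z \<omega>)"
    proof (rule AE_I2)
      fix \<omega> assume \<omega>: "\<omega> \<in> space N"
      show "(\<lambda>m. \<phi> (?P m \<omega>)) \<longlonglongrightarrow> \<phi> (\<lambda>z\<in>{0..1}. B z \<omega>)"
      proof (rule LIM_zero_cancel, rule Lim_null_comparison)
        show "\<forall>\<^sub>F m in sequentially. norm (\<phi> (?P m \<omega>) - \<phi> (\<lambda>z\<in>{0..1}. B z \<omega>)) \<le>
            L * mdist C01 (?P m \<omega>) (\<lambda>z\<in>{0..1}. B z \<omega>)"
          using lip[OF measurable_in_mspace[OF mP \<omega>] measurable_in_mspace[OF mB \<omega>]] by simp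
        show "(\<lambda>m. L * mdist C01 (?P m \<omega>) (\<lambda>z\<in>{0..1}. B z \<omega>)) \<longlonglongrightarrow> 0"
          using tendsto_mult_left[OF polygon_bm_tendsto[OF \<omega>, of "\<lambda>_. 0"], of L] by simp
      qed
    qed
    show "AE \<omega> in N. norm (\<phi> (?P m \<omega>)) \<le> K" for m
      using K[OF measurable_in_mspace[OF mP]] by (intro AE_I2) simp
  qed simp
  \<comment> \<open>The interpolated increments omit the start value, so they agree with the polygon
    only almost surely, and measurability has to be shown for both.\<close>
  moreover have "N.expectation (\<lambda>\<omega>. \<phi> (?P m \<omega>)) = N.expectation (\<lambda>\<omega>. \<phi> (\<lambda>z\<in>{0..1}. interp m (\<lambda>j. incr m j \<omega>) z))" for m
  proof (rule integral_cong_AE)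
    show "(\<lambda>\<omega>. \<phi> (?P m \<omega>)) \<in> borel_measurable N"
      by (rule measurable_borel_metric_continuous[OF mP cont])
    have "(\<lambda>\<omega>. \<lambda>z\<in>{0..1}. 0 + (\<Sum>j<m. incr m j \<omega> * ramp (real m * z - real j))) \<in> N \<rightarrow>\<^sub>M borel_metric C01"
      by (intro measurable_C01_combination c0 measurable_incr continuous_on_ramp)
    then show "(\<lambda>\<omega>. \<phi> (\<lambda>z\<in>{0..1}. interp m (\<lambda>j. incr m j \<omega>) z)) \<in> borel_measurable N"
      unfolding interp_def using measurable_borel_metric_continuous[OF _ cont] by simp
    show "AE \<omega> in N. \<phi> (?P m \<omega>) = \<phi> (\<lambda>z\<in>{0..1}. interp m (\<lambda>j. incr m j \<omega>) z)"
      using bm_0 by eventually_elim (simp add: polygon_def)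
  qed
  ultimately show ?thesis by simp
qed

end

section \<open>Convergence of the residual process without drift\<close>

context error_array_bm
begin

lemma measurable_W_plus:
  assumes n: "n \<ge> 1" and f: "continuous_on {0..1} f"
  shows "(\<lambda>\<omega>. \<lambda>z\<in>{0..1}. f z + W n \<omega> z) \<in> M n \<rightarrow>\<^sub>M borel_metric C01"
  unfolding W_def interp_def
proof (rule measurable_C01_combination[OF _ f])
  fix i assume "i < n - 1"
  then have "Suc i < n" by simp
  from measurable_residual[OF this]
  show "(\<lambda>\<omega>. residual (\<lambda>j. \<epsilon> n j \<omega>) (Suc i) / sqrt (real n - 1)) \<in> borel_measurable (M n)" by simp
qed (rule continuous_on_ramp)

text \<open>Three comparisons at one well chosen \<open>m\<close>: the path with its polygon, the
  polygon with the Brownian polygon through finite-dimensional convergence, and the Brownian polygon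
  with the Brownian path. Each costs at most \<open>r / 4\<close>.\<close>

lemma expectation_W_tendsto:
  fixes \<phi> :: "(real \<Rightarrow> real) \<Rightarrow> real"
  assumes K: "\<And>x. x \<in> mspace C01 \<Longrightarrow> \<bar>\<phi> x\<bar> \<le> K"
    and lip: "\<And>x y. x \<in> mspace C01 \<Longrightarrow> y \<in> mspace C01 \<Longrightarrow> \<bar>\<phi> x - \<phi> y\<bar> \<le> L * mdist C01 x y"
  shows "(\<lambda>n. \<integral>\<omega>. \<phi> (\<lambda>z\<in>{0..1}. W n \<omega> z) \<partial>M n) \<longlonglongrightarrow> N.expectation (\<lambda>\<omega>. \<phi> (\<lambda>z\<in>{0..1}. B z \<omega>))"
proof (rule LIMSEQ_I)
  fix r :: real assume r: "r > 0"
  have K0: "K \<ge> 0" using order_trans[OF abs_ge_zero K[OF restrict_interp_in_C01]] .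
  define A where "A = \<bar>L\<bar> + 2 * K + 1"
  have A: "A > 0" using K0 by (simp add: A_def)
  \<comment> \<open>Off the exceptional event the functional changes by at most
    \<open>\<bar>L\<bar> * e\<close>; on it, by at most \<open>2 * K\<close> with probability at
    most \<open>e\<close>. The choice keeps the sum of both within \<open>r / 4\<close>.\<close>
  define e where "e = r / (4 * A)"
  have e: "e > 0" using r A by (simp add: e_def)
  have eA: "\<bar>L\<bar> * e + 2 * K * e \<le> r / 4"
  proof -
    have "\<bar>L\<bar> * e + 2 * K * e \<le> A * e" using e by (simp add: A_def algebra_simps)
    also have "\<dots> = r / 4" using A by (simp add: e_def)
    finally show ?thesis .
  qed
  define \<psi> where "\<psi> m v = \<phi> (\<lambda>z\<in>{0..1}. interp m v z)" for m v
  have \<psi>K: "\<bar>\<psi> m v\<bar> \<le> K" for m v unfolding \<psi>_def by (rule K[OF restrict_interp_in_C01])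
  have \<psi>if: "\<psi> m (\<lambda>j. if j < m then v j else 0) = \<psi> m v" for m v
    unfolding \<psi>_def by (subst interp_cong[of m _ v]) auto
  have \<psi>c: "continuous_on UNIV (\<psi> m)" for m
    unfolding \<psi>_def using continuous_on_lipschitz_interp[OF lip] .
  have "\<forall>\<^sub>F m in sequentially.
      dist (N.expectation (\<lambda>\<omega>. \<psi> m (\<lambda>j. incr m j \<omega>))) (N.expectation (\<lambda>\<omega>. \<phi> (\<lambda>z\<in>{0..1}. B z \<omega>))) < r / 4"
    using tendstoD[OF expectation_interp_bm_tendsto[OF K lip], of "r / 4"] r unfolding \<psi>_def by simp
  from eventually_happens'[OF sequentially_bot
      eventually_conj[OF eventually_conj[OF this W_polygon_close[OF e]] eventually_gt_at_top[of 0]]]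
  obtain m where m: "m > 0"
    "\<bar>N.expectation (\<lambda>\<omega>. \<psi> m (\<lambda>j. incr m j \<omega>)) - N.expectation (\<lambda>\<omega>. \<phi> (\<lambda>z\<in>{0..1}. B z \<omega>))\<bar> < r / 4"
    and close: "\<forall>\<^sub>F n in sequentially. \<exists>E\<in>sets (M n). measure (M n) E \<le> e \<and>
      (\<forall>\<omega>\<in>space (M n) - E. \<forall>z. 0 \<le> z \<and> z \<le> 1 \<longrightarrow> \<bar>W n \<omega> z - polygon m (W n \<omega>) z\<bar> \<le> e)"
    unfolding dist_real_def by blast
  have "(\<lambda>n. \<integral>\<omega>. \<psi> m (\<lambda>j. increments m (W n \<omega>) j) \<partial>M n) \<longlonglongrightarrow> N.expectation (\<lambda>\<omega>. \<psi> m (\<lambda>j. incr m j \<omega>))"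
    using finite_dimensional_convergence_W[OF m(1) \<psi>c \<psi>K, of m] unfolding \<psi>if .
  from tendstoD[OF this, of "r / 4"] r have
    "\<forall>\<^sub>F n in sequentially. \<bar>(\<integral>\<omega>. \<psi> m (\<lambda>j. increments m (W n \<omega>) j) \<partial>M n) - N.expectation (\<lambda>\<omega>. \<psi> m (\<lambda>j. incr m j \<omega>))\<bar> < r / 4"
    by (simp add: dist_real_def)
  then have "\<forall>\<^sub>F n in sequentially.
      norm ((\<integral>\<omega>. \<phi> (\<lambda>z\<in>{0..1}. W n \<omega> z) \<partial>M n) - N.expectation (\<lambda>\<omega>. \<phi> (\<lambda>z\<in>{0..1}. B z \<omega>))) < r"
    using close eventually_ge_at_top[of 1]
  proof eventually_elim
    case (elim n)
    interpret prob_space "M n" using elim by (intro prob_space_row) simp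
    obtain E where E: "E \<in> events" "prob E \<le> e"
      "\<And>\<omega> z. \<omega> \<in> space (M n) - E \<Longrightarrow> 0 \<le> z \<Longrightarrow> z \<le> 1 \<Longrightarrow> \<bar>W n \<omega> z - polygon m (W n \<omega>) z\<bar> \<le> e"
      using elim(2) by blast
    note cont = continuous_map_lipschitz[OF lip]
    have WC: "(\<lambda>z\<in>{0..1}. W n \<omega> z) \<in> mspace C01" for \<omega>
      unfolding W_def by (rule restrict_interp_in_C01)
    have mW: "(\<lambda>\<omega>. \<lambda>z\<in>{0..1}. W n \<omega> z) \<in> M n \<rightarrow>\<^sub>M borel_metric C01"
      using measurable_W_plus[OF elim(3), of "\<lambda>_. 0"] by simp
    have mI: "(\<lambda>\<omega>. \<lambda>z\<in>{0..1}. interp m (increments m (W n \<omega>)) z) \<in> M n \<rightarrow>\<^sub>M borel_metric C01"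
    proof -
      have "(\<lambda>\<omega>. \<lambda>z\<in>{0..1}. 0 + (\<Sum>j<m. increments m (W n \<omega>) j * ramp (real m * z - real j))) \<in> M n \<rightarrow>\<^sub>M borel_metric C01"
        unfolding increments_W by (intro measurable_C01_combination measurable_residual_sum continuous_on_ramp) auto
      then show ?thesis unfolding interp_def by simp
    qed
    have "\<bar>(\<integral>\<omega>. \<phi> (\<lambda>z\<in>{0..1}. W n \<omega> z) \<partial>M n) - (\<integral>\<omega>. \<psi> m (\<lambda>j. increments m (W n \<omega>) j) \<partial>M n)\<bar> \<le> \<bar>L\<bar> * e + 2 * K * e"
    proof (rule expectation_diff_le[OF _ _ E(1,2)])
      show "integrable (M n) (\<lambda>\<omega>. \<phi> (\<lambda>z\<in>{0..1}. W n \<omega> z))"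
        by (rule integrable_bounded_borel_metric[OF prob_space_axioms mW cont K])
      show "integrable (M n) (\<lambda>\<omega>. \<psi> m (\<lambda>j. increments m (W n \<omega>) j))"
        unfolding \<psi>_def by (rule integrable_bounded_borel_metric[OF prob_space_axioms mI cont K])
      show "\<bar>\<phi> (\<lambda>z\<in>{0..1}. W n \<omega> z) - \<psi> m (\<lambda>j. increments m (W n \<omega>) j)\<bar> \<le> \<bar>L\<bar> * e" if \<omega>: "\<omega> \<in> space (M n) - E" for \<omega>
      proof -
        \<comment> \<open>Since the process starts at 0, its polygon is exactly the interpolation of
          its increments.\<close>
        have "W n \<omega> 0 = 0" by (simp add: W_def)
        then have "interp m (increments m (W n \<omega>)) = polygon m (W n \<omega>)" by (simp add: polygon_def fun_eq_iff)
        then have "mdist C01 (\<lambda>z\<in>{0..1}. W n \<omega> z) (\<lambda>z\<in>{0..1}. interp m (increments m (W n \<omega>)) z) \<le> e"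
          using E(3)[OF \<omega>] e by (intro C01_mdist_le) auto
        then have "L * mdist C01 (\<lambda>z\<in>{0..1}. W n \<omega> z) (\<lambda>z\<in>{0..1}. interp m (increments m (W n \<omega>)) z) \<le> \<bar>L\<bar> * e"
          by (intro mult_mono) auto
        then show ?thesis using lip[OF WC restrict_interp_in_C01] unfolding \<psi>_def by (rule order_trans[rotated])
      qed
      show "\<bar>\<phi> (\<lambda>z\<in>{0..1}. W n \<omega> z) - \<psi> m (\<lambda>j. increments m (W n \<omega>) j)\<bar> \<le> 2 * K" for \<omega>
        using K[OF WC[of \<omega>]] \<psi>K[of m "\<lambda>j. increments m (W n \<omega>) j"] by linarith
    qed (use e K0 in auto)
    then show ?case using eA elim(1) m(2) r unfolding real_norm_def by linarith
  qed
  then show "\<exists>n0. \<forall>n\<ge>n0. norm ((\<integral>\<omega>. \<phi> (\<lambda>z\<in>{0..1}. W n \<omega> z) \<partial>M n) - N.expectation (\<lambda>\<omega>. \<phi> (\<lambda>z\<in>{0..1}. B z \<omega>))) < r"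
    unfolding eventually_sequentially .
qed

end

subsection \<open>The drift under the local alternative\<close>

lemma residual_linear:
  assumes "\<And>j. 1 \<le> j \<Longrightarrow> j \<le> Suc k \<Longrightarrow> y j = c * g j + e j"
  shows "residual y k = c * residual g k + residual e k"
proof -
  have "(\<Sum>j=1..k. y j) = c * (\<Sum>j=1..k. g j) + (\<Sum>j=1..k. e j)"
    using assms by (simp add: sum_distrib_left flip: sum.distrib)
  then show ?thesis using assms[of "Suc k"] by (simp add: residual_def add_divide_distrib diff_divide_distrib algebra_simps)
qed

text \<open>Both \<open>1 / sqrt (k * (k + 1))\<close> and \<open>ln (k + 1) - ln k\<close> lie between \<open>1 / (k + 1)\<close> and \<open>1 / k\<close>,
  so the errors telescope.\<close>

lemma sum_inverse_geometric_mean: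
  assumes "1 \<le> k" "k \<le> p"
  shows "\<bar>(\<Sum>i=k..<p. 1 / sqrt (real i * real (Suc i))) - ln (real p / real k)\<bar> \<le> 1 / real k - 1 / real p"
  using assms(2)
proof (induction p rule: dec_induct)
  case base
  then show ?case using assms by simp
next
  case (step p)
  have p: "real p > 0" using assms step by simp
  have le: "real p * real p \<le> real p * real (Suc p)" "real p * real (Suc p) \<le> real (Suc p) * real (Suc p)"
    by (intro mult_left_mono mult_right_mono; simp)+
  have a: "real p \<le> sqrt (real p * real (Suc p))" "sqrt (real p * real (Suc p)) \<le> real (Suc p)"
    using real_sqrt_le_mono[OF le(1)] real_sqrt_le_mono[OF le(2)] by simp_all
  have b: "1 / real (Suc p) \<le> 1 / sqrt (real p * real (Suc p))" "1 / sqrt (real p * real (Suc p)) \<le> 1 / real p"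
    using a p by (auto intro!: divide_left_mono mult_pos_pos)
  have c: "ln (real (Suc p) / real p) \<le> 1 / real p"
    using ln_le_minus_one[of "real (Suc p) / real p"] p by (simp add: field_simps)
  \<comment> \<open>The lower bound for the logarithm is the upper bound
    \<open>ln x \<le> x - 1\<close> applied to the reciprocal.\<close>
  have "ln (real p / real (Suc p)) \<le> real p / real (Suc p) - 1"
    using p by (intro ln_le_minus_one) simp
  moreover have "real p / real (Suc p) - 1 = - (1 / real (Suc p))" by (simp add: field_simps)
  moreover have "ln (real p / real (Suc p)) = - ln (real (Suc p) / real p)" using p by (simp add: ln_div)
  ultimately have d: "1 / real (Suc p) \<le> ln (real (Suc p) / real p)" by linarith
  have "ln (real (Suc p) / real k) = ln (real p / real k) + ln (real (Suc p) / real p)"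
    using p assms by (simp add: ln_div)
  moreover have "(\<Sum>i=k..<Suc p. 1 / sqrt (real i * real (Suc i))) =
      (\<Sum>i=k..<p. 1 / sqrt (real i * real (Suc i))) + 1 / sqrt (real p * real (Suc p))"
    using step.hyps by simp
  ultimately show ?case using step.IH b c d by linarith
qed

text \<open>For \<open>k < K\<close> observation \<open>k + 1\<close> still precedes the jump and
  equals the mean of its predecessors. Afterwards that mean differs from the new level by
  \<open>K * (c\<^sub>0 - c\<^sub>1) / k\<close>, and the normalisation turns the denominator
  \<open>k\<close> into \<open>sqrt (k * (k + 1))\<close>.\<close>

lemma residual_step_function:
  assumes g: "\<And>j. 1 \<le> j \<Longrightarrow> j \<le> Suc k \<Longrightarrow> g j = (if j \<le> K then c\<^sub>0 else c\<^sub>1)" and k: "1 \<le> k"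
  shows "residual g k = (if k < K then 0 else real K * (c\<^sub>1 - c\<^sub>0) / sqrt (real k * real (Suc k)))"
proof (cases "k < K")
  case True
  then show ?thesis using g k by (simp add: residual_def)
next
  case False
  have "(\<Sum>j=1..k. g j) = (\<Sum>j=1..k. if j \<in> {1..K} then c\<^sub>0 else c\<^sub>1)"
    using g by (intro sum.cong) auto
  also have "\<dots> = real (card ({1..k} \<inter> {1..K})) * c\<^sub>0 + real (card ({1..k} - {1..K})) * c\<^sub>1"
    by (simp only: sum.If_cases[OF finite_atLeastAtMost] Collect_mem_eq sum_constant Diff_eq)
  also have "\<dots> = real (card {1..K}) * c\<^sub>0 + real (card {Suc K..k}) * c\<^sub>1"
  proof -
    have "{1..k} \<inter> {1..K} = {1..K}" "{1..k} - {1..K} = {Suc K..k}" using False by auto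
    then show ?thesis by (simp only:)
  qed
  finally have S: "(\<Sum>j=1..k. g j) = real K * c\<^sub>0 + (real k - real K) * c\<^sub>1"
    using False by (simp add: of_nat_diff)
  have gk: "g (Suc k) = c\<^sub>1" using g[of "Suc k"] False by simp
  have kp: "real k > 0" using k by simp
  have "residual g k = (real K * (c\<^sub>1 - c\<^sub>0) / real k) / sqrt (1 + 1 / real k)"
    unfolding residual_def S gk using kp by (simp add: field_simps)
  also have "\<dots> = real K * (c\<^sub>1 - c\<^sub>0) / (real k * sqrt (1 + 1 / real k))" by simp
  also have "real k * sqrt (1 + 1 / real k) = sqrt ((real k)\<^sup>2 * (1 + 1 / real k))"
    using kp by (simp add: real_sqrt_mult)
  also have "(real k)\<^sup>2 * (1 + 1 / real k) = real k * real (Suc k)"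
    using kp by (simp add: field_simps power2_eq_square)
  finally show ?thesis using False by simp
qed

text \<open>The error of the logarithmic approximation is at most \<open>1 / K\<close> before and
  hence at most 1 after multiplication by \<open>K\<close>, so both bounds are uniform in
  \<open>p\<close> and \<open>n\<close> and vanish after division by \<open>n - 1\<close>. The
  maximum covers the range before the jump, where the logarithm is 0.\<close>

lemma residual_step_function_bounds:
  assumes g: "\<And>j. 1 \<le> j \<Longrightarrow> j \<le> n \<Longrightarrow> g j = (if j \<le> K then c\<^sub>0 else c\<^sub>1)" and K: "1 \<le> K"
  shows "k < n \<Longrightarrow> 1 \<le> k \<Longrightarrow> \<bar>residual g k\<bar> \<le> \<bar>c\<^sub>1 - c\<^sub>0\<bar>"
    and "p < n \<Longrightarrow> \<bar>(\<Sum>i<p. residual g (Suc i)) - real K * (c\<^sub>1 - c\<^sub>0) * ln (max (real (Suc p)) (real K) / real K)\<bar> \<le> \<bar>c\<^sub>1 - c\<^sub>0\<bar>"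
proof -
  have res: "residual g k = (if k < K then 0 else real K * (c\<^sub>1 - c\<^sub>0) / sqrt (real k * real (Suc k)))"
    if "1 \<le> k" "k < n" for k
    using that by (intro residual_step_function g) auto
  show "\<bar>residual g k\<bar> \<le> \<bar>c\<^sub>1 - c\<^sub>0\<bar>" if k: "k < n" "1 \<le> k"
  proof (cases "k < K")
    case False
    have "real K * real K \<le> real k * real (Suc k)" using False by (intro mult_mono) auto
    then have "real K \<le> sqrt (real k * real (Suc k))" using real_sqrt_le_mono by fastforce
    then have "real K * \<bar>c\<^sub>1 - c\<^sub>0\<bar> \<le> sqrt (real k * real (Suc k)) * \<bar>c\<^sub>1 - c\<^sub>0\<bar>" by (intro mult_right_mono) auto
    then show ?thesis using False k res[of k] by (simp add: abs_mult divide_le_eq mult.commute)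
  qed (use k res[of k] in simp)
  show "\<bar>(\<Sum>i<p. residual g (Suc i)) - real K * (c\<^sub>1 - c\<^sub>0) * ln (max (real (Suc p)) (real K) / real K)\<bar> \<le> \<bar>c\<^sub>1 - c\<^sub>0\<bar>"
    if p: "p < n"
  proof -
    have "(\<Sum>i<p. residual g (Suc i)) = (\<Sum>k=1..<Suc p. residual g k)"
      unfolding One_nat_def sum.atLeast_Suc_lessThan_Suc_shift by (simp add: lessThan_atLeast0)
    also have "\<dots> = (\<Sum>k=1..<Suc p. if k < K then 0 else real K * (c\<^sub>1 - c\<^sub>0) / sqrt (real k * real (Suc k)))"
      using p by (intro sum.cong refl res) auto
    also have "\<dots> = (\<Sum>k=K..<Suc p. real K * (c\<^sub>1 - c\<^sub>0) * (1 / sqrt (real k * real (Suc k))))"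
      using K by (intro sum.mono_neutral_cong_right) auto
    finally have S: "(\<Sum>i<p. residual g (Suc i)) = real K * (c\<^sub>1 - c\<^sub>0) * (\<Sum>k=K..<Suc p. 1 / sqrt (real k * real (Suc k)))"
      by (simp only: sum_distrib_left)
    show ?thesis
    proof (cases "K \<le> Suc p")
      case True
      have "\<bar>(\<Sum>k=K..<Suc p. 1 / sqrt (real k * real (Suc k))) - ln (real (Suc p) / real K)\<bar> \<le> 1 / real K - 1 / real (Suc p)"
        by (rule sum_inverse_geometric_mean[OF K True])
      also have "\<dots> \<le> 1 / real K" by simp
      finally have "real K * \<bar>c\<^sub>1 - c\<^sub>0\<bar> * \<bar>(\<Sum>k=K..<Suc p. 1 / sqrt (real k * real (Suc k))) - ln (real (Suc p) / real K)\<bar>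
          \<le> real K * \<bar>c\<^sub>1 - c\<^sub>0\<bar> * (1 / real K)"
        by (intro mult_left_mono) auto
      moreover have "max (real (Suc p)) (real K) = real (Suc p)" using True by simp
      ultimately show ?thesis
        unfolding S using K by (simp only: right_diff_distrib[symmetric] abs_mult) simp
    next
      case False
      then show ?thesis unfolding S using K by simp
    qed
  qed
qed

text \<open>With the maximum in place of the indicator, continuity at \<open>q\<close> is visible
  and the limit has the same shape as the discrete sums.\<close>

lemma limit_drift_eq:
  assumes "0 < q" "0 \<le> z" "z \<le> 1"
  shows "limit_drift q c\<^sub>0 c\<^sub>1 z = (c\<^sub>1 - c\<^sub>0) * (q * ln (max z q / q))"
  using assms by (cases "q < z") (auto simp: limit_drift_def ln_div)

lemma continuous_on_limit_drift:
  assumes "0 < q"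
  shows "continuous_on {0..1} (limit_drift q c\<^sub>0 c\<^sub>1)"
proof -
  have "continuous_on {0..1} (\<lambda>z. (c\<^sub>1 - c\<^sub>0) * (q * ln (max z q / q)))"
    using assms by (intro continuous_intros) (auto simp: max_def)
  then show ?thesis
    by (rule continuous_on_cong[THEN iffD1, rotated -1]) (use limit_drift_eq[OF assms] in auto)
qed

text \<open>Uniformity in \<open>z\<close> comes from uniform continuity of one function of two
  variables on a compact rectangle, which absorbs both the rounding of \<open>z\<close> and the
  convergence of the jump position.\<close>

lemma drift_tendsto:
  fixes g :: "nat \<Rightarrow> nat \<Rightarrow> real" and K :: "nat \<Rightarrow> nat"
  assumes g: "\<And>n j. 1 \<le> j \<Longrightarrow> j \<le> n \<Longrightarrow> g n j = (if j \<le> K n then c\<^sub>0 else c\<^sub>1)"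
    and K: "(\<lambda>n. real (K n) / real n) \<longlonglongrightarrow> q" and q: "0 < q" "q < 1" and e: "e > 0"
  shows "\<forall>\<^sub>F n in sequentially. \<forall>z. 0 \<le> z \<and> z \<le> 1 \<longrightarrow>
    \<bar>interp (n - 1) (\<lambda>i. residual (g n) (Suc i) / (real n - 1)) z - limit_drift q c\<^sub>0 c\<^sub>1 z\<bar> \<le> e"
proof -
  define c where "c = \<bar>c\<^sub>1 - c\<^sub>0\<bar>"
  \<comment> \<open>The arguments are the current position and the jump position: the discrete drift
    is compared with \<open>F\<close> at \<open>((p + 1) / (n - 1), K n / (n - 1))\<close>, and the
    limit is \<open>F\<close> at \<open>(z, q)\<close>. The lower bound \<open>q / 2\<close> keeps
    the denominator away from 0, and the upper bound 2 leaves room for positions that rounding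
    pushes beyond 1.\<close>
  define F where "F = (\<lambda>(u, \<kappa>). \<kappa> * ln (max u \<kappa> / \<kappa>) :: real)"
  have "continuous_on ({0..2} \<times> {q/2..2}) F"
    unfolding F_def case_prod_beta using q
    by (intro continuous_intros) (auto simp: max_def divide_eq_0_iff)
  then have "uniformly_continuous_on ({0..2} \<times> {q/2..2}) F"
    by (intro compact_uniformly_continuous compact_Times) auto
  moreover have "e / (2 * (c + 1)) > 0" using e by (simp add: c_def add_nonneg_pos)
  ultimately obtain d where d: "d > 0" and dF:
    "\<And>x y. x \<in> {0..2} \<times> {q/2..2} \<Longrightarrow> y \<in> {0..2} \<times> {q/2..2} \<Longrightarrow> dist y x < d \<Longrightarrow> dist (F y) (F x) < e / (2 * (c + 1))"
    by (rule uniformly_continuous_onE) (rule that)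
  have "(\<lambda>n. real (K n) / real n * (real n / (real n - 1))) \<longlonglongrightarrow> q * 1"
  proof (rule tendsto_mult[OF K])
    show "(\<lambda>n. real n / (real n - 1)) \<longlonglongrightarrow> 1" by real_asymp
  qed
  moreover have "\<forall>\<^sub>F n in sequentially. real (K n) / real n * (real n / (real n - 1)) = real (K n) / (real n - 1)"
    using eventually_gt_at_top[of 0] by eventually_elim simp
  ultimately have \<kappa>: "(\<lambda>n. real (K n) / (real n - 1)) \<longlonglongrightarrow> q"
    by (simp add: Lim_transform_eventually)
  have 1: "\<forall>\<^sub>F n in sequentially. dist (real (K n) / (real n - 1)) q < min (d / 2) (q / 2)"
    using tendstoD[OF \<kappa>, of "min (d / 2) (q / 2)"] d q by simp
  have "(\<lambda>n. 2 * c / (real n - 1)) \<longlonglongrightarrow> 0" by real_asymp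
  then have 2: "\<forall>\<^sub>F n in sequentially. 2 * c / (real n - 1) < e / 2"
    by (rule order_tendstoD) (use e in simp)
  have "(\<lambda>n. 1 / (real n - 1)) \<longlonglongrightarrow> 0" by real_asymp
  then have 3: "\<forall>\<^sub>F n in sequentially. 1 / (real n - 1) < min 1 (d / 2)"
    by (rule order_tendstoD) (use d in simp)
  show ?thesis
    using 1 2 3 eventually_ge_at_top[of 2]
  proof eventually_elim
    case (elim n)
    have n1: "real n - 1 > 0" "real (n - 1) = real n - 1" using elim by (auto simp: of_nat_diff)
    define k where "k = real (K n) / (real n - 1)"
    have k: "\<bar>k - q\<bar> < d / 2" "\<bar>k - q\<bar> < q / 2" using elim(1) by (auto simp: k_def dist_real_def)
    then have kq: "q / 2 < k" "k < 2" using q by linarith+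
    then have K1: "1 \<le> K n" using n1 q by (cases "K n") (auto simp: k_def)
    have Kk: "real (K n) = k * (real n - 1)" using n1 by (simp add: k_def)
    note bounds = residual_step_function_bounds[where g = "g n" and n = n, OF g K1]
    show ?case
    proof (intro allI impI, elim conjE)
      fix z :: real assume z: "0 \<le> z" "z \<le> 1"
      define x where "x = real (n - 1) * z"
      define p where "p = nat \<lfloor>x\<rfloor>"
      have x0: "0 \<le> x" using z by (simp add: x_def)
      have xn: "x \<le> real (n - 1)" using mult_left_mono[OF z(2), of "real (n - 1)"] by (simp add: x_def)
      have p: "real p \<le> x" "x < real p + 1" "x - real p = frac x" using x0 by (auto simp: p_def frac_def)
      have pn: "p < n" using p(1) xn elim by linarith
      define H where "H = (\<Sum>i<p. residual (g n) (Suc i))"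
      have eq: "interp (n - 1) (\<lambda>i. residual (g n) (Suc i) / (real n - 1)) z = (H + frac x * residual (g n) (Suc p)) / (real n - 1)"
        unfolding interp_eq_floor[OF z] x_def[symmetric] p_def[symmetric] H_def
        by (simp add: sum_divide_distrib add_divide_distrib)
      have fr: "\<bar>frac x * residual (g n) (Suc p)\<bar> \<le> c"
      proof (cases "Suc p < n")
        case True
        have "\<bar>frac x\<bar> * \<bar>residual (g n) (Suc p)\<bar> \<le> 1 * \<bar>c\<^sub>1 - c\<^sub>0\<bar>"
          using bounds(1)[OF _ _ True] frac_lt_1[of x] by (intro mult_mono) (auto simp: less_imp_le)
        then show ?thesis by (simp add: abs_mult c_def)
      next
        \<comment> \<open>The residual bound does not reach this index beyond the row, but the
          fractional part in front of it is 0.\<close>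
        case False
        then have "real p = real (n - 1)" using pn by simp
        then have "frac x = 0" using p xn by linarith
        then have "frac x * residual (g n) (Suc p) = 0" by (simp only: mult_zero_left)
        then show ?thesis by (simp only: c_def abs_zero abs_ge_zero)
      qed
      define u where "u = real (Suc p) / (real n - 1)"
      have mx: "max (real (Suc p)) (real (K n)) / real (K n) = max u k / k"
        unfolding u_def Kk using n1 by (simp add: max_divide_distrib_right max_mult_distrib_right field_simps max_def)
      have "\<bar>H - real (K n) * (c\<^sub>1 - c\<^sub>0) * ln (max u k / k)\<bar> \<le> c"
        using bounds(2)[OF _ _ pn] unfolding H_def mx c_def by simp
      then have "\<bar>(H + frac x * residual (g n) (Suc p)) - (real n - 1) * ((c\<^sub>1 - c\<^sub>0) * F (u, k))\<bar> \<le> 2 * c"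
        using fr unfolding F_def Kk by (simp add: mult_ac)
      then have "\<bar>(H + frac x * residual (g n) (Suc p)) / (real n - 1) - (c\<^sub>1 - c\<^sub>0) * F (u, k)\<bar> \<le> 2 * c / (real n - 1)"
      proof -
        have "a / y - b = (a - y * b) / y" if "y > 0" for a b y :: real using that by (simp add: diff_divide_distrib)
        from this[OF n1(1)] show ?thesis
          using \<open>\<bar>(H + frac x * residual (g n) (Suc p)) - (real n - 1) * ((c\<^sub>1 - c\<^sub>0) * F (u, k))\<bar> \<le> 2 * c\<close> n1
          by (simp add: abs_divide divide_right_mono)
      qed
      moreover have "\<bar>(c\<^sub>1 - c\<^sub>0) * F (u, k) - limit_drift q c\<^sub>0 c\<^sub>1 z\<bar> \<le> e / 2"
      proof -
        have zx: "z = x / (real n - 1)" using n1 by (simp add: x_def)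
        have "u - z = (real p + 1 - x) / (real n - 1)" unfolding u_def zx by (simp add: diff_divide_distrib add_divide_distrib)
        moreover have "0 \<le> (real p + 1 - x) / (real n - 1)" "(real p + 1 - x) / (real n - 1) \<le> 1 / (real n - 1)"
          using p n1 by (auto intro!: divide_right_mono)
        moreover have "1 / (real n - 1) < d / 2" "1 / (real n - 1) < 1"
          using elim(3) unfolding min_less_iff_conj by blast+
        ultimately have uz: "0 \<le> u - z" "u - z < d / 2" "u - z < 1" by linarith+
        have "dist (u, k) (z, q) \<le> dist u z + dist k q"
          unfolding dist_prod_def by (simp add: sqrt_sum_squares_le_sum)
        also have "\<dots> < d" using uz k by (simp add: dist_real_def)
        finally have "dist (F (u, k)) (F (z, q)) < e / (2 * (c + 1))"
          using uz kq z q by (intro dF) auto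
        then have "c * \<bar>F (u, k) - F (z, q)\<bar> \<le> c * (e / (2 * (c + 1)))"
          by (intro mult_left_mono) (auto simp: dist_real_def c_def)
        also have "\<dots> = e / 2 * (c / (c + 1))" by simp
        also have "\<dots> \<le> e / 2"
          using e by (intro mult_left_le) (auto simp: c_def divide_le_eq_1)
        finally have "c * \<bar>F (u, k) - F (z, q)\<bar> \<le> e / 2" .
        moreover have "limit_drift q c\<^sub>0 c\<^sub>1 z = (c\<^sub>1 - c\<^sub>0) * F (z, q)"
          using limit_drift_eq[OF q(1) z] by (simp add: F_def)
        ultimately show ?thesis by (simp add: c_def abs_mult flip: right_diff_distrib)
      qed
      ultimately show "\<bar>interp (n - 1) (\<lambda>i. residual (g n) (Suc i) / (real n - 1)) z - limit_drift q c\<^sub>0 c\<^sub>1 z\<bar> \<le> e"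
        unfolding eq using elim(2) by linarith
    qed
  qed
qed

text \<open>In an identically distributed row all truncated second moments coincide, so the average
  in Lindeberg's condition already bounds each of them.\<close>

lemma iid_row_error_array:
  assumes P: "\<And>n. 1 \<le> n \<Longrightarrow> prob_space (M n)"
    and iid: "\<And>n. 1 \<le> n \<Longrightarrow> iid_row (M n) n (\<epsilon> n)"
    and int: "\<And>n i. 1 \<le> i \<Longrightarrow> i \<le> n \<Longrightarrow> integrable (M n) (\<epsilon> n i)"
    and mean: "\<And>n i. 1 \<le> i \<Longrightarrow> i \<le> n \<Longrightarrow> prob_space.expectation (M n) (\<epsilon> n i) = 0"
    and var: "\<And>n i. 1 \<le> i \<Longrightarrow> i \<le> n \<Longrightarrow> prob_space.variance (M n) (\<epsilon> n i) = 1"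
    and lind: "lindeberg M \<epsilon>"
  shows "error_array M \<epsilon>"
proof (rule error_array.intro)
  fix n :: nat assume n: "n \<ge> 1"
  interpret prob_space "M n" by (rule P[OF n])
  show "error_row (M n) n (\<epsilon> n)"
  proof
    show "indep_vars (\<lambda>_. borel) (\<epsilon> n) {1..n}" using iid[OF n] by (simp add: iid_row_def)
    fix i assume i: "i \<in> {1..n}"
    show "integrable (M n) (\<epsilon> n i)" "expectation (\<epsilon> n i) = 0" using i int mean by auto
    then show sq: "expectation (\<lambda>\<omega>. (\<epsilon> n i \<omega>)\<^sup>2) = 1" using i var[of i n] by simp
    \<comment> \<open>The integral of a non-integrable function is 0 by convention, so the value 1
      forces integrability.\<close>
    then show "integrable (M n) (\<lambda>\<omega>. (\<epsilon> n i \<omega>)\<^sup>2)" using not_integrable_integral_eq by fastforce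
  qed
next
  fix \<delta> :: real assume \<delta>: "\<delta> > 0"
  let ?g = "\<lambda>n x::real. x\<^sup>2 * indicator {x. \<delta> * sqrt (real n) < \<bar>x\<bar>} x"
  define v where "v n = (\<Sum>i=1..n. \<integral>\<omega>. ?g n (\<epsilon> n i \<omega>) \<partial>M n) / real n" for n
  have "v \<longlonglongrightarrow> 0" unfolding v_def using lind \<delta> unfolding lindeberg_def by blast
  moreover have "(\<integral>\<omega>. ?g n (\<epsilon> n i \<omega>) \<partial>M n) \<le> v n" if n: "n \<ge> 1" and i: "i \<in> {1..n}" for n i
  proof -
    have law: "(\<integral>x. ?g n x \<partial>distr (M n) borel (\<epsilon> n j)) = (\<integral>\<omega>. ?g n (\<epsilon> n j \<omega>) \<partial>M n)" if "j \<in> {1..n}" for j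
      using int[of j n] that by (intro integral_distr) auto
    have "(\<integral>\<omega>. ?g n (\<epsilon> n j \<omega>) \<partial>M n) = (\<integral>\<omega>. ?g n (\<epsilon> n i \<omega>) \<partial>M n)" if "j \<in> {1..n}" for j
    proof -
      have "distr (M n) borel (\<epsilon> n j) = distr (M n) borel (\<epsilon> n i)"
        using iid[OF n] that i unfolding iid_row_def by blast
      then show ?thesis using law[OF that] law[OF i] by simp
    qed
    then have "v n = (\<Sum>j=1..n. \<integral>\<omega>. ?g n (\<epsilon> n i \<omega>) \<partial>M n) / real n"
      unfolding v_def by (intro arg_cong2[where f = "(/)"] sum.cong) auto
    then show ?thesis using n by simp
  qed
  ultimately show "\<exists>v. v \<longlonglongrightarrow> 0 \<and> (\<forall>n\<ge>1. \<forall>i\<in>{1..n}. (\<integral>\<omega>. ?g n (\<epsilon> n i \<omega>) \<partial>M n) \<le> v n)"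
    by blast
qed

theorem theorem4:
  fixes M :: "nat \<Rightarrow> 'a measure" and N :: "'b measure"
    and \<epsilon> Y :: "nat \<Rightarrow> nat \<Rightarrow> 'a \<Rightarrow> real" and B :: "real \<Rightarrow> 'b \<Rightarrow> real"
    and t :: "nat \<Rightarrow> nat \<Rightarrow> real" and t\<^sub>0 c\<^sub>0 c\<^sub>1 q :: real
  assumes "0 < t\<^sub>0" "t\<^sub>0 < 1" and "c\<^sub>0 > c\<^sub>1"
    and "\<And>n i. 1 \<le> i \<Longrightarrow> i \<le> n \<Longrightarrow> 0 \<le> t n i \<and> t n i \<le> 1"
    and "\<And>n i j. 1 \<le> i \<Longrightarrow> i \<le> j \<Longrightarrow> j \<le> n \<Longrightarrow> t n i \<le> t n j"
    and "0 < q" "q < 1" and "asymptotic_design t t\<^sub>0 q"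
    and "\<And>n. 1 \<le> n \<Longrightarrow> prob_space (M n)"
    and "\<And>n. 1 \<le> n \<Longrightarrow> iid_row (M n) n (\<epsilon> n)"
    and "\<And>n i. 1 \<le> i \<Longrightarrow> i \<le> n \<Longrightarrow> integrable (M n) (\<epsilon> n i)"
    and "\<And>n i. 1 \<le> i \<Longrightarrow> i \<le> n \<Longrightarrow> prob_space.expectation (M n) (\<epsilon> n i) = 0"
    and "\<And>n i. 1 \<le> i \<Longrightarrow> i \<le> n \<Longrightarrow> prob_space.variance (M n) (\<epsilon> n i) = 1"
    and "lindeberg M \<epsilon>"
    and "\<And>n j \<omega>. 2 \<le> n \<Longrightarrow> 1 \<le> j \<Longrightarrow> j \<le> n \<Longrightarrow> \<omega> \<in> space (M n) \<Longrightarrow>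
      Y n j \<omega> = 1 / sqrt (real n - 1) * jump_function t\<^sub>0 c\<^sub>0 c\<^sub>1 (t n j) + \<epsilon> n j \<omega>"
    and "standard_brownian_motion N B"
  shows "converges_weakly C01
    M (\<lambda>n \<omega>. \<lambda>z\<in>{0..1}. 1 / sqrt (real n - 1) *
      partial_sum (n - 1)
        (\<lambda>i. recursive_residual constant_regression (t n) (\<lambda>j. Y n j \<omega>) (i + 1)) z)
    N (\<lambda>\<omega>. \<lambda>z\<in>{0..1}. limit_drift q c\<^sub>0 c\<^sub>1 z + B z \<omega>)"
proof -
  note t01 = assms(4) and t_mono = assms(5) and q = assms(6,7) and Y = assms(15)
  interpret error_array_bm M \<epsilon> N B
    unfolding error_array_bm_def
    using iid_row_error_array[OF assms(9-14)] assms(16) by (simp add: brownian_def)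
  define X where "X n \<omega> = (\<lambda>z\<in>{0..1}. 1 / sqrt (real n - 1) *
      partial_sum (n - 1) (\<lambda>i. recursive_residual constant_regression (t n) (\<lambda>j. Y n j \<omega>) (i + 1)) z)" for n \<omega>
  define g where "g n j = jump_function t\<^sub>0 c\<^sub>0 c\<^sub>1 (t n j)" for n j
  define H where "H n = interp (n - 1) (\<lambda>i. residual (g n) (Suc i) / (real n - 1))" for n
  define h where "h = limit_drift q c\<^sub>0 c\<^sub>1"
  have hc: "continuous_on {0..1} h" unfolding h_def by (rule continuous_on_limit_drift[OF q(1)])
  have Hc: "continuous_on {0..1} (H n)" for n unfolding H_def by (rule continuous_on_interp)
  define K where "K n = card {i \<in> {1..n}. t n i \<le> t\<^sub>0}" for n
  \<comment> \<open>Monotone design points make the observations before the jump an initial segment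
    of indices, so the mean function becomes a step function of the index alone.\<close>
  have before: "{i \<in> {1..n}. t n i \<le> t\<^sub>0} = {1..K n}" for n
  proof -
    define A where "A = {i \<in> {1..n}. t n i \<le> t\<^sub>0}"
    have down: "i \<in> A" if "j \<in> A" "1 \<le> i" "i \<le> j" for i j
      using that t_mono[of i j n] unfolding A_def by auto
    have A: "finite A" "A \<subseteq> {1..}" unfolding A_def by auto
    have "\<exists>k. A = {1..k}"
    proof (cases "A = {}")
      case True
      then show ?thesis by (intro exI[of _ 0]) simp
    next
      case False
      have "A = {1..Max A}"
      proof
        show "A \<subseteq> {1..Max A}" using A Max_ge[OF A(1)] by auto
        show "{1..Max A} \<subseteq> A" using down[OF Max_in[OF A(1) False]] by auto
      qed
      then show ?thesis by blast
    qed
    then have "A = {1..card A}" by auto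
    then show ?thesis unfolding A_def K_def .
  qed
  have g_step: "g n j = (if j \<le> K n then c\<^sub>0 else c\<^sub>1)" if "1 \<le> j" "j \<le> n" for n j
  proof -
    have "t n j \<le> t\<^sub>0 \<longleftrightarrow> j \<le> K n"
      using before[of n] that by (metis (no_types, lifting) atLeastAtMost_iff mem_Collect_eq)
    then show ?thesis using t01[OF that] unfolding g_def jump_function_def by (auto simp: indicator_def)
  qed
  have Kq: "(\<lambda>n. real (K n) / real n) \<longlonglongrightarrow> q" using assms(8) unfolding asymptotic_design_def K_def .
  have X_eq: "X n \<omega> = (\<lambda>z\<in>{0..1}. H n z + W n \<omega> z)" if n: "n \<ge> 2" and \<omega>: "\<omega> \<in> space (M n)" for n \<omega>
  proof -
    have n1: "real n - 1 > 0" using n by simp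
    have res: "1 / sqrt (real n - 1) * recursive_residual constant_regression (t n) (\<lambda>j. Y n j \<omega>) (Suc i + 1) =
        residual (g n) (Suc i) / (real n - 1) + residual (\<lambda>j. \<epsilon> n j \<omega>) (Suc i) / sqrt (real n - 1)" if i: "i < n - 1" for i
    proof -
      have "recursive_residual constant_regression (t n) (\<lambda>j. Y n j \<omega>) (Suc i + 1) = residual (\<lambda>j. Y n j \<omega>) (Suc i)"
        using t01 i by (subst recursive_residual_constant_regression) (auto simp: residual_def)
      also have "\<dots> = 1 / sqrt (real n - 1) * residual (g n) (Suc i) + residual (\<lambda>j. \<epsilon> n j \<omega>) (Suc i)"
        unfolding g_def using i by (intro residual_linear Y n \<omega>) auto
      finally have "1 / sqrt (real n - 1) * recursive_residual constant_regression (t n) (\<lambda>j. Y n j \<omega>) (Suc i + 1) =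
          (1 / sqrt (real n - 1) * (1 / sqrt (real n - 1))) * residual (g n) (Suc i) +
          residual (\<lambda>j. \<epsilon> n j \<omega>) (Suc i) / sqrt (real n - 1)"
        by (simp add: distrib_left)
      \<comment> \<open>One root comes from the normalisation of the process and the other from the
        local alternative; together they give the scale \<open>1 / (n - 1)\<close> of the
        drift.\<close>
      also have "1 / sqrt (real n - 1) * (1 / sqrt (real n - 1)) = 1 / (real n - 1)" using n1 by simp
      finally show ?thesis by simp
    qed
    show ?thesis
      unfolding X_def H_def W_def
    proof (rule restrict_ext)
      fix z :: real assume "z \<in> {0..1}"
      then have z: "0 \<le> z" "z \<le> 1" by auto
      show "1 / sqrt (real n - 1) *
          partial_sum (n - 1) (\<lambda>i. recursive_residual constant_regression (t n) (\<lambda>j. Y n j \<omega>) (i + 1)) z =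
        interp (n - 1) (\<lambda>i. residual (g n) (Suc i) / (real n - 1)) z +
        interp (n - 1) (\<lambda>i. residual (\<lambda>j. \<epsilon> n j \<omega>) (Suc i) / sqrt (real n - 1)) z"
        unfolding partial_sum_eq_interp[OF z] interp_cmult[symmetric] interp_add[symmetric]
        by (rule fun_cong[OF interp_cong[OF res]])
    qed
  qed
  have mHW: "(\<lambda>\<omega>. \<lambda>z\<in>{0..1}. H n z + W n \<omega> z) \<in> M n \<rightarrow>\<^sub>M borel_metric C01" if "n \<ge> 1" for n
    by (rule measurable_W_plus[OF that Hc])
  have mX: "X n \<in> M n \<rightarrow>\<^sub>M borel_metric C01" if n: "n \<ge> 1" for n
  proof (cases "n = 1")
    \<comment> \<open>The model is specified from \<open>n = 2\<close> on, while measurability is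
      required from \<open>n = 1\<close>; for \<open>n = 1\<close> there are no residuals and the
      path is identically 0.\<close>
    case True
    have "(\<lambda>\<omega>. \<lambda>z\<in>{0..1}. (0::real) + (\<Sum>j<0::nat. 0 * 0)) \<in> M n \<rightarrow>\<^sub>M borel_metric C01"
      by (rule measurable_C01_combination[where m = 0 and V = "\<lambda>_ _. 0" and f = "\<lambda>_. 0" and g = "\<lambda>_ _. 0"]) auto
    then show ?thesis using True by (simp add: X_def[abs_def])
  next
    case False
    then show ?thesis using n X_eq[of n] mHW[OF n] by (subst measurable_cong[of "M n" "X n"]) auto
  qed
  have mhW: "(\<lambda>\<omega>. \<lambda>z\<in>{0..1}. h z + W n \<omega> z) \<in> M n \<rightarrow>\<^sub>M borel_metric C01" if "n \<ge> 1" for n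
    by (rule measurable_W_plus[OF that hc])
  have "converges_weakly C01 M X N (\<lambda>\<omega>. \<lambda>z\<in>{0..1}. h z + B z \<omega>)"
  proof (rule converges_weaklyI_lipschitz[OF prob_space_row N.prob_space_axioms mX measurable_bm_path[OF hc]])
    fix \<phi> :: "(real \<Rightarrow> real) \<Rightarrow> real" and C L
    assume C: "\<And>x. x \<in> mspace C01 \<Longrightarrow> \<bar>\<phi> x\<bar> \<le> C"
      and lip: "\<And>x y. x \<in> mspace C01 \<Longrightarrow> y \<in> mspace C01 \<Longrightarrow> \<bar>\<phi> x - \<phi> y\<bar> \<le> L * mdist C01 x y"
    note cont = continuous_map_lipschitz[OF lip]
    \<comment> \<open>The limiting drift is absorbed into the functional; adding a fixed path does
      not increase the supremum distance, so a Lipschitz bound persists.\<close>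
    define \<psi> where "\<psi> x = \<phi> (\<lambda>z\<in>{0..1}. h z + x z)" for x
    have shift: "(\<lambda>z\<in>{0..1}. h z + x z) \<in> mspace C01" if "x \<in> mspace C01" for x
      using that hc by (intro restrict_in_C01 continuous_on_add) (auto simp: C01_mspace_iff)
    have "(\<lambda>n. \<integral>\<omega>. \<psi> (\<lambda>z\<in>{0..1}. W n \<omega> z) \<partial>M n) \<longlonglongrightarrow> N.expectation (\<lambda>\<omega>. \<psi> (\<lambda>z\<in>{0..1}. B z \<omega>))"
    proof (rule expectation_W_tendsto)
      show "\<bar>\<psi> x\<bar> \<le> C" if "x \<in> mspace C01" for x unfolding \<psi>_def by (rule C[OF shift[OF that]])
      fix x y assume xy: "x \<in> mspace C01" "y \<in> mspace C01"
      have "\<bar>\<psi> x - \<psi> y\<bar> \<le> L * mdist C01 (\<lambda>z\<in>{0..1}. h z + x z) (\<lambda>z\<in>{0..1}. h z + y z)"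
        unfolding \<psi>_def by (intro lip shift xy)
      also have "\<dots> \<le> \<bar>L\<bar> * mdist C01 x y"
        using C01_abs_diff_le[OF xy] by (intro mult_mono C01_mdist_le) auto
      finally show "\<bar>\<psi> x - \<psi> y\<bar> \<le> \<bar>L\<bar> * mdist C01 x y" .
    qed
    then have lim: "(\<lambda>n. \<integral>\<omega>. \<phi> (\<lambda>z\<in>{0..1}. h z + W n \<omega> z) \<partial>M n) \<longlonglongrightarrow> N.expectation (\<lambda>\<omega>. \<phi> (\<lambda>z\<in>{0..1}. h z + B z \<omega>))"
      unfolding \<psi>_def by (simp cong: restrict_cong)
    \<comment> \<open>It remains to exchange the discrete drift for its limit, which changes every
      path by at most the deterministic uniform distance of the two.\<close>
    have "(\<lambda>n. (\<integral>\<omega>. \<phi> (X n \<omega>) \<partial>M n) - (\<integral>\<omega>. \<phi> (\<lambda>z\<in>{0..1}. h z + W n \<omega> z) \<partial>M n)) \<longlonglongrightarrow> 0"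
    proof (rule LIMSEQ_I)
      fix r :: real assume r: "r > 0"
      define e where "e = r / (2 * (\<bar>L\<bar> + 1))"
      have e: "e > 0" using r by (simp add: e_def)
      have eL: "\<bar>L\<bar> * e < r"
      proof -
        have "\<bar>L\<bar> * e \<le> (\<bar>L\<bar> + 1) * e" using e by simp
        also have "\<dots> = r / 2" unfolding e_def by (simp add: field_simps add_nonneg_eq_0_iff)
        finally show ?thesis using r by simp
      qed
      have "\<forall>\<^sub>F n in sequentially. \<forall>z. 0 \<le> z \<and> z \<le> 1 \<longrightarrow> \<bar>H n z - h z\<bar> \<le> e"
        unfolding H_def h_def by (rule drift_tendsto[OF g_step Kq q e])
      then have "\<forall>\<^sub>F n in sequentially.
          norm ((\<integral>\<omega>. \<phi> (X n \<omega>) \<partial>M n) - (\<integral>\<omega>. \<phi> (\<lambda>z\<in>{0..1}. h z + W n \<omega> z) \<partial>M n) - 0) < r"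
        using eventually_ge_at_top[of 2]
      proof eventually_elim
        case (elim n)
        then have n: "n \<ge> 1" by simp
        interpret prob_space "M n" by (rule prob_space_row[OF n])
        \<comment> \<open>The estimate holds on every outcome, so the exceptional event is empty and
          contributes the factor 0.\<close>
        have "\<bar>(\<integral>\<omega>. \<phi> (X n \<omega>) \<partial>M n) - (\<integral>\<omega>. \<phi> (\<lambda>z\<in>{0..1}. h z + W n \<omega> z) \<partial>M n)\<bar> \<le> \<bar>L\<bar> * e + (\<bar>L\<bar> * e) * 0"
        proof (rule expectation_diff_le)
          show "integrable (M n) (\<lambda>\<omega>. \<phi> (X n \<omega>))"
            by (rule integrable_bounded_borel_metric[OF prob_space_axioms mX[OF n] cont C])
          show "integrable (M n) (\<lambda>\<omega>. \<phi> (\<lambda>z\<in>{0..1}. h z + W n \<omega> z))"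
            by (rule integrable_bounded_borel_metric[OF prob_space_axioms mhW[OF n] cont C])
          show close: "\<bar>\<phi> (X n \<omega>) - \<phi> (\<lambda>z\<in>{0..1}. h z + W n \<omega> z)\<bar> \<le> \<bar>L\<bar> * e" if \<omega>: "\<omega> \<in> space (M n)" for \<omega>
          proof -
            have "mdist C01 (X n \<omega>) (\<lambda>z\<in>{0..1}. h z + W n \<omega> z) \<le> e"
              unfolding X_eq[OF elim(2) \<omega>] using elim(1) e by (intro C01_mdist_le) auto
            then have "L * mdist C01 (X n \<omega>) (\<lambda>z\<in>{0..1}. h z + W n \<omega> z) \<le> \<bar>L\<bar> * e"
              by (intro mult_mono) auto
            then show ?thesis
              using lip[OF measurable_in_mspace[OF mX[OF n] \<omega>] measurable_in_mspace[OF mhW[OF n] \<omega>]] by linarith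
          qed
          then show "\<bar>\<phi> (X n \<omega>) - \<phi> (\<lambda>z\<in>{0..1}. h z + W n \<omega> z)\<bar> \<le> \<bar>L\<bar> * e" if "\<omega> \<in> space (M n) - {}" for \<omega>
            using that by simp
        qed (use e in auto)
        then show ?case using eL by simp
      qed
      then show "\<exists>n0. \<forall>n\<ge>n0. norm ((\<integral>\<omega>. \<phi> (X n \<omega>) \<partial>M n) - (\<integral>\<omega>. \<phi> (\<lambda>z\<in>{0..1}. h z + W n \<omega> z) \<partial>M n) - 0) < r"
        unfolding eventually_sequentially .
    qed
    from tendsto_add[OF this lim]
    show "(\<lambda>n. \<integral>\<omega>. \<phi> (X n \<omega>) \<partial>M n) \<longlonglongrightarrow> N.expectation (\<lambda>\<omega>. \<phi> (\<lambda>z\<in>{0..1}. h z + B z \<omega>))"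
      by simp
  qed
  then show ?thesis unfolding X_def[abs_def] h_def .
qed

end
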